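(* Let $\Omega\subseteq\mathbb{R}^2$ be an admissible domain with boundary components $\Gamma_0,\dots,\Gamma_N$ (see context). Let $\boldsymbol{v}\in J^S(\Omega)$ and a scalar $p$ with $p\in W^{1,q}(\Omega)$ for every $q\in[1,2)$ satisfy the steady Euler system $$(\boldsymbol{v}\cdot\nabla)\boldsymbol{v}+\nabla p=\boldsymbol{0},\quad\mathrm{div}\,\boldsymbol{v}=0\ \text{ in }\Omega,\qquad\boldsymbol{v}\cdot\boldsymbol{n}=0\ \text{ on }\partial\Omega.$$ Let $\Phi=p+\frac{|\boldsymbol{v}|^2}{2}$, and let $\widehat\Phi_j$ denote the constant value of the trace $\gamma(\Phi)$ on $\Gamma_j$, $j=0,\dots,N$. Then $$\widehat\Phi_0=\widehat\Phi_1=\cdots=\widehat\Phi_N.$$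
   Context: Domain: $\Omega=\Omega_0\setminus\bigcup_{j=1}^N\overline{\Omega}_j$ with $N\ge1$, where $\Omega_0,\dots,\Omega_N$ are simply connected bounded domains of $\mathbb{R}^2$ with $\overline{\Omega}_j\subseteq\Omega_0$ for $j\ge1$, $\overline{\Omega}_i\cap\overline{\Omega}_j=\emptyset$ for $i\ne j$, $i,j\ge1$, and $\Gamma_j=\partial\Omega_j$ are $C^\infty$-smooth closed curves. Such an $\Omega$ is admissible if (i) it is symmetric with respect to the $x_1$-axis and (ii) each $\Gamma_j$ intersects the $x_1$-axis. A vector field $\boldsymbol{h}=(h_1,h_2)$ is symmetric with respect to the $x_1$-axis if $h_1$ is even in $x_2$ and $h_2$ is odd in $x_2$. $\boldsymbol{n}$ is the unit outer normal to $\partial\Omega$, $\gamma$ the trace operator. $J^S(\Omega)$ is the set of $\boldsymbol{u}\in W^{1,2}(\Omega)$ with $\mathrm{div}\,\boldsymbol{u}=0$ in $\Omega$, $\gamma(\boldsymbol{u})\cdot\boldsymbol{n}=0$ on $\partial\Omega$, that are symmetric with respect to the $x_1$-axis. It is a known fact in this setting (a consequence of the Bernoulli law for Sobolev solutions of the Euler system) that $\gamma(\Phi)$ is almost everywhere equal to a constant on each $\Gamma_j$; this is what makes $\widehat\Phi_j$ well defined. *)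

theory Defs
  imports "HOL-Analysis.Analysis"
begin

section \<open>Smooth functions and smooth closed curves\<close>

fun iterated_deriv ::
  "'a::euclidean_space list \<Rightarrow> ('a \<Rightarrow> 'b::euclidean_space) \<Rightarrow> 'a \<Rightarrow> 'b" where
  "iterated_deriv [] f = f"
| "iterated_deriv (h # hs) f = (\<lambda>x. frechet_derivative (iterated_deriv hs f) (at x) h)"

text \<open>
  If every iterated directional derivative is differentiable, then all of them are continuous,
  so this is the class of infinitely often continuously differentiable functions.
\<close>

definition smooth :: "('a::euclidean_space \<Rightarrow> 'b::euclidean_space) \<Rightarrow> bool" where
  "smooth f \<longleftrightarrow> (\<forall>hs. iterated_deriv hs f differentiable_on UNIV)"

definition smooth_loop :: "(real \<Rightarrow> real^2) \<Rightarrow> bool" where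
  "smooth_loop c \<longleftrightarrow>
     smooth c \<and> (\<forall>t. c (t + 1) = c t) \<and> inj_on c {0..<1} \<and>
     (\<forall>t. vector_derivative c (at t) \<noteq> 0)"

definition smooth_closed_curve :: "(real^2) set \<Rightarrow> bool" where
  "smooth_closed_curve \<Gamma> \<longleftrightarrow> (\<exists>c. smooth_loop c \<and> range c = \<Gamma>)"

text \<open>
  Arc length measure on a smooth closed curve, as a Borel measure on the plane. It does not
  depend on the parametrization that is selected; on other sets it is meaningless.
\<close>

definition arclength :: "(real^2) set \<Rightarrow> (real^2) measure" where
  "arclength \<Gamma> =
     (let c = (SOME c. smooth_loop c \<and> range c = \<Gamma>)
      in distr (density (restrict_space lborel {0..<1})
                 (\<lambda>t. ennreal (norm (vector_derivative c (at t))))) borel c)"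


section \<open>Admissible domains\<close>

definition reflect :: "real^2 \<Rightarrow> real^2" where
  "reflect x = vector [x $ 1, - (x $ 2)]"

definition x1_axis :: "(real^2) set" where
  "x1_axis = {x. x $ 2 = 0}"

text \<open>The domain bounded by \<open>frontier (D 0), \<dots>, frontier (D N)\<close>.\<close>

definition perforated :: "nat \<Rightarrow> (nat \<Rightarrow> (real^2) set) \<Rightarrow> (real^2) set" where
  "perforated N D = D 0 - (\<Union>j\<in>{1..N}. closure (D j))"

definition admissible :: "nat \<Rightarrow> (nat \<Rightarrow> (real^2) set) \<Rightarrow> bool" where
  "admissible N D \<longleftrightarrow>
     1 \<le> N \<and>
     (\<forall>j\<le>N. D j \<noteq> {} \<and> open (D j) \<and> connected (D j) \<and> simply_connected (D j) \<and> bounded (D j) \<and>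
        smooth_closed_curve (frontier (D j))) \<and>
     (\<forall>j\<in>{1..N}. closure (D j) \<subseteq> D 0) \<and>
     (\<forall>i\<in>{1..N}. \<forall>j\<in>{1..N}. i \<noteq> j \<longrightarrow> closure (D i) \<inter> closure (D j) = {}) \<and>
     reflect ` perforated N D = perforated N D \<and>
     (\<forall>j\<le>N. frontier (D j) \<inter> x1_axis \<noteq> {})"

text \<open>The second clause says that \<open>n\<close> is orthogonal to the boundary curve through \<open>x\<close>.\<close>

definition outer_normal :: "(real^2) set \<Rightarrow> real^2 \<Rightarrow> real^2" where
  "outer_normal \<Omega> x =
     (THE n. norm n = 1 \<and>
        (\<forall>c t. smooth_loop c \<and> range c \<subseteq> frontier \<Omega> \<and> c t = x \<longrightarrow>
           n \<bullet> vector_derivative c (at t) = 0) \<and>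
        (\<exists>e>0. \<forall>s. 0 < s \<and> s < e \<longrightarrow> x + s *\<^sub>R n \<notin> closure \<Omega> \<and> x - s *\<^sub>R n \<in> \<Omega>))"


section \<open>Sobolev spaces\<close>

definition partial_deriv :: "2 \<Rightarrow> (real^2 \<Rightarrow> real) \<Rightarrow> real^2 \<Rightarrow> real" where
  "partial_deriv i f x = frechet_derivative f (at x) (axis i 1)"

definition test_function :: "(real^2) set \<Rightarrow> (real^2 \<Rightarrow> real) \<Rightarrow> bool" where
  "test_function \<Omega> \<phi> \<longleftrightarrow>
     smooth \<phi> \<and> compact (closure {x. \<phi> x \<noteq> 0}) \<and> closure {x. \<phi> x \<noteq> 0} \<subseteq> \<Omega>"

definition locally_integrable :: "(real^2) set \<Rightarrow> (real^2 \<Rightarrow> real) \<Rightarrow> bool" where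
  "locally_integrable \<Omega> u \<longleftrightarrow> (\<forall>K. compact K \<and> K \<subseteq> \<Omega> \<longrightarrow> integrable (lebesgue_on K) u)"

definition has_weak_partial ::
  "(real^2) set \<Rightarrow> 2 \<Rightarrow> (real^2 \<Rightarrow> real) \<Rightarrow> (real^2 \<Rightarrow> real) \<Rightarrow> bool" where
  "has_weak_partial \<Omega> i u g \<longleftrightarrow>
     locally_integrable \<Omega> u \<and> locally_integrable \<Omega> g \<and>
     (\<forall>\<phi>. test_function \<Omega> \<phi> \<longrightarrow>
        integral\<^sup>L (lebesgue_on \<Omega>) (\<lambda>x. u x * partial_deriv i \<phi> x) =
        - integral\<^sup>L (lebesgue_on \<Omega>) (\<lambda>x. g x * \<phi> x))"

text \<open>
  A weak derivative, when it exists, is unique up to null sets, and \<open>weak_partial\<close> selects a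
  representative. Therefore all statements about it are made almost everywhere.
\<close>

definition weak_partial :: "(real^2) set \<Rightarrow> 2 \<Rightarrow> (real^2 \<Rightarrow> real) \<Rightarrow> real^2 \<Rightarrow> real" where
  "weak_partial \<Omega> i u = (SOME g. has_weak_partial \<Omega> i u g)"

definition Lq :: "real \<Rightarrow> (real^2) set \<Rightarrow> (real^2 \<Rightarrow> real) set" where
  "Lq q \<Omega> = {u. u \<in> borel_measurable (lebesgue_on \<Omega>) \<and>
                integrable (lebesgue_on \<Omega>) (\<lambda>x. \<bar>u x\<bar> powr q)}"

definition W1 :: "real \<Rightarrow> (real^2) set \<Rightarrow> (real^2 \<Rightarrow> real) set" where
  "W1 q \<Omega> = {u. u \<in> Lq q \<Omega> \<and>
                (\<forall>i. (\<exists>g. has_weak_partial \<Omega> i u g) \<and> weak_partial \<Omega> i u \<in> Lq q \<Omega>)}"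

text \<open>
  \<open>has_trace q \<Omega> u g\<close> says that \<open>g\<close> represents the image of \<open>u\<close> under the trace operator, the
  continuous extension to \<open>W1 q \<Omega>\<close> of the map that restricts a smooth function to the boundary.
  For a bounded domain whose boundary consists of finitely many disjoint smooth closed curves,
  these curves are the connected components of the boundary, every \<open>u\<close> in \<open>W1 q \<Omega>\<close> has a trace
  for \<open>q \<ge> 1\<close>, the trace is unique almost everywhere, and it is the same for every \<open>q\<close> such
  that \<open>u\<close> is in \<open>W1 q \<Omega>\<close>.
\<close>

definition has_trace ::
  "real \<Rightarrow> (real^2) set \<Rightarrow> (real^2 \<Rightarrow> real) \<Rightarrow> (real^2 \<Rightarrow> real) \<Rightarrow> bool" where
  "has_trace q \<Omega> u g \<longleftrightarrow>
     u \<in> W1 q \<Omega> \<and>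
     (\<forall>\<Gamma>\<in>components (frontier \<Omega>). g \<in> borel_measurable (arclength \<Gamma>)) \<and>
     (\<exists>w :: nat \<Rightarrow> real^2 \<Rightarrow> real.
        (\<forall>k. smooth (w k)) \<and>
        (\<lambda>k. \<integral>\<^sup>+ x. ennreal (\<bar>w k x - u x\<bar> powr q) \<partial>lebesgue_on \<Omega>) \<longlonglongrightarrow> 0 \<and>
        (\<forall>i. (\<lambda>k. \<integral>\<^sup>+ x. ennreal (\<bar>partial_deriv i (w k) x - weak_partial \<Omega> i u x\<bar> powr q)
                    \<partial>lebesgue_on \<Omega>) \<longlonglongrightarrow> 0) \<and>
        (\<forall>\<Gamma>\<in>components (frontier \<Omega>).
           (\<lambda>k. \<integral>\<^sup>+ x. ennreal (\<bar>w k x - g x\<bar> powr q) \<partial>arclength \<Gamma>) \<longlonglongrightarrow> 0))"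


section \<open>Vector fields and the steady Euler system\<close>

definition div_free :: "(real^2) set \<Rightarrow> (real^2 \<Rightarrow> real^2) \<Rightarrow> bool" where
  "div_free \<Omega> v \<longleftrightarrow>
     (AE x in lebesgue_on \<Omega>. (\<Sum>i\<in>UNIV. weak_partial \<Omega> i (\<lambda>y. v y $ i) x) = 0)"

definition zero_normal_trace :: "(real^2) set \<Rightarrow> (real^2 \<Rightarrow> real^2) \<Rightarrow> bool" where
  "zero_normal_trace \<Omega> v \<longleftrightarrow>
     (\<exists>g :: real^2 \<Rightarrow> real^2.
        (\<forall>i. has_trace 2 \<Omega> (\<lambda>x. v x $ i) (\<lambda>x. g x $ i)) \<and>
        (\<forall>\<Gamma>\<in>components (frontier \<Omega>). AE x in arclength \<Gamma>. g x \<bullet> outer_normal \<Omega> x = 0))"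

definition symmetric_field :: "(real^2) set \<Rightarrow> (real^2 \<Rightarrow> real^2) \<Rightarrow> bool" where
  "symmetric_field \<Omega> v \<longleftrightarrow>
     (AE x in lebesgue_on \<Omega>. v (reflect x) $ 1 = v x $ 1 \<and> v (reflect x) $ 2 = - (v x $ 2))"

definition JS :: "(real^2) set \<Rightarrow> (real^2 \<Rightarrow> real^2) set" where
  "JS \<Omega> = {v. (\<forall>i. (\<lambda>x. v x $ i) \<in> W1 2 \<Omega>) \<and> div_free \<Omega> v \<and> zero_normal_trace \<Omega> v \<and>
              symmetric_field \<Omega> v}"

definition steady_euler ::
  "(real^2) set \<Rightarrow> (real^2 \<Rightarrow> real^2) \<Rightarrow> (real^2 \<Rightarrow> real) \<Rightarrow> bool" where
  "steady_euler \<Omega> v p \<longleftrightarrow>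
     (AE x in lebesgue_on \<Omega>. \<forall>i.
        (\<Sum>j\<in>UNIV. v x $ j * weak_partial \<Omega> j (\<lambda>y. v y $ i) x) + weak_partial \<Omega> i p x = 0) \<and>
     div_free \<Omega> v \<and> zero_normal_trace \<Omega> v"

definition total_head :: "(real^2 \<Rightarrow> real^2) \<Rightarrow> (real^2 \<Rightarrow> real) \<Rightarrow> real^2 \<Rightarrow> real" where
  "total_head v p x = p x + (norm (v x))\<^sup>2 / 2"

end

theory Submission
  imports Defs "HOL-Analysis.Analysis"
begin

text \<open>
  Write \<open>\<omega>\<close> for the vorticity \<open>\<partial>\<^sub>1 v\<^sub>2 - \<partial>\<^sub>2 v\<^sub>1\<close>. The Euler system gives \<open>\<partial>\<^sub>1 \<Phi> = v\<^sub>2 \<omega>\<close>, and \<open>v\<^sub>2\<close>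
  is odd in \<open>x\<^sub>2\<close>, so it vanishes on the axis of symmetry, which all the boundary curves meet:
  formally, \<open>\<Phi>\<close> is constant along the axis, and passing from hole to hole along the axis one
  finds the same boundary value on every curve. A weak derivative has no values on the axis, so the
  proof estimates the integral of \<open>\<bar>\<partial>\<^sub>1 \<Phi>\<bar>\<close> over the strips \<open>\<bar>x\<^sub>2\<bar> < e\<close> from both sides as \<open>e\<close> tends
  to 0.

  Lower bound (\<open>head_jump_le_strip_integral\<close>). If some boundary value differs from the outer one,
  then every horizontal line at small height on at least one side of the axis contains a
  segment in \<open>\<Omega>\<close> that leads from a hole with a different value to a curve with the outer value.
  On it \<open>\<Phi>\<close> jumps by a fixed amount, so the integral of \<open>\<bar>\<partial>\<^sub>1 \<Phi>\<bar>\<close> over the strip is at least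
  \<open>\<delta> e\<close>. This is proved for the smooth functions that approximate \<open>\<Phi>\<close>; the heights at which such
  a function is far from the boundary value somewhere on a curve form a set whose measure is
  controlled by an integral over the curve (\<open>emeasure_bad_heights\<close>), so they are negligible in
  the limit.

  Upper bound. By Cauchy and Schwarz, the same integral is at most the \<open>L\<^sup>2\<close> norm of \<open>v\<^sub>2\<close> on the
  strip times that of \<open>\<omega>\<close> on the strip. The second factor tends to 0 because the strips shrink to
  a null set. The first is \<open>O(e)\<close>, by a Poincare inequality for functions that vanish on the axis
  (\<open>poincare_near_axis\<close>, \<open>odd_W12_strip_estimate\<close>). Vertical segments may leave \<open>\<Omega>\<close> near a
  boundary curve; but the curves cross the axis transversally
  (\<open>axis_crossing_transversal\<close>, another consequence of symmetry), and horizontal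
  translates of the boundary curve itself replace the vertical segments. So the integral
  is \<open>o(e)\<close>, which contradicts the lower bound.

  The identity for \<open>\<partial>\<^sub>1 \<Phi>\<close> holds for an arbitrary choice of weak derivatives
  (\<open>head_derivative_eq_vorticity_times_velocity\<close>). That rests on the product rule for squares of
  \<open>W\<^sup>1\<^sup>,\<^sup>2\<close> functions and on the uniqueness of weak derivatives, hence on the fundamental lemma
  of the calculus of variations with explicit smooth bump functions.
\<close>

section \<open>Smooth functions\<close>

text \<open>
  Smoothness is a coinductive notion: it holds for all members of a class of differentiable
  functions that is closed under directional derivatives.
\<close>

lemma smooth_coinduct:
  assumes "f \<in> S"
    and "\<And>g. g \<in> S \<Longrightarrow> g differentiable_on UNIV"
    and "\<And>g h. g \<in> S \<Longrightarrow> (\<lambda>x. frechet_derivative g (at x) h) \<in> S"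
  shows "smooth f"
proof -
  have "iterated_deriv hs f \<in> S" for hs
    by (induction hs) (auto simp: assms)
  then show ?thesis
    unfolding smooth_def using assms(2) by blast
qed

lemma smooth_has_derivative:
  assumes "smooth f"
  shows "(f has_derivative frechet_derivative f (at x)) (at x)"
proof -
  have "iterated_deriv [] f differentiable_on UNIV"
    using assms unfolding smooth_def by blast
  then show ?thesis
    by (simp add: differentiable_on_def frechet_derivative_works)
qed

lemma iterated_deriv_snoc:
  "iterated_deriv hs (\<lambda>x. frechet_derivative f (at x) h) = iterated_deriv (hs @ [h]) f"
  by (induction hs) auto

lemma smooth_directional_derivative:
  "smooth f \<Longrightarrow> smooth (\<lambda>x. frechet_derivative f (at x) h)"
  unfolding smooth_def by (metis iterated_deriv_snoc)

lemma smooth_continuous: "smooth f \<Longrightarrow> continuous_on A f"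
  by (meson continuous_at_imp_continuous_on has_derivative_continuous smooth_has_derivative)

text \<open>
  The Leibniz rule leads out of the class of products, but not out of their finite sums; this
  is the closed class that shows a product of smooth functions to be smooth.
\<close>

inductive_set sums_of_smooth_products :: "('a::euclidean_space \<Rightarrow> real) set" where
  prod: "smooth f \<Longrightarrow> smooth g \<Longrightarrow> (\<lambda>x. f x * g x) \<in> sums_of_smooth_products"
| add: "f \<in> sums_of_smooth_products \<Longrightarrow> g \<in> sums_of_smooth_products \<Longrightarrow>
    (\<lambda>x. f x + g x) \<in> sums_of_smooth_products"

lemma sums_of_smooth_products_derivative:
  assumes "f \<in> sums_of_smooth_products"
  shows "(\<forall>x. (f has_derivative frechet_derivative f (at x)) (at x)) \<and>
         (\<lambda>x. frechet_derivative f (at x) h) \<in> sums_of_smooth_products"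
  using assms
proof induction
  case (prod f g)
  have d: "((\<lambda>x. f x * g x) has_derivative
      (\<lambda>h. f x * frechet_derivative g (at x) h + frechet_derivative f (at x) h * g x)) (at x)" for x
    by (intro has_derivative_mult smooth_has_derivative prod)
  have "(\<lambda>x. frechet_derivative (\<lambda>x. f x * g x) (at x) h) =
      (\<lambda>x. f x * frechet_derivative g (at x) h + frechet_derivative f (at x) h * g x)"
    using frechet_derivative_at[OF d] by (auto simp: fun_eq_iff)
  then show ?case
    using d by (auto intro!: sums_of_smooth_products.intros smooth_directional_derivative prod
        simp: frechet_derivative_at[OF d, symmetric])
next
  case (add f g)
  have d: "((\<lambda>x. f x + g x) has_derivative
      (\<lambda>h. frechet_derivative f (at x) h + frechet_derivative g (at x) h)) (at x)" for x
    using add.IH by (intro has_derivative_add) auto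
  have "(\<lambda>x. frechet_derivative (\<lambda>x. f x + g x) (at x) h) =
      (\<lambda>x. frechet_derivative f (at x) h + frechet_derivative g (at x) h)"
    using frechet_derivative_at[OF d] by (auto simp: fun_eq_iff)
  then show ?case
    using d add.IH by (auto intro!: sums_of_smooth_products.add
        simp: frechet_derivative_at[OF d, symmetric])
qed

lemma smooth_mult:
  fixes f g :: "'a::euclidean_space \<Rightarrow> real"
  assumes "smooth f" "smooth g"
  shows "smooth (\<lambda>x. f x * g x)"
proof (rule smooth_coinduct)
  show "(\<lambda>x. f x * g x) \<in> sums_of_smooth_products"
    by (rule sums_of_smooth_products.prod[OF assms])
qed (use sums_of_smooth_products_derivative in
      \<open>auto simp: differentiable_on_def differentiable_def\<close>)

text \<open>
  The functions \<open>P (1/s) exp (-1/s)\<close>, continued by 0 to \<open>s \<le> 0\<close>, with all derivatives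
  vanishing at 0. Keeping the polynomial \<open>P\<close> as a parameter makes the class closed under
  differentiation; \<open>flat 1\<close> is the standard smooth function that is positive exactly on the
  positive half line.
\<close>

definition flat :: "real poly \<Rightarrow> real \<Rightarrow> real" where
  "flat P s = (if s > 0 then poly P (1 / s) * exp (- (1 / s)) else 0)"

lemma poly_times_exp_tendsto_0: "((\<lambda>x. poly P x * exp (- x)) \<longlongrightarrow> (0::real)) at_top"
proof -
  have "((\<lambda>x. \<Sum>i\<le>degree P. coeff P i * (x ^ i / exp x)) \<longlongrightarrow> (\<Sum>i\<le>degree P. coeff P i * 0)) at_top"
    by (intro tendsto_intros tendsto_power_div_exp_0)
  then show ?thesis
    by (simp add: poly_altdef sum_distrib_right exp_minus field_simps sum_divide_distrib)
qed

lemma flat_has_derivative: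
  "(flat P has_real_derivative flat ([:0, 0, 1:] * (P - pderiv P)) s) (at s)"
proof -
  consider "s < 0" | "s = 0" | "s > 0" by linarith
  then show ?thesis
  proof cases
    case 1
    have "((\<lambda>_. 0) has_real_derivative 0) (at s)" by simp
    then have "(flat P has_real_derivative 0) (at s)"
      by (rule has_field_derivative_transform_within_open[where S = "{..<0}"]) (use 1 in \<open>auto simp: flat_def\<close>)
    then show ?thesis using 1 by (simp add: flat_def)
  next
    case 3
    have "((\<lambda>s. poly P (1 / s) * exp (- (1 / s))) has_real_derivative
        flat ([:0, 0, 1:] * (P - pderiv P)) s) (at s)"
      unfolding flat_def using 3
      by (auto intro!: derivative_eq_intros poly_DERIV[THEN DERIV_chain2] simp: field_simps power2_eq_square)
    then show ?thesis
      by (rule has_field_derivative_transform_within_open[where S = "{0<..}"]) (use 3 in \<open>auto simp: flat_def\<close>)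
  next
    case 2
    have "((\<lambda>h. poly (pCons 0 P) (inverse h) * exp (- (inverse h))) \<longlongrightarrow> 0) (at_right 0)"
      by (rule filterlim_compose[OF poly_times_exp_tendsto_0 filterlim_inverse_at_top_right])
    then have "((\<lambda>h. flat P h / h) \<longlongrightarrow> 0) (at_right 0)"
      by (rule Lim_transform_eventually)
       (auto simp: flat_def field_simps inverse_eq_divide intro!: eventually_at_rightI[of 0 1])
    moreover have "((\<lambda>h. flat P h / h) \<longlongrightarrow> 0) (at_left 0)"
      by (rule tendsto_eventually) (auto simp: flat_def intro!: eventually_at_leftI[of "-1"])
    ultimately have "((\<lambda>h. flat P h / h) \<longlongrightarrow> 0) (at 0)"
      by (simp add: filterlim_at_split)
    then show ?thesis
      using 2 by (simp add: DERIV_def flat_def)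
  qed
qed

lemma smooth_flat_affine: "smooth (\<lambda>x. flat P (u \<bullet> x + b))"
proof (rule smooth_coinduct[of _ "{\<lambda>x. a * flat P (u \<bullet> x + b) | a P. True}"])
  show "(\<lambda>x. flat P (u \<bullet> x + b)) \<in> {\<lambda>x. a * flat P (u \<bullet> x + b) |a P. True}"
    by (auto intro!: exI[of _ 1] exI[of _ P])
next
  fix g h assume "g \<in> {\<lambda>x. a * flat P (u \<bullet> x + b) |a P. True}"
  then obtain a P where g: "g = (\<lambda>x. a * flat P (u \<bullet> x + b))" by blast
  let ?Q = "[:0, 0, 1:] * (P - pderiv P)"
  have d: "(g has_derivative (\<lambda>h. a * (flat ?Q (u \<bullet> x + b) * (u \<bullet> h)))) (at x)" for x
    unfolding g
    by (intro has_derivative_mult_right has_derivative_compose[of "\<lambda>x. u \<bullet> x + b", OF _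
          flat_has_derivative[unfolded has_field_derivative_def]])
      (auto intro!: derivative_eq_intros)
  then show "g differentiable_on UNIV"
    by (auto simp: differentiable_on_def differentiable_def)
  show "(\<lambda>x. frechet_derivative g (at x) h) \<in> {\<lambda>x. a * flat P (u \<bullet> x + b) |a P. True}"
    unfolding frechet_derivative_at[OF d, symmetric] mem_Collect_eq
    by (intro exI[of _ "a * (u \<bullet> h)"] exI[of _ ?Q]) (simp add: mult_ac)
qed

section \<open>Bump functions and the fundamental lemma of the calculus of variations\<close>

text \<open>
  Since \<open>flat 1 (n s)\<close> tends to 1 for \<open>s > 0\<close>, these bumps converge, boundedly, to the
  indicator of the open box.
\<close>

definition bump :: "nat \<Rightarrow> real^2 \<Rightarrow> real^2 \<Rightarrow> real^2 \<Rightarrow> real" where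
  "bump n l u x =
     flat 1 (real (Suc n) * (x$1 - l$1)) * (flat 1 (real (Suc n) * (u$1 - x$1)) *
     (flat 1 (real (Suc n) * (x$2 - l$2)) * flat 1 (real (Suc n) * (u$2 - x$2))))"

lemma smooth_bump: "smooth (bump n l u)"
proof -
  have 1: "smooth (\<lambda>x::real^2. flat 1 (real (Suc n) * (x$i - a)))" for i a
    using smooth_flat_affine[of 1 "real (Suc n) *\<^sub>R axis i 1" "- (real (Suc n) * a)"]
    by (simp add: cart_eq_inner_axis inner_commute algebra_simps)
  have 2: "smooth (\<lambda>x::real^2. flat 1 (real (Suc n) * (a - x$i)))" for i a
    using smooth_flat_affine[of 1 "- real (Suc n) *\<^sub>R axis i 1" "real (Suc n) * a"]
    by (simp add: cart_eq_inner_axis inner_commute algebra_simps)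
  show ?thesis
    unfolding bump_def by (intro smooth_mult 1 2)
qed

lemma flat_one_bounds: "0 \<le> flat 1 s" "flat 1 s \<le> 1" "flat 1 s \<noteq> 0 \<longleftrightarrow> s > 0"
  by (auto simp: flat_def)

lemma flat_one_tendsto: "(\<lambda>n. flat 1 (real (Suc n) * s)) \<longlonglongrightarrow> (if s > 0 then 1 else 0)"
proof (cases "s > 0")
  case True
  have "(\<lambda>n. exp (- (inverse (real (Suc n)) * inverse s))) \<longlonglongrightarrow> exp (- (0 * inverse s))"
    by (intro tendsto_intros LIMSEQ_inverse_real_of_nat)
  then show ?thesis
    using True by (simp add: flat_def inverse_eq_divide)
next
  case False
  then have "flat 1 (real (Suc n) * s) = 0" for n
    using flat_one_bounds(3) by (metis (no_types, lifting) of_nat_0_less_iff zero_less_Suc zero_less_mult_pos)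
  then show ?thesis using False by simp
qed

lemma mem_box_2: "x \<in> box l u \<longleftrightarrow> l$1 < x$1 \<and> x$1 < u$1 \<and> l$2 < x$2 \<and> x$2 < u$2" for x l u :: "real^2"
  by (auto simp: mem_box_cart forall_2)

lemma bump_nonneg: "0 \<le> bump n l u x"
  unfolding bump_def by (intro mult_nonneg_nonneg flat_one_bounds)

lemma bump_le_1: "bump n l u x \<le> 1"
  unfolding bump_def by (intro mult_le_one mult_nonneg_nonneg flat_one_bounds)

lemma bump_support: "{x. bump n l u x \<noteq> 0} = box l u"
  unfolding bump_def mult_eq_0_iff de_Morgan_disj flat_one_bounds(3) set_eq_iff mem_Collect_eq mem_box_2
  by (simp add: zero_less_mult_iff del: of_nat_Suc) 

lemma bump_tendsto: "(\<lambda>n. bump n l u x) \<longlonglongrightarrow> indicator (box l u) x"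
proof -
  have "(\<lambda>n. bump n l u x) \<longlonglongrightarrow>
      (if x$1 - l$1 > 0 then 1 else 0) * ((if u$1 - x$1 > 0 then 1 else 0) *
      ((if x$2 - l$2 > 0 then 1 else 0) * (if u$2 - x$2 > 0 then 1 else 0)))"
    unfolding bump_def by (intro tendsto_mult flat_one_tendsto)
  then show ?thesis
    by (simp add: indicator_def mem_box_2 split: if_splits)
qed

lemma measurable_bump: "bump n l u \<in> borel_measurable lebesgue"
  unfolding measurable_lborel1[symmetric]
  by (intro measurable_completion) (simp add: borel_measurable_continuous_onI smooth_bump smooth_continuous)

lemma test_function_bump:
  assumes "cbox l u \<subseteq> \<Omega>"
  shows "test_function \<Omega> (bump n l u)"
proof -
  have "closure (box l u) \<subseteq> cbox l u"
    by (intro closure_minimal box_subset_cbox closed_cbox)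
  then show ?thesis
    using assms unfolding test_function_def bump_support
    by (auto simp: smooth_bump compact_closure bounded_box)
qed

lemma lebesgue_set_inner:
  assumes "A \<in> sets lebesgue"
  obtains B where "B \<in> sets borel" "B \<subseteq> A" "A - B \<in> null_sets lebesgue"
proof
  show "main_part lborel A \<in> sets borel"
    using main_part_sets[OF assms] by simp
  show "main_part lborel A \<subseteq> A"
    using main_part_null_part_Un[OF assms] by blast
  obtain N where N: "N \<in> null_sets lborel" "null_part lborel A \<subseteq> N"
    using null_part[OF assms] by blast
  have "A - main_part lborel A \<subseteq> N"
    using main_part_null_part_Un[OF assms] N(2) by blast
  then show "A - main_part lborel A \<in> null_sets lebesgue"
    using null_sets_completionI[OF N(1)] null_sets_completion_subset by blast
qed

text \<open>
  The sets on which \<open>d\<close> integrates to 0 form a Dynkin system, and the boxes are an intersection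
  stable generator of the Borel sets.
\<close>

lemma zero_integral_boxes_imp_AE_zero:
  fixes d :: "real^2 \<Rightarrow> real"
  assumes d: "integrable lebesgue d"
    and box: "\<And>l u. (LINT x|lebesgue. indicator (box l u) x * d x) = 0"
  shows "AE x in lebesgue. d x = 0"
proof -
  have int: "set_integrable lebesgue A d" if "A \<in> sets lebesgue" for A
    using integrable_mult_indicator[OF that d] by (simp add: set_integrable_def)
  have all: "(LINT x|lebesgue. d x) = 0"
  proof -
    have "(\<lambda>n. LINT x|lebesgue. indicator (box (\<chi> i. - real n) (\<chi> i. real n)) x * d x)
        \<longlonglongrightarrow> (LINT x|lebesgue. d x)"
    proof (rule integral_dominated_convergence)
      show "integrable lebesgue (\<lambda>x. \<bar>d x\<bar>)" using d by simp
      show "AE x in lebesgue. (\<lambda>n. indicator (box (\<chi> i. - real n) (\<chi> i. real n)) x * d x) \<longlonglongrightarrow> d x"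
      proof (intro AE_I2 tendsto_eventually)
        fix x :: "real^2"
        obtain n :: nat where n: "norm x < n" using reals_Archimedean2 by blast
        have "x \<in> box (\<chi> i. - real m) (\<chi> i. real m)" if "m \<ge> n" for m
        proof -
          have "\<bar>x $ i\<bar> < real m" for i
            using component_le_norm_cart[of x i] n that by linarith
          then show ?thesis by (auto simp: mem_box_2 abs_less_iff minus_less_iff)
        qed
        then show "\<forall>\<^sub>F n in sequentially. indicator (box (\<chi> i. - real n) (\<chi> i. real n)) x * d x = d x"
          by (auto intro!: eventually_sequentiallyI[of n])
      qed
    qed (use d in \<open>auto intro!: borel_measurable_times borel_measurable_indicator split: split_indicator\<close>)
    then show ?thesis
      using box by (simp add: LIMSEQ_const_iff)
  qed
  have sigma_eq: "sets (borel :: (real^2) measure) = sigma_sets UNIV (range (\<lambda>(a, b). box a b))"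
    by (simp add: borel_eq_box)
  have borel: "set_lebesgue_integral lebesgue A d = 0" if "A \<in> sets borel" for A
  proof -
    have "A \<in> sigma_sets UNIV (range (\<lambda>(a, b). box a b :: (real^2) set))"
      using that sigma_eq by simp
    moreover have "Int_stable (range (\<lambda>(a, b). box a b :: (real^2) set))"
    proof (rule Int_stableI)
      fix A B :: "(real^2) set" assume "A \<in> range (\<lambda>(a, b). box a b)" "B \<in> range (\<lambda>(a, b). box a b)"
      then obtain a b c d where "A = box a b" "B = box c d" by auto
      then show "A \<inter> B \<in> range (\<lambda>(a, b). box a b)"
        using rangeI[of "\<lambda>(a, b). box a b :: (real^2) set"
            "(\<Sum>i\<in>Basis. max (a \<bullet> i) (c \<bullet> i) *\<^sub>R i, \<Sum>i\<in>Basis. min (b \<bullet> i) (d \<bullet> i) *\<^sub>R i)"]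
        unfolding \<open>A = box a b\<close> \<open>B = box c d\<close> box_Int_box by simp
    qed
    moreover have "range (\<lambda>(a, b). box a b :: (real^2) set) \<subseteq> Pow UNIV" by simp
    ultimately have "Int_stable (range (\<lambda>(a, b). box a b :: (real^2) set))"
      "range (\<lambda>(a, b). box a b :: (real^2) set) \<subseteq> Pow UNIV"
      "A \<in> sigma_sets UNIV (range (\<lambda>(a, b). box a b :: (real^2) set))" by blast+
    then show ?thesis
    proof (induction rule: sigma_sets_induct_disjoint)
      case (basic A)
      then show ?case using box by (auto simp: set_lebesgue_integral_def)
    next
      case empty
      then show ?case by (simp add: set_lebesgue_integral_def)
    next
      case (compl A)
      then have A: "A \<in> sets lebesgue" using sigma_eq sets_completionI_sets[of A lborel] by simp
      have "set_lebesgue_integral lebesgue (UNIV - A) d + set_lebesgue_integral lebesgue A d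
          = set_lebesgue_integral lebesgue UNIV d"
        using A by (subst set_integral_Un[symmetric]) (auto intro!: int simp: Un_commute)
      then show ?case using compl all by (simp add: set_lebesgue_integral_def)
    next
      case (union A)
      then have A: "A i \<in> sets lebesgue" for i
        using range_subsetD[OF union(2), of i] sets_completionI_sets[of "A i" lborel] unfolding sigma_eq[symmetric] by simp
      show ?case
        by (subst lebesgue_integral_countable_add)
          (use union A in \<open>auto simp: disjoint_family_on_def intro!: int sets.countable_UN\<close>)
    qed
  qed
  show ?thesis
  proof (rule density_unique_real[OF d])
    show "integrable lebesgue (\<lambda>_. 0 :: real)" by simp
  next
    fix A :: "(real^2) set" assume A: "A \<in> sets lebesgue"
    then obtain B where B: "B \<in> sets borel" "B \<subseteq> A" "A - B \<in> null_sets lebesgue"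
      by (rule lebesgue_set_inner)
    have "set_lebesgue_integral lebesgue A d = set_lebesgue_integral lebesgue B d"
      unfolding set_lebesgue_integral_def
    proof (intro integral_cong_AE)
      have "AE x in lebesgue. x \<notin> A - B"
        using B(3) by (rule AE_not_in)
      then show "AE x in lebesgue. indicat_real A x *\<^sub>R d x = indicat_real B x *\<^sub>R d x"
        by eventually_elim (use B(2) in \<open>auto simp: indicator_def\<close>)
    qed (use A sets_completionI_sets[of B lborel] B(1) in
        \<open>auto intro!: borel_measurable_times borel_measurable_indicator borel_measurable_integrable[OF d]\<close>)
    then show "set_lebesgue_integral lebesgue A d = set_lebesgue_integral lebesgue A (\<lambda>_. 0)"
      using borel[OF B(1)] by (simp add: set_lebesgue_integral_def)
  qed
qed

lemma AE_lebesgue_on_iff: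
  "S \<in> sets lebesgue \<Longrightarrow> (AE x in lebesgue_on S. P x) \<longleftrightarrow> (AE x in lebesgue. x \<in> S \<longrightarrow> P x)"
  by (simp add: AE_restrict_space_iff)

text \<open>
  Testing with bumps, which converge to indicators of boxes, shows that \<open>d\<close> has integral 0 over
  every box in \<open>\<Omega>\<close>; and \<open>\<Omega>\<close> is a countable union of boxes.
\<close>

lemma fundamental_lemma_calculus_of_variations:
  fixes d :: "real^2 \<Rightarrow> real"
  assumes "open \<Omega>"
    and d: "locally_integrable \<Omega> d"
    and test: "\<And>\<phi>. test_function \<Omega> \<phi> \<Longrightarrow> integral\<^sup>L (lebesgue_on \<Omega>) (\<lambda>x. d x * \<phi> x) = 0"
  shows "AE x in lebesgue_on \<Omega>. d x = 0"
proof -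
  have cb: "AE x in lebesgue. x \<in> cbox a b \<longrightarrow> d x = 0" if ab: "cbox a b \<subseteq> \<Omega>" for a b
  proof -
    have "integrable (lebesgue_on (cbox a b)) d"
      by (intro d[unfolded locally_integrable_def, rule_format] conjI compact_cbox ab)
    then have di: "integrable lebesgue (\<lambda>x. indicator (cbox a b) x * d x)"
      using integrable_restrict_space[of "cbox a b" lebesgue d] by simp
    have "AE x in lebesgue. indicator (cbox a b) x * d x = 0"
    proof (rule zero_integral_boxes_imp_AE_zero[OF di])
      fix l u :: "real^2"
      \<comment> \<open>The intersection of the two boxes, so that its bumps are supported in \<open>cbox a b\<close>.\<close>
      define l' where "l' = (\<chi> i. max (l$i) (a$i))"
      define u' where "u' = (\<chi> i. min (u$i) (b$i))"
      have sub: "cbox l' u' \<subseteq> cbox a b"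
        by (simp add: subset_iff mem_box_cart l'_def u'_def)
      have boxeq: "box l u \<inter> box a b = box l' u'"
        by (auto simp: mem_box_2 l'_def u'_def)
      have lim: "(\<lambda>n. LINT x|lebesgue. bump n l' u' x * (indicator (cbox a b) x * d x))
          \<longlonglongrightarrow> (LINT x|lebesgue. indicator (box l' u') x * (indicator (cbox a b) x * d x))"
      proof (rule integral_dominated_convergence)
        show "integrable lebesgue (\<lambda>x. \<bar>indicator (cbox a b) x * d x\<bar>)" using di by simp
        show "(\<lambda>x. bump n l' u' x * (indicator (cbox a b) x * d x)) \<in> borel_measurable lebesgue" for n
          by (intro borel_measurable_times measurable_bump borel_measurable_integrable[OF di])
        show "AE x in lebesgue. norm (bump n l' u' x * (indicator (cbox a b) x * d x))
            \<le> \<bar>indicator (cbox a b) x * d x\<bar>" for n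
          by (intro AE_I2) (simp add: abs_mult bump_nonneg bump_le_1 mult_left_le_one_le)
        show "AE x in lebesgue. (\<lambda>n. bump n l' u' x * (indicator (cbox a b) x * d x))
            \<longlonglongrightarrow> indicator (box l' u') x * (indicator (cbox a b) x * d x)"
          by (intro AE_I2 tendsto_mult bump_tendsto tendsto_const)
      qed (auto intro!: borel_measurable_times borel_measurable_indicator borel_measurable_integrable[OF di])
      have "(LINT x|lebesgue. bump n l' u' x * (indicator (cbox a b) x * d x)) = 0" for n
      proof -
        have sup: "bump n l' u' x = 0" if "x \<notin> cbox a b" for x
          using bump_support[of n l' u'] box_subset_cbox[of l' u'] sub that by blast
        have "(LINT x|lebesgue. bump n l' u' x * (indicator (cbox a b) x * d x))
            = (LINT x|lebesgue. indicator \<Omega> x *\<^sub>R (d x * bump n l' u' x))"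
          by (intro Bochner_Integration.integral_cong) (use sup ab in \<open>auto simp: indicator_def\<close>)
        also have "\<dots> = integral\<^sup>L (lebesgue_on \<Omega>) (\<lambda>x. d x * bump n l' u' x)"
          using \<open>open \<Omega>\<close> by (simp add: integral_restrict_space)
        also have "\<dots> = 0"
          by (rule test[OF test_function_bump[OF order_trans[OF sub ab]]])
        finally show ?thesis .
      qed
      then have "(LINT x|lebesgue. indicator (box l' u') x * (indicator (cbox a b) x * d x)) = 0"
        using lim by (simp add: LIMSEQ_const_iff)
      moreover have "(LINT x|lebesgue. indicator (box l' u') x * (indicator (cbox a b) x * d x))
          = (LINT x|lebesgue. indicator (box l u) x * (indicator (cbox a b) x * d x))"
      proof (rule integral_cong_AE)
        have "AE x in lebesgue. x \<notin> cbox a b - box a b"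
          using negligible_frontier_interval[of a b] by (intro AE_not_in) (simp add: negligible_iff_null_sets)
        then show "AE x in lebesgue. indicator (box l' u') x * (indicator (cbox a b) x * d x)
            = indicator (box l u) x * (indicator (cbox a b) x * d x)"
          by eventually_elim (use boxeq in \<open>auto simp: indicator_def\<close>)
      qed (auto intro!: borel_measurable_times borel_measurable_indicator borel_measurable_integrable[OF di])
      ultimately show "(LINT x|lebesgue. indicator (box l u) x * (indicator (cbox a b) x * d x)) = 0"
        by simp
    qed
    then show ?thesis by eventually_elim (auto simp: indicator_def)
  qed
  obtain \<D> where \<D>: "countable \<D>" "\<D> \<subseteq> Pow \<Omega>" "\<And>X. X \<in> \<D> \<Longrightarrow> \<exists>a b. X = cbox a b" "\<Union>\<D> = \<Omega>"
    using open_countable_Union_open_cbox[OF \<open>open \<Omega>\<close>] by metis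
  have "AE x in lebesgue. \<forall>X\<in>\<D>. x \<in> X \<longrightarrow> d x = 0"
    unfolding AE_ball_countable[OF \<D>(1)] using cb \<D>(2,3) by blast
  then have "AE x in lebesgue. x \<in> \<Omega> \<longrightarrow> d x = 0"
    by eventually_elim (use \<D>(4) in blast)
  then show ?thesis
    using \<open>open \<Omega>\<close> by (simp add: AE_lebesgue_on_iff)
qed

section \<open>Integration in the plane\<close>

text \<open>
  The point with given coordinates, written so that linearity in the coordinates is immediate.
\<close>

definition pt :: "real \<Rightarrow> real \<Rightarrow> real^2" where
  "pt x y = x *\<^sub>R axis 1 1 + y *\<^sub>R axis 2 1"

lemma pt_component [simp]: "pt x y $ 1 = x" "pt x y $ 2 = y"
  by (simp_all add: pt_def axis_def)

lemma vec2_eq_iff: "a = b \<longleftrightarrow> a $ 1 = b $ 1 \<and> a $ 2 = b $ 2" for a b :: "'a^2"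
  by (simp add: vec_eq_iff forall_2)

lemma pt_eta [simp]: "pt (z $ 1) (z $ 2) = z"
  by (simp add: vec2_eq_iff)

lemma continuous_on_pt [continuous_intros]:
  "continuous_on S f \<Longrightarrow> continuous_on S g \<Longrightarrow> continuous_on S (\<lambda>x. pt (f x) (g x))"
  unfolding pt_def by (intro continuous_intros)

lemma measurable_pt [measurable (raw)]:
  "f \<in> borel_measurable M \<Longrightarrow> g \<in> borel_measurable M \<Longrightarrow> (\<lambda>x. pt (f x) (g x)) \<in> borel_measurable M"
  unfolding pt_def by (intro borel_measurable_add borel_measurable_scaleR borel_measurable_const)

lemma measurable_pt_pair [measurable]:
  "(\<lambda>z :: real \<times> real. pt (fst z) (snd z)) \<in> borel_measurable borel"
  by (intro borel_measurable_continuous_onI continuous_intros)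

lemma Basis_plane: "(Basis :: (real^2) set) = {axis 1 1, axis 2 1}"
  by (auto simp: Basis_vec_def UNIV_2)

lemma distr_lborel_pt: "distr (lborel :: (real \<times> real) measure) borel (\<lambda>(x, y). pt x y) = lborel"
proof (rule lborel_eqI[symmetric])
  fix l u :: "real^2"
  assume le: "\<And>b. b \<in> Basis \<Longrightarrow> l \<bullet> b \<le> u \<bullet> b"
  have le': "l $ 1 \<le> u $ 1" "l $ 2 \<le> u $ 2"
    using le[of "axis 1 1"] le[of "axis 2 1"] by (simp_all add: Basis_plane inner_axis)
  have "emeasure (distr (lborel :: (real \<times> real) measure) borel (\<lambda>(x, y). pt x y)) (box l u)
      = emeasure (lborel :: (real \<times> real) measure) ((\<lambda>(x, y). pt x y) -` box l u)"
    by (subst emeasure_distr) (auto simp: case_prod_beta')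
  also have "(\<lambda>(x, y). pt x y) -` box l u = {l $ 1<..<u $ 1} \<times> {l $ 2<..<u $ 2}"
    by (auto simp: mem_box_2)
  also have "emeasure (lborel :: (real \<times> real) measure) \<dots> = ennreal ((u $ 1 - l $ 1) * (u $ 2 - l $ 2))"
    using le' by (simp add: lborel_prod[symmetric] lborel.emeasure_pair_measure_Times ennreal_mult)
  also have "(u $ 1 - l $ 1) * (u $ 2 - l $ 2) = (\<Prod>b\<in>Basis. (u - l) \<bullet> b)"
    by (simp add: Basis_plane inner_axis axis_eq_axis)
  finally show "emeasure (distr (lborel :: (real \<times> real) measure) borel (\<lambda>(x, y). pt x y)) (box l u)
      = ennreal (\<Prod>b\<in>Basis. (u - l) \<bullet> b)" .
qed simp

text \<open>
  Fubini's theorem in the form used throughout: the inner integral runs along a horizontal line.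
\<close>

lemma nn_integral_plane:
  fixes f :: "real^2 \<Rightarrow> ennreal"
  assumes [measurable]: "f \<in> borel_measurable borel"
  shows "(\<integral>\<^sup>+z. f z \<partial>lborel) = (\<integral>\<^sup>+y. \<integral>\<^sup>+x. f (pt x y) \<partial>lborel \<partial>lborel)"
proof -
  have "(\<integral>\<^sup>+z. f z \<partial>lborel) = (\<integral>\<^sup>+z. f ((\<lambda>(x, y). pt x y) z) \<partial>(lborel \<Otimes>\<^sub>M lborel))"
    by (subst distr_lborel_pt[symmetric], subst nn_integral_distr)
      (auto simp: case_prod_beta' lborel_prod)
  also have "\<dots> = (\<integral>\<^sup>+y. \<integral>\<^sup>+x. f (pt x y) \<partial>lborel \<partial>lborel)"
    by (subst lborel_pair.nn_integral_snd[symmetric]) (auto simp: case_prod_beta')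
  finally show ?thesis .
qed

lemma integral_plane:
  fixes f :: "real^2 \<Rightarrow> real"
  assumes f: "integrable lborel f"
  shows "(\<integral>z. f z \<partial>lborel) = (\<integral>y. \<integral>x. f (pt x y) \<partial>lborel \<partial>lborel)"
proof -
  have [measurable]: "f \<in> borel_measurable borel"
    using f by (simp add: borel_measurable_integrable)
  have int: "integrable (lborel \<Otimes>\<^sub>M lborel) (\<lambda>z. f (pt (fst z) (snd z)))"
  proof -
    have "integrable (distr (lborel :: (real \<times> real) measure) borel (\<lambda>(x, y). pt x y)) f"
      using f by (simp add: distr_lborel_pt)
    then show ?thesis
      by (subst (asm) integrable_distr_eq) (auto simp: case_prod_beta' lborel_prod)
  qed
  have "(\<integral>z. f z \<partial>lborel) = (\<integral>z. f (pt (fst z) (snd z)) \<partial>(lborel \<Otimes>\<^sub>M lborel))"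
    by (subst distr_lborel_pt[symmetric], subst integral_distr)
      (auto simp: case_prod_beta' lborel_prod)
  also have "\<dots> = (\<integral>y. \<integral>x. f (pt x y) \<partial>lborel \<partial>lborel)"
    using lborel_pair.integral_snd[of "\<lambda>x y. f (pt x y)"] int by (simp add: case_prod_beta')
  finally show ?thesis .
qed

lemma integrable_compact_support:
  fixes h :: "'a::euclidean_space \<Rightarrow> real"
  assumes "continuous_on UNIV h" "compact K" "\<And>x. x \<notin> K \<Longrightarrow> h x = 0"
  shows "integrable lborel h"
proof -
  have "integrable lborel (\<lambda>x. indicator K x *\<^sub>R h x)"
    by (intro borel_integrable_compact assms continuous_on_subset[OF assms(1)]) auto
  moreover have "(\<lambda>x. indicator K x *\<^sub>R h x) = h"
    using assms(3) by (auto simp: fun_eq_iff indicator_def)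
  ultimately show ?thesis by simp
qed

lemma smooth_partial_deriv: "smooth f \<Longrightarrow> smooth (partial_deriv i f)"
  unfolding partial_deriv_def[abs_def] by (rule smooth_directional_derivative)

lemma smooth_has_real_derivative_curve:
  assumes f: "smooth f"
    and x: "(x has_real_derivative x') (at t within S)"
    and y: "(y has_real_derivative y') (at t within S)"
  shows "((\<lambda>t. f (pt (x t) (y t))) has_real_derivative
    (partial_deriv 1 f (pt (x t) (y t)) * x' + partial_deriv 2 f (pt (x t) (y t)) * y')) (at t within S)"
proof -
  let ?D = "frechet_derivative f (at (pt (x t) (y t)))"
  have D: "(f has_derivative ?D) (at (pt (x t) (y t)))"
    by (rule smooth_has_derivative[OF f])
  have lin: "linear ?D" using D has_derivative_linear by blast
  have "((\<lambda>t. pt (x t) (y t)) has_derivative (\<lambda>h. pt (x' * h) (y' * h))) (at t within S)"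
    unfolding pt_def
    by (rule has_derivative_add[OF has_derivative_scaleR_left[OF x[unfolded has_field_derivative_def]]
          has_derivative_scaleR_left[OF y[unfolded has_field_derivative_def]]])
  from has_derivative_compose[OF this D]
  have "((\<lambda>t. f (pt (x t) (y t))) has_derivative (\<lambda>h. ?D (pt (x' * h) (y' * h)))) (at t within S)" .
  moreover have "?D (pt (x' * h) (y' * h)) =
      (partial_deriv 1 f (pt (x t) (y t)) * x' + partial_deriv 2 f (pt (x t) (y t)) * y') * h" for h
    unfolding pt_def[of "x' * h" "y' * h"] partial_deriv_def
    by (simp add: linear_add[OF lin] linear_cmul[OF lin] algebra_simps)
  ultimately show ?thesis by (simp add: has_field_derivative_def)
qed

lemma integral_partial_deriv_1_compact_support:
  assumes f: "smooth f" and K: "compact K" "\<And>x. x \<notin> K \<Longrightarrow> f x = 0"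
    and supp: "\<And>x. x \<notin> K \<Longrightarrow> partial_deriv 1 f x = 0"
  shows "(\<integral>z. partial_deriv 1 f z \<partial>lborel) = 0"
proof -
  have int: "integrable lborel (partial_deriv 1 f)"
    by (rule integrable_compact_support[OF smooth_continuous[OF smooth_partial_deriv[OF f]] K(1) supp])
  obtain R where R: "\<And>x. x \<in> K \<Longrightarrow> norm x < R"
    using compact_imp_bounded[OF K(1)] by (metis bounded_pos_less)
  have out: "pt x y \<notin> K" if "\<bar>x\<bar> \<ge> \<bar>R\<bar>" for x y
    using R[of "pt x y"] component_le_norm_cart[of "pt x y" 1] that by auto
  have "(\<integral>x. partial_deriv 1 f (pt x y) \<partial>lborel) = 0" for y
  proof -
    have "partial_deriv 1 f (pt x y) = 0" if "x \<notin> {-\<bar>R\<bar>..\<bar>R\<bar>}" for x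
      by (rule supp, rule out) (use that in auto)
    then have "(\<integral>x. partial_deriv 1 f (pt x y) \<partial>lborel)
        = (\<integral>x. indicator {-\<bar>R\<bar>..\<bar>R\<bar>} x *\<^sub>R partial_deriv 1 f (pt x y) \<partial>lborel)"
      by (intro Bochner_Integration.integral_cong refl) (metis indicator_eq_0_iff indicator_eq_1_iff scaleR_one scaleR_zero_right)
    also have "\<dots> = f (pt \<bar>R\<bar> y) - f (pt (-\<bar>R\<bar>) y)"
    proof (rule integral_FTC_Icc)
      show "((\<lambda>x. f (pt x y)) has_vector_derivative partial_deriv 1 f (pt x y)) (at x within {- \<bar>R\<bar>..\<bar>R\<bar>})" for x
        using smooth_has_real_derivative_curve[OF f, of "\<lambda>x. x" 1 x _ "\<lambda>_. y" 0]
        by (simp add: has_real_derivative_iff_has_vector_derivative)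
      show "continuous_on {- \<bar>R\<bar>..\<bar>R\<bar>} (\<lambda>x. partial_deriv 1 f (pt x y))"
        by (intro continuous_on_compose2[OF smooth_continuous[OF smooth_partial_deriv[OF f], of UNIV]]
            continuous_intros) auto
    qed simp
    also have "\<dots> = 0" using out K(2) by simp
    finally show ?thesis .
  qed
  then show ?thesis by (simp add: integral_plane[OF int])
qed

lemma partial_deriv_mult:
  assumes "smooth f" "smooth g"
  shows "partial_deriv i (\<lambda>x. f x * g x) x = f x * partial_deriv i g x + partial_deriv i f x * g x"
proof -
  have d: "((\<lambda>x. f x * g x) has_derivative
      (\<lambda>h. f x * frechet_derivative g (at x) h + frechet_derivative f (at x) h * g x)) (at x)"
    by (intro has_derivative_mult smooth_has_derivative assms)
  show ?thesis
    unfolding partial_deriv_def frechet_derivative_at[OF d, symmetric] by (rule refl)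
qed

lemma integral_lebesgue_on_support:
  fixes h :: "'a::euclidean_space \<Rightarrow> real"
  assumes "open \<Omega>" "h \<in> borel_measurable borel" "\<And>x. x \<notin> \<Omega> \<Longrightarrow> h x = 0"
  shows "integral\<^sup>L (lebesgue_on \<Omega>) h = (\<integral>x. h x \<partial>lborel)"
proof -
  have "integral\<^sup>L (lebesgue_on \<Omega>) h = (\<integral>x. indicator \<Omega> x *\<^sub>R h x \<partial>lebesgue)"
    using assms(1) by (intro integral_restrict_space) auto
  also have "\<dots> = (\<integral>x. h x \<partial>lebesgue)"
    using assms(3) by (intro Bochner_Integration.integral_cong) (auto simp: indicator_def)
  also have "\<dots> = (\<integral>x. h x \<partial>lborel)"
    using assms(2) by (intro integral_completion) simp
  finally show ?thesis .
qed

lemma partial_deriv_outside_support: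
  assumes "x \<notin> closure {x. f x \<noteq> 0}"
  shows "partial_deriv i f x = 0"
proof -
  have "((\<lambda>_. 0) has_derivative (\<lambda>_. 0)) (at x)" by simp
  then have "(f has_derivative (\<lambda>_. 0)) (at x)"
    by (rule has_derivative_transform_within_open[where s = "- closure {x. f x \<noteq> 0}"])
      (use assms closure_subset[of "{x. f x \<noteq> 0}"] in auto)
  then show ?thesis
    unfolding partial_deriv_def by (simp add: frechet_derivative_at[symmetric])
qed

text \<open>
  The product has compact support in \<open>\<Omega>\<close>, so the integral of its derivative over the plane
  vanishes, line by line.
\<close>

lemma integration_by_parts_1:
  assumes "open \<Omega>" and w: "smooth w" and \<phi>: "test_function \<Omega> \<phi>"
  shows "integral\<^sup>L (lebesgue_on \<Omega>) (\<lambda>x. w x * partial_deriv 1 \<phi> x)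
    = - integral\<^sup>L (lebesgue_on \<Omega>) (\<lambda>x. partial_deriv 1 w x * \<phi> x)"
proof -
  define K where "K = closure {x. \<phi> x \<noteq> 0}"
  have K: "compact K" "K \<subseteq> \<Omega>" and s: "smooth \<phi>"
    using \<phi> by (auto simp: test_function_def K_def)
  have 0: "\<phi> x = 0" "partial_deriv 1 \<phi> x = 0" if "x \<notin> K" for x
    using that closure_subset[of "{x. \<phi> x \<noteq> 0}"] partial_deriv_outside_support[of x \<phi>]
    unfolding K_def by blast+
  note c = smooth_continuous[OF w] smooth_continuous[OF s]
    smooth_continuous[OF smooth_partial_deriv[OF w]] smooth_continuous[OF smooth_partial_deriv[OF s]]
  have i1: "integrable lborel (\<lambda>x. w x * partial_deriv 1 \<phi> x)"
    by (rule integrable_compact_support[OF continuous_on_mult[OF c(1) c(4)] K(1)]) (simp add: 0)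
  have i2: "integrable lborel (\<lambda>x. partial_deriv 1 w x * \<phi> x)"
    by (rule integrable_compact_support[OF continuous_on_mult[OF c(3) c(2)] K(1)]) (simp add: 0)
  have "(\<integral>z. partial_deriv 1 (\<lambda>x. w x * \<phi> x) z \<partial>lborel) = 0"
    by (rule integral_partial_deriv_1_compact_support[OF smooth_mult[OF w s] K(1)])
      (auto simp: 0 partial_deriv_mult[OF w s])
  then have "(\<integral>z. w z * partial_deriv 1 \<phi> z \<partial>lborel) + (\<integral>z. partial_deriv 1 w z * \<phi> z \<partial>lborel) = 0"
    by (simp add: partial_deriv_mult[OF w s] i1 i2)
  moreover have "integral\<^sup>L (lebesgue_on \<Omega>) (\<lambda>x. w x * partial_deriv 1 \<phi> x) = (\<integral>z. w z * partial_deriv 1 \<phi> z \<partial>lborel)"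
    by (rule integral_lebesgue_on_support[OF \<open>open \<Omega>\<close>]) (use i1 0 K(2) in \<open>auto simp: borel_measurable_integrable\<close>)
  moreover have "integral\<^sup>L (lebesgue_on \<Omega>) (\<lambda>x. partial_deriv 1 w x * \<phi> x) = (\<integral>z. partial_deriv 1 w z * \<phi> z \<partial>lborel)"
    by (rule integral_lebesgue_on_support[OF \<open>open \<Omega>\<close>]) (use i2 0 K(2) in \<open>auto simp: borel_measurable_integrable\<close>)
  ultimately show ?thesis by simp
qed

lemma abs_diff_le_nn_integral_deriv:
  fixes f :: "real \<Rightarrow> real"
  assumes "a \<le> b"
    and der: "\<And>t. t \<in> {a..b} \<Longrightarrow> (f has_real_derivative f' t) (at t within {a..b})"
    and cont: "continuous_on {a..b} f'"
  shows "ennreal \<bar>f b - f a\<bar> \<le> (\<integral>\<^sup>+t. ennreal \<bar>f' t\<bar> * indicator {a..b} t \<partial>lborel)"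
proof -
  have I: "(f' has_integral f b - f a) {a..b}"
    by (rule fundamental_theorem_of_calculus[OF \<open>a \<le> b\<close>])
      (use der in \<open>simp add: has_real_derivative_iff_has_vector_derivative\<close>)
  have J: "((\<lambda>t. \<bar>f' t\<bar>) has_integral integral {a..b} (\<lambda>t. \<bar>f' t\<bar>)) {a..b}"
    by (intro integrable_integral integrable_continuous_real continuous_intros cont)
  have "\<bar>f b - f a\<bar> \<le> integral {a..b} (\<lambda>t. \<bar>f' t\<bar>)"
    using J I integral_norm_bound_integral[of f' "{a..b}" "\<lambda>t. \<bar>f' t\<bar>"]
    by (auto simp: has_integral_integrable_integral)
  then show ?thesis
    using nn_integral_has_integral_lebesgue'[OF _ J] by (simp add: ennreal_leI)
qed

text \<open>
  Cauchy-Schwarz for the increment of \<open>f\<close>, obtained by expanding the nonnegative integral of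
  \<open>(f' - m)\<^sup>2\<close>, where \<open>m\<close> is the mean slope.
\<close>

lemma square_diff_le_nn_integral_deriv:
  fixes f :: "real \<Rightarrow> real"
  assumes "a \<le> b"
    and der: "\<And>t. t \<in> {a..b} \<Longrightarrow> (f has_real_derivative f' t) (at t within {a..b})"
    and cont: "continuous_on {a..b} f'"
  shows "ennreal ((f b - f a)\<^sup>2) \<le> ennreal (b - a) * (\<integral>\<^sup>+t. ennreal ((f' t)\<^sup>2) * indicator {a..b} t \<partial>lborel)"
proof (cases "a = b")
  case False
  then have "a < b" using \<open>a \<le> b\<close> by simp
  \<comment> \<open>the mean slope, the constant that minimizes the integral of \<open>(f' - m)\<^sup>2\<close>\<close>
  define m where "m = (f b - f a) / (b - a)"
  have I: "(f' has_integral f b - f a) {a..b}"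
    by (rule fundamental_theorem_of_calculus[OF \<open>a \<le> b\<close>])
      (use der in \<open>simp add: has_real_derivative_iff_has_vector_derivative\<close>)
  define J where "J = integral {a..b} (\<lambda>t. (f' t)\<^sup>2)"
  have J: "((\<lambda>t. (f' t)\<^sup>2) has_integral J) {a..b}"
    unfolding J_def by (intro integrable_integral integrable_continuous_real continuous_intros cont)
  have "((\<lambda>t. (f' t)\<^sup>2 - 2 * m * f' t + m\<^sup>2) has_integral (J - 2 * m * (f b - f a) + m\<^sup>2 * (b - a))) {a..b}"
    using has_integral_const_real[of "m\<^sup>2" a b] \<open>a < b\<close>
    by (intro has_integral_add has_integral_diff J has_integral_mult_right I) (simp add: mult.commute)
  moreover have "(f' t)\<^sup>2 - 2 * m * f' t + m\<^sup>2 = (f' t - m)\<^sup>2" for t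
    by (simp add: power2_eq_square algebra_simps)
  ultimately have "0 \<le> J - 2 * m * (f b - f a) + m\<^sup>2 * (b - a)"
    by (auto intro: has_integral_nonneg)
  moreover have "f b - f a = m * (b - a)"
    using \<open>a < b\<close> by (simp add: m_def)
  ultimately have "(b - a) * (m\<^sup>2 * (b - a)) \<le> (b - a) * J"
    using \<open>a < b\<close> by (intro mult_left_mono) (simp_all add: power2_eq_square)
  then have "(f b - f a)\<^sup>2 \<le> (b - a) * J"
    unfolding \<open>f b - f a = m * (b - a)\<close> by (simp add: power2_eq_square algebra_simps)
  then have "ennreal ((f b - f a)\<^sup>2) \<le> ennreal (b - a) * ennreal J"
    using \<open>a < b\<close> by (simp add: ennreal_mult'[symmetric] ennreal_leI)
  then show ?thesis
    using nn_integral_has_integral_lebesgue'[OF _ J] by simp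
qed simp

lemma reflect_component [simp]: "reflect x $ 1 = x $ 1" "reflect x $ 2 = - x $ 2"
  by (simp_all add: reflect_def)

lemma reflect_reflect [simp]: "reflect (reflect x) = x"
  by (simp add: vec2_eq_iff)

lemma reflect_eq_pt: "reflect x = pt (x $ 1) (- x $ 2)"
  by (simp add: vec2_eq_iff)

lemma continuous_on_reflect [continuous_intros]:
  "continuous_on S f \<Longrightarrow> continuous_on S (\<lambda>x. reflect (f x))"
  unfolding reflect_eq_pt by (intro continuous_intros)

lemma measurable_reflect [measurable]: "reflect \<in> borel_measurable borel"
  by (intro borel_measurable_continuous_onI continuous_intros)

lemma distr_lborel_reflect: "distr lborel borel reflect = lborel"
proof (rule lborel_eqI[symmetric])
  fix l u :: "real^2"
  assume le: "\<And>b. b \<in> Basis \<Longrightarrow> l \<bullet> b \<le> u \<bullet> b"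
  let ?l = "pt (l $ 1) (- u $ 2)" and ?u = "pt (u $ 1) (- l $ 2)"
  have "reflect -` box l u = box ?l ?u"
    by (auto simp: mem_box_2)
  moreover have "\<And>b. b \<in> Basis \<Longrightarrow> ?l \<bullet> b \<le> ?u \<bullet> b"
    using le[of "axis 1 1"] le[of "axis 2 1"] by (auto simp: Basis_plane inner_axis)
  ultimately show "emeasure (distr lborel borel reflect) (box l u) = ennreal (\<Prod>b\<in>Basis. (u - l) \<bullet> b)"
    by (simp add: emeasure_distr emeasure_lborel_box_eq Basis_plane inner_axis axis_eq_axis)
qed simp

lemma nn_integral_reflect:
  "f \<in> borel_measurable borel \<Longrightarrow> (\<integral>\<^sup>+x. f (reflect x) \<partial>lborel) = (\<integral>\<^sup>+x. f x \<partial>lborel)"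
  by (subst (2) distr_lborel_reflect[symmetric], subst nn_integral_distr) auto

section \<open>The weak derivative of the total head pressure\<close>

lemma W1_has_weak_partial:
  assumes "u \<in> W1 q \<Omega>"
  shows "has_weak_partial \<Omega> i u (weak_partial \<Omega> i u)"
proof -
  have "\<exists>g. has_weak_partial \<Omega> i u g"
    using assms unfolding W1_def by blast
  then show ?thesis
    unfolding weak_partial_def by (rule someI_ex)
qed

lemma W1_measurable:
  assumes "u \<in> W1 q \<Omega>"
  shows "u \<in> borel_measurable (lebesgue_on \<Omega>)" "weak_partial \<Omega> i u \<in> borel_measurable (lebesgue_on \<Omega>)"
  using assms unfolding W1_def Lq_def by auto

lemma abs_powr_two: "\<bar>x :: real\<bar> powr 2 = x\<^sup>2"
  by (cases "x = 0") auto

lemma Lq_two_finite: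
  assumes "u \<in> Lq 2 \<Omega>"
  shows "(\<integral>\<^sup>+x. ennreal ((u x)\<^sup>2) \<partial>lebesgue_on \<Omega>) < \<infinity>"
  using assms by (auto simp: Lq_def abs_powr_two integrable_iff_bounded)

lemma W1_two_finite:
  assumes "u \<in> W1 2 \<Omega>"
  shows "(\<integral>\<^sup>+x. ennreal ((u x)\<^sup>2) \<partial>lebesgue_on \<Omega>) < \<infinity>"
    "(\<integral>\<^sup>+x. ennreal ((weak_partial \<Omega> i u x)\<^sup>2) \<partial>lebesgue_on \<Omega>) < \<infinity>"
  by (rule Lq_two_finite, use assms in \<open>simp add: W1_def\<close>)+

lemma smooth_measurable_lebesgue_on: "smooth f \<Longrightarrow> f \<in> borel_measurable (lebesgue_on S)"
  by (intro measurable_restrict_space1 measurable_completion)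
    (simp add: borel_measurable_continuous_onI smooth_continuous)

lemma tendsto_0_if_square_tendsto_0_ennreal:
  fixes x :: "'a \<Rightarrow> ennreal"
  assumes "((\<lambda>k. (x k)\<^sup>2) \<longlongrightarrow> 0) F"
  shows "(x \<longlongrightarrow> 0) F"
proof (rule tendsto_zero_ennreal)
  fix r :: real assume "0 < r"
  then have "0 < (ennreal r)\<^sup>2" by (simp add: ennreal_power)
  then have "eventually (\<lambda>k. (x k)\<^sup>2 < (ennreal r)\<^sup>2) F"
    by (rule order_tendstoD[OF assms])
  then show "eventually (\<lambda>k. x k < ennreal r) F"
    by eventually_elim (metis mult_mono not_less power2_eq_square zero_le)
qed

lemma tendsto_0_le_ennreal:
  fixes x y :: "'a \<Rightarrow> ennreal"
  assumes "(y \<longlongrightarrow> 0) F" "\<And>k. x k \<le> y k"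
  shows "(x \<longlongrightarrow> 0) F"
  by (rule tendsto_sandwich[OF _ _ tendsto_const assms(1)]) (simp_all add: assms(2))

lemma nn_integral_product_tendsto_0:
  fixes a b :: "nat \<Rightarrow> 'a \<Rightarrow> real"
  assumes [measurable]: "\<And>k. a k \<in> borel_measurable M" "\<And>k. b k \<in> borel_measurable M"
    and a: "(\<lambda>k. \<integral>\<^sup>+x. ennreal ((a k x)\<^sup>2) \<partial>M) \<longlonglongrightarrow> A" and "A < \<infinity>"
    and b: "(\<lambda>k. \<integral>\<^sup>+x. ennreal ((b k x)\<^sup>2) \<partial>M) \<longlonglongrightarrow> 0"
  shows "(\<lambda>k. \<integral>\<^sup>+x. ennreal \<bar>a k x * b k x\<bar> \<partial>M) \<longlonglongrightarrow> 0"
proof (rule tendsto_0_if_square_tendsto_0_ennreal)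
  have "(\<lambda>k. (\<integral>\<^sup>+x. ennreal ((a k x)\<^sup>2) \<partial>M) * (\<integral>\<^sup>+x. ennreal ((b k x)\<^sup>2) \<partial>M)) \<longlonglongrightarrow> 0"
    using tendsto_mult_ennreal[OF a b] \<open>A < \<infinity>\<close> by simp
  moreover have "(\<integral>\<^sup>+x. ennreal \<bar>a k x * b k x\<bar> \<partial>M)\<^sup>2
      \<le> (\<integral>\<^sup>+x. ennreal ((a k x)\<^sup>2) \<partial>M) * (\<integral>\<^sup>+x. ennreal ((b k x)\<^sup>2) \<partial>M)" for k
    using Cauchy_Schwarz_nn_integral[of "\<lambda>x. ennreal \<bar>a k x\<bar>" M "\<lambda>x. ennreal \<bar>b k x\<bar>"]
    by (simp add: ennreal_mult'[symmetric] ennreal_power abs_mult)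
  ultimately show "(\<lambda>k. (\<integral>\<^sup>+x. ennreal \<bar>a k x * b k x\<bar> \<partial>M)\<^sup>2) \<longlonglongrightarrow> 0"
    by (rule tendsto_0_le_ennreal)
qed

text \<open>
  A product is a continuous bilinear map from \<open>L\<^sup>2 \<times> L\<^sup>2\<close> to \<open>L\<^sup>1\<close>.
\<close>

lemma L2_product_tendsto_L1:
  fixes f g :: "'a \<Rightarrow> real"
  assumes [measurable]: "f \<in> borel_measurable M" "g \<in> borel_measurable M"
    "\<And>k. h k \<in> borel_measurable M" "\<And>k. l k \<in> borel_measurable M"
    and f: "(\<integral>\<^sup>+x. ennreal ((f x)\<^sup>2) \<partial>M) < \<infinity>" and g: "(\<integral>\<^sup>+x. ennreal ((g x)\<^sup>2) \<partial>M) < \<infinity>"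
    and h: "(\<lambda>k. \<integral>\<^sup>+x. ennreal ((h k x - f x)\<^sup>2) \<partial>M) \<longlonglongrightarrow> 0"
    and l: "(\<lambda>k. \<integral>\<^sup>+x. ennreal ((l k x - g x)\<^sup>2) \<partial>M) \<longlonglongrightarrow> 0"
  shows "(\<lambda>k. \<integral>\<^sup>+x. ennreal \<bar>h k x * l k x - f x * g x\<bar> \<partial>M) \<longlonglongrightarrow> 0"
proof -
  have "(\<lambda>k. (\<integral>\<^sup>+x. ennreal \<bar>(h k x - f x) * (l k x - g x)\<bar> \<partial>M)
      + (\<integral>\<^sup>+x. ennreal \<bar>f x * (l k x - g x)\<bar> \<partial>M)
      + (\<integral>\<^sup>+x. ennreal \<bar>g x * (h k x - f x)\<bar> \<partial>M)) \<longlonglongrightarrow> 0"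
    by (intro tendsto_add[of _ 0 _ _ 0, simplified] nn_integral_product_tendsto_0[OF _ _ h _ l]
        nn_integral_product_tendsto_0[OF _ _ tendsto_const f l]
        nn_integral_product_tendsto_0[OF _ _ tendsto_const g h]) measurable
  moreover have "(\<integral>\<^sup>+x. ennreal \<bar>h k x * l k x - f x * g x\<bar> \<partial>M)
      \<le> (\<integral>\<^sup>+x. ennreal \<bar>(h k x - f x) * (l k x - g x)\<bar> \<partial>M)
      + (\<integral>\<^sup>+x. ennreal \<bar>f x * (l k x - g x)\<bar> \<partial>M)
      + (\<integral>\<^sup>+x. ennreal \<bar>g x * (h k x - f x)\<bar> \<partial>M)" for k
  proof -
    have eq: "h k x * l k x - f x * g x
        = (h k x - f x) * (l k x - g x) + f x * (l k x - g x) + g x * (h k x - f x)" for x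
      by (simp add: algebra_simps)
    have "\<bar>h k x * l k x - f x * g x\<bar>
        \<le> \<bar>(h k x - f x) * (l k x - g x)\<bar> + \<bar>f x * (l k x - g x)\<bar> + \<bar>g x * (h k x - f x)\<bar>" for x
      unfolding eq[of x] by linarith
    then have "(\<integral>\<^sup>+x. ennreal \<bar>h k x * l k x - f x * g x\<bar> \<partial>M)
      \<le> (\<integral>\<^sup>+x. ennreal \<bar>(h k x - f x) * (l k x - g x)\<bar> + ennreal \<bar>f x * (l k x - g x)\<bar>
        + ennreal \<bar>g x * (h k x - f x)\<bar> \<partial>M)"
      by (intro nn_integral_mono) (simp add: ennreal_plus[symmetric] ennreal_leI del: ennreal_plus)
    then show ?thesis
      by (simp add: nn_integral_add)
  qed
  ultimately show ?thesis
    by (rule tendsto_0_le_ennreal)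
qed

lemma integrable_L2_product:
  fixes f g :: "'a \<Rightarrow> real"
  assumes [measurable]: "f \<in> borel_measurable M" "g \<in> borel_measurable M"
    and f: "(\<integral>\<^sup>+x. ennreal ((f x)\<^sup>2) \<partial>M) < \<infinity>" and g: "(\<integral>\<^sup>+x. ennreal ((g x)\<^sup>2) \<partial>M) < \<infinity>"
  shows "integrable M (\<lambda>x. f x * g x)"
proof (rule integrableI_bounded)
  have "\<bar>f x * g x\<bar> \<le> (f x)\<^sup>2 + (g x)\<^sup>2" for x
  proof -
    have "0 \<le> (\<bar>f x\<bar> - \<bar>g x\<bar>)\<^sup>2" by simp
    then have "2 * \<bar>f x * g x\<bar> \<le> (f x)\<^sup>2 + (g x)\<^sup>2"
      by (simp add: power2_diff abs_mult)
    then show ?thesis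
      using abs_ge_zero[of "f x * g x"] by linarith
  qed
  then have "(\<integral>\<^sup>+x. ennreal (norm (f x * g x)) \<partial>M) \<le> (\<integral>\<^sup>+x. ennreal ((f x)\<^sup>2) + ennreal ((g x)\<^sup>2) \<partial>M)"
    by (intro nn_integral_mono) (simp add: ennreal_plus[symmetric] ennreal_leI del: ennreal_plus)
  also have "\<dots> < \<infinity>"
    using f g by (subst nn_integral_add) auto
  finally show "(\<integral>\<^sup>+x. ennreal (norm (f x * g x)) \<partial>M) < \<infinity>" .
qed measurable

lemma integral_L2_product_tendsto:
  fixes f g :: "'a \<Rightarrow> real"
  assumes [measurable]: "f \<in> borel_measurable M" "g \<in> borel_measurable M"
    "\<And>k. h k \<in> borel_measurable M" "\<And>k. l k \<in> borel_measurable M"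
    and f: "(\<integral>\<^sup>+x. ennreal ((f x)\<^sup>2) \<partial>M) < \<infinity>" and g: "(\<integral>\<^sup>+x. ennreal ((g x)\<^sup>2) \<partial>M) < \<infinity>"
    and h: "(\<lambda>k. \<integral>\<^sup>+x. ennreal ((h k x - f x)\<^sup>2) \<partial>M) \<longlonglongrightarrow> 0"
    and l: "(\<lambda>k. \<integral>\<^sup>+x. ennreal ((l k x - g x)\<^sup>2) \<partial>M) \<longlonglongrightarrow> 0"
    and \<phi>[measurable]: "\<phi> \<in> borel_measurable M" and B: "\<And>x. \<bar>\<phi> x\<bar> \<le> B"
  shows "(\<lambda>k. \<integral>x. h k x * l k x * \<phi> x \<partial>M) \<longlonglongrightarrow> (\<integral>x. f x * g x * \<phi> x \<partial>M)"
proof -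
  note L1 = L2_product_tendsto_L1[OF assms(1-4) f g h l]
  have ig: "integrable M (\<lambda>x. q x * \<phi> x)" if "integrable M q" for q
  proof (rule Bochner_Integration.integrable_bound[OF integrable_mult_right[OF that, of B]])
    show "AE x in M. norm (q x * \<phi> x) \<le> norm (B * q x)"
      unfolding real_norm_def abs_mult
      by (intro AE_I2, subst mult.commute, intro mult_right_mono order_trans[OF B abs_ge_self] abs_ge_zero)
    show "(\<lambda>x. q x * \<phi> x) \<in> borel_measurable M"
      using that by measurable
  qed
  have fg: "integrable M (\<lambda>x. f x * g x)"
    by (rule integrable_L2_product[OF assms(1,2) f g])
  have "eventually (\<lambda>k. (\<integral>\<^sup>+x. ennreal \<bar>h k x * l k x - f x * g x\<bar> \<partial>M) < 1) sequentially"
    by (rule order_tendstoD[OF L1]) simp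
  then obtain K where K: "\<And>k. k \<ge> K \<Longrightarrow> (\<integral>\<^sup>+x. ennreal \<bar>h k x * l k x - f x * g x\<bar> \<partial>M) < 1"
    unfolding eventually_sequentially by blast
  have hl: "integrable M (\<lambda>x. h k x * l k x)" if "k \<ge> K" for k
  proof -
    have "integrable M (\<lambda>x. h k x * l k x - f x * g x)"
      using order_less_trans[OF K[OF that], of \<infinity>] by (intro integrableI_bounded) auto
    from Bochner_Integration.integrable_add[OF this fg] show ?thesis by simp
  qed
  have "(\<lambda>k. \<integral>x. h (k + K) x * l (k + K) x * \<phi> x \<partial>M) \<longlonglongrightarrow> (\<integral>x. f x * g x * \<phi> x \<partial>M)"
  proof (rule tendsto_L1_int)
    have "0 \<le> B" using B[of undefined] abs_ge_zero order_trans by blast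
    have "(\<lambda>k. ennreal B * (\<integral>\<^sup>+x. ennreal \<bar>h (k + K) x * l (k + K) x - f x * g x\<bar> \<partial>M)) \<longlonglongrightarrow> 0"
      using ennreal_tendsto_cmult[OF _ LIMSEQ_ignore_initial_segment[OF L1, of K], of "ennreal B"] by simp
    moreover have "(\<integral>\<^sup>+x. ennreal (norm (h (k + K) x * l (k + K) x * \<phi> x - f x * g x * \<phi> x)) \<partial>M)
        \<le> ennreal B * (\<integral>\<^sup>+x. ennreal \<bar>h (k + K) x * l (k + K) x - f x * g x\<bar> \<partial>M)" for k
    proof -
      have "\<bar>h (k + K) x * l (k + K) x * \<phi> x - f x * g x * \<phi> x\<bar>
          \<le> B * \<bar>h (k + K) x * l (k + K) x - f x * g x\<bar>" for x
        unfolding left_diff_distrib[symmetric] abs_mult by (subst mult.commute, intro mult_right_mono B abs_ge_zero)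
      then show ?thesis
        using \<open>0 \<le> B\<close> by (subst nn_integral_cmult[symmetric])
          (auto intro!: nn_integral_mono simp: ennreal_mult'[symmetric] ennreal_leI)
    qed
    ultimately show "(\<lambda>k. \<integral>\<^sup>+x. ennreal (norm (h (k + K) x * l (k + K) x * \<phi> x - f x * g x * \<phi> x)) \<partial>M) \<longlonglongrightarrow> 0"
      by (rule tendsto_0_le_ennreal)
  qed (auto intro!: ig hl fg)
  then show ?thesis by (rule LIMSEQ_offset)
qed

lemma compact_support_bounded:
  fixes \<phi> :: "'a::euclidean_space \<Rightarrow> real"
  assumes "continuous_on UNIV \<phi>" "compact K" "\<And>x. x \<notin> K \<Longrightarrow> \<phi> x = 0"
  obtains B where "\<And>x. \<bar>\<phi> x\<bar> \<le> B"
proof -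
  have "bounded (\<phi> ` K)"
    using assms by (intro compact_imp_bounded compact_continuous_image) (auto intro: continuous_on_subset)
  then obtain B where B: "\<And>x. x \<in> K \<Longrightarrow> \<bar>\<phi> x\<bar> \<le> B"
    unfolding bounded_iff by auto
  have "\<bar>\<phi> x\<bar> \<le> max B 0" for x
    using B[of x] assms(3)[of x] by (cases "x \<in> K") auto
  then show ?thesis by (rule that)
qed

lemma test_function_outside:
  assumes "test_function \<Omega> \<phi>"
  obtains K where "compact K" "K \<subseteq> \<Omega>" "\<And>x. x \<notin> K \<Longrightarrow> \<phi> x = 0" "\<And>x i. x \<notin> K \<Longrightarrow> partial_deriv i \<phi> x = 0"
proof
  show "compact (closure {x. \<phi> x \<noteq> 0})" "closure {x. \<phi> x \<noteq> 0} \<subseteq> \<Omega>"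
    using assms by (auto simp: test_function_def)
  show "\<phi> x = 0" if "x \<notin> closure {x. \<phi> x \<noteq> 0}" for x
    using that closure_subset[of "{x. \<phi> x \<noteq> 0}"] by blast
  show "partial_deriv i \<phi> x = 0" if "x \<notin> closure {x. \<phi> x \<noteq> 0}" for x i
    by (rule partial_deriv_outside_support[OF that])
qed

text \<open>
  The trace predicate provides smooth functions on the whole plane that converge to \<open>u\<close> in
  \<open>W\<^sup>1\<^sup>,\<^sup>2\<close>; integration by parts for their squares passes to the limit.
\<close>

lemma weak_partial_half_square:
  assumes "open \<Omega>" and tr: "has_trace 2 \<Omega> u g" and \<phi>: "test_function \<Omega> \<phi>"
  shows "(\<integral>x. u x * u x * partial_deriv 1 \<phi> x \<partial>lebesgue_on \<Omega>)
    = - 2 * (\<integral>x. u x * weak_partial \<Omega> 1 u x * \<phi> x \<partial>lebesgue_on \<Omega>)"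
proof -
  let ?M = "lebesgue_on \<Omega>"
  obtain w where u: "u \<in> W1 2 \<Omega>" and w: "\<And>k. smooth (w k)"
    and w0: "(\<lambda>k. \<integral>\<^sup>+x. ennreal ((w k x - u x)\<^sup>2) \<partial>?M) \<longlonglongrightarrow> 0"
    and w1: "(\<lambda>k. \<integral>\<^sup>+x. ennreal ((partial_deriv 1 (w k) x - weak_partial \<Omega> 1 u x)\<^sup>2) \<partial>?M) \<longlonglongrightarrow> 0"
    using tr unfolding has_trace_def abs_powr_two by blast
  obtain K where K: "compact K" "K \<subseteq> \<Omega>" "\<And>x. x \<notin> K \<Longrightarrow> \<phi> x = 0" "\<And>x i. x \<notin> K \<Longrightarrow> partial_deriv i \<phi> x = 0"
    using \<phi> by (rule test_function_outside) (use that in blast)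
  have s: "smooth \<phi>" using \<phi> by (simp add: test_function_def)
  obtain B where B: "\<And>x. \<bar>\<phi> x\<bar> \<le> B"
    using compact_support_bounded[OF smooth_continuous[OF s] K(1,3)] by metis
  obtain B' where B': "\<And>x. \<bar>partial_deriv 1 \<phi> x\<bar> \<le> B'"
    using compact_support_bounded[OF smooth_continuous[OF smooth_partial_deriv[OF s]] K(1,4)] by metis
  note m = W1_measurable[OF u] smooth_measurable_lebesgue_on[OF w]
    smooth_measurable_lebesgue_on[OF smooth_partial_deriv[OF w]]
    smooth_measurable_lebesgue_on[OF s] smooth_measurable_lebesgue_on[OF smooth_partial_deriv[OF s]]
  have "(\<lambda>k. \<integral>x. w k x * w k x * partial_deriv 1 \<phi> x \<partial>?M) \<longlonglongrightarrow> (\<integral>x. u x * u x * partial_deriv 1 \<phi> x \<partial>?M)"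
    by (rule integral_L2_product_tendsto[OF m(1) m(1) m(3) m(3) W1_two_finite(1)[OF u] W1_two_finite(1)[OF u] w0 w0 m(6) B'])
  moreover have "(\<lambda>k. \<integral>x. w k x * partial_deriv 1 (w k) x * \<phi> x \<partial>?M) \<longlonglongrightarrow> (\<integral>x. u x * weak_partial \<Omega> 1 u x * \<phi> x \<partial>?M)"
    by (rule integral_L2_product_tendsto[OF m(1) m(2) m(3) m(4) W1_two_finite(1)[OF u] W1_two_finite(2)[OF u] w0 w1 m(5) B])
  moreover have "(\<integral>x. w k x * w k x * partial_deriv 1 \<phi> x \<partial>?M) = - 2 * (\<integral>x. w k x * partial_deriv 1 (w k) x * \<phi> x \<partial>?M)" for k
  proof -
    have "(\<integral>x. w k x * w k x * partial_deriv 1 \<phi> x \<partial>?M)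
        = - (\<integral>x. (w k x * partial_deriv 1 (w k) x + partial_deriv 1 (w k) x * w k x) * \<phi> x \<partial>?M)"
      using integration_by_parts_1[OF \<open>open \<Omega>\<close> smooth_mult[OF w[of k] w[of k]] \<phi>]
      by (simp add: partial_deriv_mult[OF w w])
    also have "\<dots> = - (\<integral>x. 2 * (w k x * partial_deriv 1 (w k) x * \<phi> x) \<partial>?M)"
      by (simp add: algebra_simps)
    finally show ?thesis by simp
  qed
  ultimately have "(\<lambda>k. - 2 * (\<integral>x. w k x * partial_deriv 1 (w k) x * \<phi> x \<partial>?M))
      \<longlonglongrightarrow> (\<integral>x. u x * u x * partial_deriv 1 \<phi> x \<partial>?M)" 
    and "(\<lambda>k. - 2 * (\<integral>x. w k x * partial_deriv 1 (w k) x * \<phi> x \<partial>?M))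
      \<longlonglongrightarrow> - 2 * (\<integral>x. u x * weak_partial \<Omega> 1 u x * \<phi> x \<partial>?M)"
    by (auto intro!: tendsto_intros)
  then show ?thesis by (rule LIMSEQ_unique)
qed

lemma locally_integrable_times_compact_support:
  assumes "open \<Omega>" and f: "locally_integrable \<Omega> f" and K: "compact K" "K \<subseteq> \<Omega>"
    and \<psi>: "continuous_on UNIV \<psi>" "\<And>x. x \<notin> K \<Longrightarrow> \<psi> x = 0"
  shows "integrable (lebesgue_on \<Omega>) (\<lambda>x. f x * \<psi> x)"
proof -
  obtain B where B: "\<And>x. \<bar>\<psi> x\<bar> \<le> B"
    using compact_support_bounded[OF \<psi>(1) K(1) \<psi>(2)] by metis
  have K': "K \<in> sets lebesgue" using K(1) by (simp add: compact_imp_closed)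
  have "integrable (lebesgue_on K) f"
    by (intro f[unfolded locally_integrable_def, rule_format] conjI K)
  then have i: "integrable lebesgue (\<lambda>x. indicator K x *\<^sub>R f x)"
    using integrable_restrict_space[of K lebesgue f] K' by simp
  have m: "\<psi> \<in> borel_measurable lebesgue"
    by (intro measurable_completion) (simp add: borel_measurable_continuous_onI \<psi>(1))
  have "integrable lebesgue (\<lambda>x. (indicator K x *\<^sub>R f x) * \<psi> x)"
  proof (rule Bochner_Integration.integrable_bound[OF integrable_mult_right[OF i, of B]])
    show "AE x in lebesgue. norm ((indicator K x *\<^sub>R f x) * \<psi> x) \<le> norm (B * (indicator K x *\<^sub>R f x))"
      unfolding real_norm_def abs_mult[of _ "\<psi> _"] abs_mult[of B]
      by (intro AE_I2, subst mult.commute, intro mult_right_mono order_trans[OF B abs_ge_self] abs_ge_zero)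
  qed (intro borel_measurable_times borel_measurable_integrable[OF i] m)
  moreover have "(\<lambda>x. (indicator K x *\<^sub>R f x) * \<psi> x) = (\<lambda>x. indicator \<Omega> x *\<^sub>R (f x * \<psi> x))"
    using \<psi>(2) K(2) by (auto simp: fun_eq_iff indicator_def)
  ultimately show ?thesis
    using integrable_restrict_space[of \<Omega> lebesgue "\<lambda>x. f x * \<psi> x"] \<open>open \<Omega>\<close> by simp
qed

lemma integrable_imp_locally_integrable:
  assumes "open \<Omega>" "integrable (lebesgue_on \<Omega>) f"
  shows "locally_integrable \<Omega> f"
  unfolding locally_integrable_def
proof (intro allI impI)
  fix K assume K: "compact K \<and> K \<subseteq> \<Omega>"
  have K': "K \<in> sets lebesgue" using K by (simp add: compact_imp_closed)
  have "integrable lebesgue (\<lambda>x. indicator \<Omega> x *\<^sub>R f x)"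
    using integrable_restrict_space[of \<Omega> lebesgue f] assms by simp
  from integrable_mult_indicator[OF K' this]
  have "integrable lebesgue (\<lambda>x. indicator K x *\<^sub>R (indicator \<Omega> x *\<^sub>R f x))" .
  moreover have "(\<lambda>x. indicator K x *\<^sub>R (indicator \<Omega> x *\<^sub>R f x)) = (\<lambda>x. indicator K x *\<^sub>R f x)"
    using K by (auto simp: fun_eq_iff indicator_def)
  ultimately show "integrable (lebesgue_on K) f"
    using integrable_restrict_space[of K lebesgue f] K' by simp
qed

text \<open>
  Both sides are weak derivatives of the total head, so they agree almost everywhere. The
  squares of the velocity components are handled by approximation; \<open>p\<close> is tested directly.
\<close>

lemma weak_partial_total_head:
  assumes "open \<Omega>"
    and v: "\<And>i. has_trace 2 \<Omega> (\<lambda>x. v x $ i) (g i)"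
    and p: "p \<in> W1 1 \<Omega>"
    and head: "total_head v p \<in> W1 1 \<Omega>"
  shows "AE x in lebesgue_on \<Omega>. weak_partial \<Omega> 1 (total_head v p) x = weak_partial \<Omega> 1 p x
    + v x $ 1 * weak_partial \<Omega> 1 (\<lambda>y. v y $ 1) x + v x $ 2 * weak_partial \<Omega> 1 (\<lambda>y. v y $ 2) x"
proof -
  let ?M = "lebesgue_on \<Omega>"
  define V where "V i = weak_partial \<Omega> 1 (\<lambda>y. v y $ i)" for i
  define P where "P = weak_partial \<Omega> 1 p"
  define G where "G = weak_partial \<Omega> 1 (total_head v p)"
  have vW: "(\<lambda>x. v x $ i) \<in> W1 2 \<Omega>" for i
    using v[of i] by (simp add: has_trace_def)
  have wp: "has_weak_partial \<Omega> 1 p P" and wG: "has_weak_partial \<Omega> 1 (total_head v p) G"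
    unfolding P_def G_def by (rule W1_has_weak_partial[OF p], rule W1_has_weak_partial[OF head])
  have iV: "integrable ?M (\<lambda>x. v x $ i * V i x)" for i
    unfolding V_def by (intro integrable_L2_product W1_measurable[OF vW] W1_two_finite[OF vW])
  have ivv: "integrable ?M (\<lambda>x. v x $ i * v x $ i)" for i
    by (intro integrable_L2_product W1_measurable[OF vW] W1_two_finite[OF vW])
  have lP: "locally_integrable \<Omega> P" "locally_integrable \<Omega> p"
    and lG: "locally_integrable \<Omega> G"
    using wp wG by (auto simp: has_weak_partial_def)
  note l = lP lG integrable_imp_locally_integrable[OF \<open>open \<Omega>\<close> iV] integrable_imp_locally_integrable[OF \<open>open \<Omega>\<close> ivv]
  have d: "locally_integrable \<Omega> (\<lambda>x. G x - (P x + v x $ 1 * V 1 x + v x $ 2 * V 2 x))"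
    unfolding locally_integrable_def
  proof (intro allI impI)
    fix K assume "compact K \<and> K \<subseteq> \<Omega>"
    then show "integrable (lebesgue_on K) (\<lambda>x. G x - (P x + v x $ 1 * V 1 x + v x $ 2 * V 2 x))"
      using l unfolding locally_integrable_def
      by (intro Bochner_Integration.integrable_diff Bochner_Integration.integrable_add) blast+
  qed
  have "AE x in ?M. G x - (P x + v x $ 1 * V 1 x + v x $ 2 * V 2 x) = 0"
  proof (rule fundamental_lemma_calculus_of_variations[OF \<open>open \<Omega>\<close> d])
    fix \<phi> assume \<phi>: "test_function \<Omega> \<phi>"
    obtain K where K: "compact K" "K \<subseteq> \<Omega>" "\<And>x. x \<notin> K \<Longrightarrow> \<phi> x = 0" "\<And>x i. x \<notin> K \<Longrightarrow> partial_deriv i \<phi> x = 0"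
      using \<phi> by (rule test_function_outside) (use that in blast)
    have s: "smooth \<phi>" using \<phi> by (simp add: test_function_def)
    note i\<phi> = locally_integrable_times_compact_support[OF \<open>open \<Omega>\<close> _ K(1,2) smooth_continuous[OF s] K(3)]
    note i\<phi>' = locally_integrable_times_compact_support[OF \<open>open \<Omega>\<close> _ K(1,2)
        smooth_continuous[OF smooth_partial_deriv[OF s]] K(4)]
    have sq: "(\<integral>x. v x $ i * v x $ i * partial_deriv 1 \<phi> x \<partial>?M) = - 2 * (\<integral>x. v x $ i * V i x * \<phi> x \<partial>?M)" for i
      unfolding V_def by (rule weak_partial_half_square[OF \<open>open \<Omega>\<close> v \<phi>])
    have head_eq: "total_head v p x = p x + (v x $ 1 * v x $ 1 + v x $ 2 * v x $ 2) / 2" for x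
      by (simp add: total_head_def power2_norm_eq_inner inner_vec_def sum_2)
    have "(\<integral>x. G x * \<phi> x \<partial>?M) = - (\<integral>x. total_head v p x * partial_deriv 1 \<phi> x \<partial>?M)"
      using wG \<phi> by (simp add: has_weak_partial_def)
    also have "\<dots> = - (\<integral>x. p x * partial_deriv 1 \<phi> x + (v x $ 1 * v x $ 1 * partial_deriv 1 \<phi> x) / 2
        + (v x $ 2 * v x $ 2 * partial_deriv 1 \<phi> x) / 2 \<partial>?M)"
      by (simp add: head_eq algebra_simps add_divide_distrib)
    also have "\<dots> = - ((\<integral>x. p x * partial_deriv 1 \<phi> x \<partial>?M) + (\<integral>x. v x $ 1 * v x $ 1 * partial_deriv 1 \<phi> x \<partial>?M) / 2
        + (\<integral>x. v x $ 2 * v x $ 2 * partial_deriv 1 \<phi> x \<partial>?M) / 2)"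
      using i\<phi>'[OF l(2)] i\<phi>'[OF l(5), of 1] i\<phi>'[OF l(5), of 2] by simp
    also have "(\<integral>x. p x * partial_deriv 1 \<phi> x \<partial>?M) = - (\<integral>x. P x * \<phi> x \<partial>?M)"
      using wp \<phi> by (simp add: has_weak_partial_def)
    finally have "(\<integral>x. G x * \<phi> x \<partial>?M) = (\<integral>x. P x * \<phi> x \<partial>?M)
        + (\<integral>x. v x $ 1 * V 1 x * \<phi> x \<partial>?M) + (\<integral>x. v x $ 2 * V 2 x * \<phi> x \<partial>?M)"
      unfolding sq by simp
    then show "(\<integral>x. (G x - (P x + v x $ 1 * V 1 x + v x $ 2 * V 2 x)) * \<phi> x \<partial>?M) = 0"
      using i\<phi>[OF l(1)] i\<phi>[OF l(3)] i\<phi>[OF l(4), of 1] i\<phi>[OF l(4), of 2]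
      by (simp add: left_diff_distrib distrib_right)
  qed
  then show ?thesis
    unfolding G_def P_def V_def by eventually_elim simp
qed

lemma head_derivative_eq_vorticity_times_velocity:
  assumes "open \<Omega>" "steady_euler \<Omega> v p"
    and p: "p \<in> W1 1 \<Omega>"
    and head: "total_head v p \<in> W1 1 \<Omega>"
  shows "AE x in lebesgue_on \<Omega>. weak_partial \<Omega> 1 (total_head v p) x
    = v x $ 2 * (weak_partial \<Omega> 1 (\<lambda>y. v y $ 2) x - weak_partial \<Omega> 2 (\<lambda>y. v y $ 1) x)"
proof -
  obtain g :: "real^2 \<Rightarrow> real^2" where g: "\<And>i. has_trace 2 \<Omega> (\<lambda>x. v x $ i) (\<lambda>x. g x $ i)"
    using assms(2) unfolding steady_euler_def zero_normal_trace_def by blast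
  have "AE x in lebesgue_on \<Omega>. \<forall>i.
        (\<Sum>j\<in>UNIV. v x $ j * weak_partial \<Omega> j (\<lambda>y. v y $ i) x) + weak_partial \<Omega> i p x = 0"
    using assms(2) unfolding steady_euler_def by blast
  with weak_partial_total_head[OF \<open>open \<Omega>\<close> g p head] show ?thesis
  proof eventually_elim
    case (elim x)
    from elim(2)[rule_format, of 1] elim(1) show ?case
      by (simp add: sum_2 algebra_simps)
  qed
qed

section \<open>Smooth loops symmetric about the axis\<close>

lemma smooth_has_vector_derivative:
  fixes c :: "real \<Rightarrow> 'b::euclidean_space"
  assumes "smooth c"
  shows "(c has_vector_derivative vector_derivative c (at t)) (at t)"
proof -
  have "c differentiable (at t)"
    using smooth_has_derivative[OF assms] by (auto simp: differentiable_def)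
  then show ?thesis by (simp add: vector_derivative_works)
qed

lemma smooth_continuous_vector_derivative:
  fixes c :: "real \<Rightarrow> 'b::euclidean_space"
  assumes "smooth c"
  shows "continuous_on A (\<lambda>t. vector_derivative c (at t))"
proof -
  have "vector_derivative c (at t) = frechet_derivative c (at t) 1" for t
  proof -
    have "(c has_derivative (\<lambda>h. h *\<^sub>R vector_derivative c (at t))) (at t)"
      using smooth_has_vector_derivative[OF assms] by (simp add: has_vector_derivative_def)
    from frechet_derivative_at[OF this] show ?thesis by (metis scaleR_one)
  qed
  then show ?thesis
    using smooth_continuous[OF smooth_directional_derivative[OF assms]] by simp
qed

locale smooth_loop_param =
  fixes c :: "real \<Rightarrow> real^2"
  assumes loop: "smooth_loop c"
begin

definition c' :: "real \<Rightarrow> real^2" where "c' t = vector_derivative c (at t)"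

lemma smooth_c: "smooth c" and c'_nonzero: "c' t \<noteq> 0"
  using loop by (auto simp: smooth_loop_def c'_def)

lemma continuous_c: "continuous_on A c"
  by (rule smooth_continuous[OF smooth_c])

lemma continuous_c': "continuous_on A c'"
  unfolding c'_def[abs_def] by (rule smooth_continuous_vector_derivative[OF smooth_c])

lemma has_real_derivative_component:
  "((\<lambda>t. c t $ i) has_real_derivative c' t $ i) (at t within S)"
proof -
  have "((\<lambda>t. c t $ i) has_vector_derivative c' t $ i) (at t)"
    using bounded_linear.has_vector_derivative[OF bounded_linear_vec_nth smooth_has_vector_derivative[OF smooth_c]]
    by (simp add: c'_def)
  then show ?thesis
    by (simp add: has_real_derivative_iff_has_vector_derivative has_vector_derivative_at_within)
qed

lemma periodic_int: "c (t + of_int n) = c t"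
proof -
  have p: "c (t + 1) = c t" for t
    using loop by (auto simp: smooth_loop_def)
  have nat: "c (t + of_nat m) = c t" for t m
  proof (induction m)
    case (Suc m)
    then show ?case using p[of "t + of_nat m"] by (simp add: add_ac)
  qed simp
  show ?thesis
  proof (cases "n \<ge> 0")
    case True
    then show ?thesis using nat[of t "nat n"] by simp
  next
    case False
    then show ?thesis using nat[of "t + of_int n" "nat (- n)"] by simp
  qed
qed

lemma eq_imp_int_difference:
  assumes "c s = c t"
  obtains n :: int where "s = t + of_int n"
proof -
  have "c (frac s) = c (frac t)"
    using assms periodic_int[of s "- \<lfloor>s\<rfloor>"] periodic_int[of t "- \<lfloor>t\<rfloor>"] by (simp add: frac_def)
  moreover have "inj_on c {0..<1}" using loop by (simp add: smooth_loop_def)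
  ultimately have "frac s = frac t"
    by (auto simp: inj_on_def frac_lt_1)
  then have "s = t + of_int (\<lfloor>s\<rfloor> - \<lfloor>t\<rfloor>)"
    by (simp add: frac_def)
  then show ?thesis by (rule that)
qed

lemma range_eq_path_image: "range c = path_image c"
proof -
  have "c t \<in> c ` {0..1}" for t
  proof -
    have "c t = c (frac t)"
      using periodic_int[of t "- \<lfloor>t\<rfloor>"] by (simp add: frac_def)
    moreover have "frac t \<in> {0..1}"
      using frac_lt_1[of t] by (simp add: less_imp_le)
    ultimately show ?thesis by blast
  qed
  then show ?thesis by (auto simp: path_image_def)
qed

lemma compact_range: "compact (range c)" and connected_range: "connected (range c)"
  by (simp_all add: range_eq_path_image path_image_def compact_continuous_image continuous_c
      connected_continuous_image)

lemma simple_path_c: "simple_path c"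
  unfolding simple_path_def loop_free_def
proof (intro conjI ballI impI)
  show "path c" by (simp add: path_def continuous_c)
  fix x y :: real assume xy: "x \<in> {0..1}" "y \<in> {0..1}" "c x = c y"
  obtain n :: int where n: "x = y + of_int n"
    using xy(3) by (rule eq_imp_int_difference)
  have "of_int n \<ge> (-1::real)" "of_int n \<le> (1::real)" using n xy(1,2) by auto
  then have "n \<in> {-1, 0, 1}" by (simp add: of_int_le_iff[of n 1, where 'a = real, simplified]) linarith
  then show "x = y \<or> x = 0 \<and> y = 1 \<or> x = 1 \<and> y = 0"
    using n xy(1,2) by auto
qed

lemma homeomorphic_circle: "range c homeomorphic sphere (0::complex) 1"
proof -
  have "c 1 = c 0" using periodic_int[of 0 1] by simp
  then show ?thesis
    unfolding range_eq_path_image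
    by (intro homeomorphic_simple_path_image_circle simple_path_c) (simp_all add: pathfinish_def pathstart_def)
qed

text \<open>
  A loop does not come close to one of its points a second time: the arc over the remaining
  parameters of one period is compact and avoids that point.
\<close>

lemma local_arc:
  assumes "\<sigma> > 0"
  obtains \<rho> where "\<rho> > 0" "\<And>x. x \<in> range c \<Longrightarrow> dist x (c t0) < \<rho> \<Longrightarrow> \<exists>t. \<bar>t - t0\<bar> < \<sigma> \<and> c t = x"
proof -
  define \<sigma>' where "\<sigma>' = min \<sigma> (1/2)"
  have \<sigma>': "0 < \<sigma>'" "\<sigma>' \<le> \<sigma>" "\<sigma>' \<le> 1/2" using assms by (auto simp: \<sigma>'_def)
  let ?K = "c ` {t0 + \<sigma>'..t0 + 1 - \<sigma>'}"
  have "closed ?K"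
    by (intro compact_imp_closed compact_continuous_image continuous_c) auto
  moreover have "c t0 \<notin> ?K"
  proof
    assume "c t0 \<in> ?K"
    then obtain s where s: "s \<in> {t0 + \<sigma>'..t0 + 1 - \<sigma>'}" "c s = c t0" by auto
    then obtain n :: int where "s = t0 + of_int n" using eq_imp_int_difference by metis
    then have "0 < real_of_int n" "real_of_int n < 1" using s(1) \<sigma>' by auto
    then show False by simp
  qed
  ultimately have "open (- ?K)" "c t0 \<in> - ?K" by auto
  then obtain \<rho> where \<rho>: "\<rho> > 0" "ball (c t0) \<rho> \<subseteq> - ?K"
    by (rule openE)
  have "\<exists>t. \<bar>t - t0\<bar> < \<sigma> \<and> c t = x" if x: "x \<in> range c" "dist x (c t0) < \<rho>" for x
  proof -
    have xK: "x \<notin> ?K" using x(2) \<rho>(2) by (auto simp: dist_commute subset_iff)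
    obtain s where s: "x = c s" using x(1) by auto
    define n where "n = \<lfloor>s - t0 + \<sigma>'\<rfloor>"
    define s' where "s' = s - of_int n"
    have cs': "c s' = x" using periodic_int[of s "- n"] s by (simp add: s'_def)
    have lo: "t0 - \<sigma>' \<le> s'" "s' < t0 + 1 - \<sigma>'"
      using of_int_floor_le[of "s - t0 + \<sigma>'"] floor_correct[of "s - t0 + \<sigma>'"] unfolding s'_def n_def by linarith+
    have "s' < t0 + \<sigma>'" using xK cs' lo by force
    moreover have "s' \<noteq> t0 - \<sigma>'"
    proof
      assume "s' = t0 - \<sigma>'"
      then have "t0 + 1 - \<sigma>' = s' + of_int 1" by simp
      then have "c (t0 + 1 - \<sigma>') = x" by (simp only: periodic_int cs')
      then show False using xK \<sigma>'(3) by force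
    qed
    ultimately have "\<bar>s' - t0\<bar> < \<sigma>" using lo \<sigma>'(2) by auto
    then show ?thesis using cs' by blast
  qed
  with \<rho>(1) show ?thesis by (rule that)
qed

lemma component_inj_near:
  assumes nz: "\<And>z. \<bar>z - t0\<bar> < \<sigma> \<Longrightarrow> c' z $ i \<noteq> 0"
    and st: "\<bar>s - t0\<bar> < \<sigma>" "\<bar>t - t0\<bar> < \<sigma>" "c s $ i = c t $ i"
  shows "s = t"
proof -
  have *: False if "s < t" "\<bar>s - t0\<bar> < \<sigma>" "\<bar>t - t0\<bar> < \<sigma>" "c s $ i = c t $ i" for s t
  proof -
    have "\<exists>z. s < z \<and> z < t \<and> (\<lambda>h. h * c' z $ i) = (\<lambda>_. 0)"
    proof (rule Rolle_deriv)
      show "continuous_on {s..t} (\<lambda>t. c t $ i)"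
        by (intro continuous_intros continuous_c)
      show "((\<lambda>t. c t $ i) has_derivative (\<lambda>h. h * c' z $ i)) (at z)" for z
        using has_real_derivative_component[of i z UNIV] by (simp add: has_field_derivative_def mult_commute_abs)
    qed (use that in auto)
    then obtain z where z: "s < z" "z < t" "(\<lambda>h. h * c' z $ i) = (\<lambda>_. 0)" by blast
    have "c' z $ i = 0" using fun_cong[OF z(3), of 1] by simp
    moreover have "\<bar>z - t0\<bar> < \<sigma>" using z(1,2) that by auto
    ultimately show False using nz by blast
  qed
  show ?thesis using *[of s t] *[of t s] st by fastforce
qed

end

lemma dist_reflect_axis:
  assumes "a $ 2 = 0"
  shows "dist (reflect z) a = dist z a"
  using assms by (simp add: dist_norm norm_vec_def L2_set_def sum_2)

text \<open>
  At a tangential crossing the curve is locally a graph over the axis. Symmetry identifies the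
  graph with its mirror image, so it is part of the axis. Hence the tangential crossings form an
  open as well as closed set of parameters: if there were one, the whole loop would run in the
  axis with nonvanishing speed, which Rolle's theorem forbids for a periodic function.
\<close>

lemma (in smooth_loop_param) axis_crossing_transversal:
  assumes sym: "\<And>a. a \<in> range c \<Longrightarrow> a $ 2 = 0 \<Longrightarrow>
      \<exists>r>0. \<forall>z\<in>range c. dist z a < r \<longrightarrow> reflect z \<in> range c"
    and "c t $ 2 = 0"
  shows "c' t $ 2 \<noteq> 0"
proof
  assume "c' t $ 2 = 0"
  \<comment> \<open>the parameters of tangential points on the axis\<close>
  define T where "T = {t. c t $ 2 = 0 \<and> c' t $ 2 = 0}"
  have "closed {t. c t $ 2 = 0}" "closed {t. c' t $ 2 = 0}"
    by (intro closed_Collect_eq continuous_intros continuous_c continuous_c')+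
  then have "closed T"
    unfolding T_def Collect_conj_eq by (rule closed_Int)
  moreover have "open T"
    unfolding open_dist
  proof
    fix t0 assume t0: "t0 \<in> T"
    then have "c' t0 $ 1 \<noteq> 0" using c'_nonzero[of t0] by (simp add: T_def vec2_eq_iff)
    moreover have "isCont (\<lambda>t. c' t $ 1) t0"
      using continuous_c'[of UNIV] by (simp add: continuous_on_eq_continuous_at continuous_intros)
    ultimately obtain \<sigma> where \<sigma>: "\<sigma> > 0" "\<And>t. dist t0 t < \<sigma> \<Longrightarrow> c' t $ 1 \<noteq> 0"
      using continuous_at_avoid by blast
    have inj: "s = t" if "\<bar>s - t0\<bar> < \<sigma>" "\<bar>t - t0\<bar> < \<sigma>" "c s $ 1 = c t $ 1" for s t
      by (rule component_inj_near[OF _ that]) (use \<sigma>(2) in \<open>simp add: dist_real_def abs_minus_commute\<close>)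
    obtain \<rho> where \<rho>: "\<rho> > 0" "\<And>x. x \<in> range c \<Longrightarrow> dist x (c t0) < \<rho> \<Longrightarrow> \<exists>t. \<bar>t - t0\<bar> < \<sigma> \<and> c t = x"
      using local_arc[OF \<sigma>(1)] by metis
    obtain r where r: "r > 0" "\<And>z. z \<in> range c \<Longrightarrow> dist z (c t0) < r \<Longrightarrow> reflect z \<in> range c"
      using sym[of "c t0"] t0 by (auto simp: T_def)
    have "isCont c t0" using continuous_c[of UNIV] by (simp add: continuous_on_eq_continuous_at)
    then obtain \<delta> where \<delta>: "\<delta> > 0" "\<And>t. dist t t0 < \<delta> \<Longrightarrow> dist (c t) (c t0) < min \<rho> r"
      using \<rho>(1) r(1) unfolding continuous_at_eps_delta by (metis min_less_iff_conj)
    define e where "e = min \<delta> \<sigma>"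
    have e: "e > 0" using \<delta>(1) \<sigma>(1) by (simp add: e_def)
    \<comment> \<open>The mirror image of \<open>c t\<close> lies on the same arc and has the same abscissa, so it is \<open>c t\<close>.\<close>
    have zero: "c t $ 2 = 0" if "dist t t0 < e" for t
    proof -
      have d: "dist (c t) (c t0) < min \<rho> r" using \<delta>(2) that by (simp add: e_def)
      then have "reflect (c t) \<in> range c" using r(2) by simp
      moreover have "dist (reflect (c t)) (c t0) < \<rho>"
        using d t0 by (simp add: dist_reflect_axis T_def)
      ultimately obtain s where s: "\<bar>s - t0\<bar> < \<sigma>" "c s = reflect (c t)" using \<rho>(2) by blast
      have "s = t" by (rule inj) (use s that in \<open>auto simp: dist_real_def e_def\<close>)
      then have "c t $ 2 = - (c t $ 2)" using arg_cong[OF s(2), of "\<lambda>z. z $ 2"] by simp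
      then show ?thesis by simp
    qed
    have "c' t $ 2 = 0" if "dist t t0 < e" for t
    proof -
      have "((\<lambda>_. 0::real) has_real_derivative 0) (at t)" by simp
      then have "((\<lambda>t. c t $ 2) has_real_derivative 0) (at t)"
        by (rule has_field_derivative_transform_within_open[where S = "ball t0 e"])
          (use that zero in \<open>auto simp: dist_commute\<close>)
      then show ?thesis using has_real_derivative_component[of 2 t UNIV] DERIV_unique by blast
    qed
    with zero e show "\<exists>e>0. \<forall>y. dist y t0 < e \<longrightarrow> y \<in> T" by (auto simp: T_def)
  qed
  moreover have "t \<in> T" using \<open>c' t $ 2 = 0\<close> \<open>c t $ 2 = 0\<close> by (simp add: T_def)
  ultimately have "T = UNIV" using clopen[of T] by blast
  have "\<exists>z. 0 < z \<and> z < 1 \<and> (\<lambda>h. h * c' z $ 1) = (\<lambda>_. 0)"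
  proof (rule Rolle_deriv)
    show "c 0 $ 1 = c 1 $ 1" using periodic_int[of 0 1] by simp
    show "continuous_on {0..1} (\<lambda>t. c t $ 1)"
      by (intro continuous_intros continuous_c)
    show "((\<lambda>t. c t $ 1) has_derivative (\<lambda>h. h * c' z $ 1)) (at z)" for z
      using has_real_derivative_component[of 1 z UNIV] by (simp add: has_field_derivative_def mult_commute_abs)
  qed simp
  then obtain z where "(\<lambda>h. h * c' z $ 1) = (\<lambda>_. 0)" by blast
  from fun_cong[OF this, of 1] have "c' z $ 1 = 0" by simp
  moreover have "c' z $ 2 = 0" using \<open>T = UNIV\<close> by (auto simp: T_def)
  ultimately show False using c'_nonzero[of z] by (simp add: vec2_eq_iff)
qed

text \<open>
  A bounded domain whose frontier is a Jordan curve does not lie on both sides of it: the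
  unbounded component of the complement of the curve also has the entire curve as its frontier
  (Jordan-Brouwer) and is disjoint from the domain.
\<close>

lemma smooth_closed_curve_exterior_side:
  assumes \<Gamma>: "smooth_closed_curve (frontier U)"
    and U: "open U" "connected U" "bounded U" "U \<noteq> {}"
  shows "frontier U \<subseteq> closure (- closure U)"
proof -
  obtain c where "smooth_loop c" and c: "range c = frontier U"
    using \<Gamma> by (auto simp: smooth_closed_curve_def)
  then interpret smooth_loop_param c by unfold_locales
  let ?\<Gamma> = "frontier U"
  have "compact ?\<Gamma>" using compact_range c by simp
  then have "bounded (- (- ?\<Gamma>))" by (simp add: compact_imp_bounded)
  then obtain x where x: "x \<in> - ?\<Gamma>" "\<not> bounded (connected_component_set (- ?\<Gamma>) x)"
    using cobounded_unbounded_component[of "- ?\<Gamma>"] by auto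
  define O' where "O' = connected_component_set (- ?\<Gamma>) x"
  have O': "O' \<in> components (- ?\<Gamma>)" using x(1) by (simp add: O'_def componentsI)
  have "open O'"
    using open_components[OF _ O'] \<open>compact ?\<Gamma>\<close> by (simp add: compact_imp_closed open_Compl)
  have "O' \<inter> U = {}"
  proof (rule ccontr)
    assume "O' \<inter> U \<noteq> {}"
    moreover have "connected O'" using O' by (rule in_components_connected)
    moreover have "O' \<inter> ?\<Gamma> = {}" using in_components_subset[OF O'] by blast
    ultimately have "O' \<subseteq> U" using connected_Int_frontier[of O' U] by blast
    then show False using x(2) U(3) bounded_subset unfolding O'_def by blast
  qed
  then have "O' \<inter> closure U = {}"
    using \<open>open O'\<close> open_Int_closure_eq_empty by blast
  moreover have "frontier O' = ?\<Gamma>"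
  proof (rule Jordan_Brouwer_frontier[OF _ O'])
    show "?\<Gamma> homeomorphic sphere (0 :: real^2) 1"
      using homeomorphic_trans[OF homeomorphic_circle] homeomorphic_spheres_gen[of 1 1 "0::complex" "0::real^2"] c
      by simp
  qed simp
  ultimately show ?thesis
    using closure_mono[of O' "- closure U"] by (auto simp: frontier_def)
qed

section \<open>The perforated domain and charts along the axis\<close>

text \<open>
  A chart near a point \<open>a\<close> of the axis: the horizontal translates of the graph \<open>x\<^sub>1 = g x\<^sub>2\<close> lie
  entirely inside or entirely outside \<open>\<Omega>\<close>. They play the part of vertical segments.
\<close>

definition axis_chart ::
  "(real^2) set \<Rightarrow> real^2 \<Rightarrow> real \<Rightarrow> real \<Rightarrow> (real \<Rightarrow> real) \<Rightarrow> (real \<Rightarrow> real) \<Rightarrow> bool" where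
  "axis_chart \<Omega> a \<rho> r g g' \<longleftrightarrow>
     0 < \<rho> \<and> 0 < r \<and> g 0 = a $ 1 \<and>
     (\<forall>y. \<bar>y\<bar> < \<rho> \<longrightarrow> (g has_real_derivative g' y) (at y)) \<and>
     continuous_on {-\<rho><..<\<rho>} g' \<and> bounded (g' ` {-\<rho><..<\<rho>}) \<and>
     (\<forall>s y. \<bar>s\<bar> < r \<longrightarrow> \<bar>y\<bar> < \<rho> \<longrightarrow> (pt (g y + s) y \<in> \<Omega> \<longleftrightarrow> pt (g 0 + s) 0 \<in> \<Omega>))"

lemma norm_pt_le: "norm (pt x y) \<le> \<bar>x\<bar> + \<bar>y\<bar>"
  using norm_le_l1_cart[of "pt x y"] by (simp add: sum_2)

lemma pt_diff: "pt x y - pt x' y' = pt (x - x') (y - y')"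
  by (simp add: vec2_eq_iff)

lemma dist_pt_le: "dist (pt x y) (pt x' y') \<le> \<bar>x - x'\<bar> + \<bar>y - y'\<bar>"
  unfolding dist_norm pt_diff by (rule norm_pt_le)

text \<open>
  Transversality makes the boundary curve a graph \<open>x\<^sub>1 = g x\<^sub>2\<close> near the crossing. A small
  nonzero translate of this graph is connected and does not meet the frontier, so it lies on one
  side of it; the graph itself lies in the frontier.
\<close>

lemma (in smooth_loop_param) axis_chart_at_crossing:
  assumes "open \<Omega>" and sub: "range c \<subseteq> frontier \<Omega>"
    and R: "R > 0" "frontier \<Omega> \<inter> ball (c t0) R \<subseteq> range c"
    and t0: "c t0 $ 2 = 0" "c' t0 $ 2 \<noteq> 0"
  obtains \<rho> r g g' where "axis_chart \<Omega> (c t0) \<rho> r g g'"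
proof -
  have "isCont (\<lambda>t. c' t $ 2) t0"
    using continuous_c'[of UNIV] by (simp add: continuous_on_eq_continuous_at continuous_intros)
  then obtain \<sigma> where \<sigma>: "\<sigma> > 0" "\<And>t. dist t0 t < \<sigma> \<Longrightarrow> c' t $ 2 \<noteq> 0"
    using continuous_at_avoid t0(2) by blast
  define S where "S = {t. \<bar>t - t0\<bar> < \<sigma>}"
  have S: "S = {t0 - \<sigma><..<t0 + \<sigma>}" by (auto simp: S_def abs_less_iff)
  have nz: "c' t $ 2 \<noteq> 0" if "t \<in> S" for t
    using \<sigma>(2)[of t] that by (simp add: S_def dist_real_def abs_minus_commute)
  define f where "f t = c t $ 2" for t
  have inj: "inj_on f S"
    unfolding inj_on_def f_def
  proof (intro ballI impI)
    fix s t assume "s \<in> S" "t \<in> S" "c s $ 2 = c t $ 2"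
    then show "s = t"
      by (intro component_inj_near[of t0 \<sigma> 2 s t]) (use nz in \<open>auto simp: S_def\<close>)
  qed
  have contf: "continuous_on A f" for A
    unfolding f_def by (intro continuous_intros continuous_c)
  define U where "U = f ` S"
  have "open U"
    unfolding U_def by (rule invariance_of_domain[OF contf _ inj]) (simp add: S)
  have "t0 \<in> S" using \<sigma>(1) by (simp add: S_def)
  then have "0 \<in> U" using t0(1) by (auto simp: U_def f_def intro!: image_eqI[of _ _ t0])
  \<comment> \<open>the parameter of the curve as a function of the height\<close>
  define \<tau> where "\<tau> = inv_into S f"
  have \<tau>f: "\<tau> (f t) = t" if "t \<in> S" for t
    using inj that by (simp add: \<tau>_def)
  have \<tau>S: "\<tau> y \<in> S" and f\<tau>: "f (\<tau> y) = y" if "y \<in> U" for y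
    using that by (auto simp: \<tau>_def U_def inv_into_into f_inv_into_f)
  have d\<tau>: "(\<tau> has_real_derivative 1 / c' (\<tau> y) $ 2) (at y)" if "y \<in> U" for y
  proof -
    have "(f has_derivative (\<lambda>h. c' (\<tau> y) $ 2 * h)) (at (\<tau> y))"
      unfolding f_def using has_real_derivative_component[of 2 "\<tau> y" UNIV] by (simp add: has_field_derivative_def)
    then have "(\<tau> has_derivative (*) (1 / c' (\<tau> y) $ 2)) (at (f (\<tau> y)))"
      by (rule has_derivative_inverse_strong[of S "\<tau> y" f \<tau>, rotated 4])
        (use \<tau>f \<tau>S[OF that] nz[OF \<tau>S[OF that]] contf in \<open>auto simp: S fun_eq_iff\<close>)
    then show ?thesis
      unfolding f\<tau>[OF that] has_field_derivative_def .
  qed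
  define g where "g y = c (\<tau> y) $ 1" for y
  define g' where "g' y = c' (\<tau> y) $ 1 * (1 / c' (\<tau> y) $ 2)" for y
  have dg: "(g has_real_derivative g' y) (at y)" if "y \<in> U" for y
  proof -
    have "((\<lambda>t. c t $ 1) has_real_derivative c' (\<tau> y) $ 1) (at (\<tau> y))"
      by (rule has_real_derivative_component)
    from DERIV_chain2[OF this d\<tau>[OF that]] show ?thesis
      unfolding g_def g'_def .
  qed
  have cont\<tau>: "continuous_on U \<tau>"
    using DERIV_isCont[OF d\<tau>] by (simp add: continuous_at_imp_continuous_on)
  have contg': "continuous_on U g'"
    unfolding g'_def
    by (intro continuous_intros continuous_on_compose2[OF continuous_c'[of UNIV] cont\<tau>]) (use nz \<tau>S in auto)
  have gc: "pt (g y) y = c (\<tau> y)" if "y \<in> U" for y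
    using f\<tau>[OF that] by (simp add: vec2_eq_iff g_def f_def)
  have \<tau>0: "\<tau> 0 = t0" using \<tau>f[OF \<open>t0 \<in> S\<close>] t0(1) by (simp add: f_def)
  obtain \<rho>1 where \<rho>1: "\<rho>1 > 0" "cball 0 \<rho>1 \<subseteq> U"
    using \<open>open U\<close> \<open>0 \<in> U\<close> by (meson open_contains_cball)
  obtain \<rho>2 where \<rho>2: "\<rho>2 > 0" "\<And>x. x \<in> range c \<Longrightarrow> dist x (c t0) < \<rho>2 \<Longrightarrow> \<exists>t. \<bar>t - t0\<bar> < \<sigma> \<and> c t = x"
    using local_arc[OF \<sigma>(1)] by metis
  define e where "e = min R \<rho>2"
  have e: "e > 0" "e \<le> R" "e \<le> \<rho>2" using R(1) \<rho>2(1) by (auto simp: e_def)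
  have "isCont g 0" using DERIV_isCont[OF dg[OF \<open>0 \<in> U\<close>]] .
  then obtain \<delta> where \<delta>: "\<delta> > 0" "\<And>y. dist y 0 < \<delta> \<Longrightarrow> dist (g y) (g 0) < e / 3"
    unfolding continuous_at_eps_delta using e(1) by (metis divide_pos_pos zero_less_numeral)
  define \<rho> where "\<rho> = min (min \<rho>1 \<delta>) (e / 3)"
  have \<rho>: "\<rho> > 0" "\<rho> \<le> \<rho>1" "\<rho> \<le> \<delta>" "\<rho> \<le> e / 3" using \<rho>1(1) \<delta>(1) e(1) by (auto simp: \<rho>_def)
  have \<rho>U: "y \<in> U" if "\<bar>y\<bar> < \<rho>" for y
    using that \<rho>(2) \<rho>1(2) by (auto simp: subset_iff)
  have near: "dist (pt (g y + s) y) (c t0) < e" if "\<bar>s\<bar> < e / 3" "\<bar>y\<bar> < \<rho>" for s y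
  proof -
    have "c t0 = pt (g 0) 0" using gc[OF \<open>0 \<in> U\<close>] \<tau>0 by simp
    then have "dist (pt (g y + s) y) (c t0) \<le> \<bar>g y + s - g 0\<bar> + \<bar>y - 0\<bar>"
      using dist_pt_le by metis
    moreover have "\<bar>g y - g 0\<bar> < e / 3" using \<delta>(2)[of y] that \<rho>(3) by (simp add: dist_real_def)
    ultimately show ?thesis using that \<rho>(4) by linarith
  qed
  have side: "pt (g y + s) y \<in> \<Omega> \<Longrightarrow> pt (g y' + s) y' \<in> \<Omega>"
    if s: "\<bar>s\<bar> < e / 3" and y: "\<bar>y\<bar> < \<rho>" "\<bar>y'\<bar> < \<rho>" for s y y'
  proof (cases "s = 0")
    case True
    assume "pt (g y + s) y \<in> \<Omega>"
    then have "c (\<tau> y) \<in> \<Omega>" using gc[OF \<rho>U[OF y(1)]] True by simp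
    moreover have "c (\<tau> y) \<in> frontier \<Omega>" using sub by blast
    ultimately show ?thesis using \<open>open \<Omega>\<close> by (simp add: frontier_def interior_open)
  next
    case False
    assume in\<Omega>: "pt (g y + s) y \<in> \<Omega>"
    let ?A = "(\<lambda>y. pt (g y + s) y) ` {-\<rho><..<\<rho>}"
    have cg: "continuous_on {-\<rho><..<\<rho>} g"
      using DERIV_isCont[OF dg] \<rho>U by (auto intro!: continuous_at_imp_continuous_on simp: abs_less_iff)
    have "connected ?A"
      by (intro connected_continuous_image continuous_intros cg) auto
    moreover have "?A \<inter> \<Omega> \<noteq> {}"
    proof -
      have "y \<in> {-\<rho><..<\<rho>}" using y(1) by auto
      then show ?thesis using in\<Omega> by blast
    qed
    moreover have "?A \<inter> frontier \<Omega> = {}"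
    proof (rule ccontr)
      assume "?A \<inter> frontier \<Omega> \<noteq> {}"
      then obtain u where "u \<in> {-\<rho><..<\<rho>}" and u2: "pt (g u + s) u \<in> frontier \<Omega>" by blast
      then have u: "\<bar>u\<bar> < \<rho>" "pt (g u + s) u \<in> frontier \<Omega>" by auto
      have d: "dist (pt (g u + s) u) (c t0) < e" by (rule near[OF s u(1)])
      then have "pt (g u + s) u \<in> range c" using R(2) u(2) e(2) by (auto simp: dist_commute)
      then obtain t where t: "\<bar>t - t0\<bar> < \<sigma>" "c t = pt (g u + s) u" using \<rho>2(2) d e(3) by force
      have "f t = u" using t(2) by (simp add: f_def)
      then have "\<tau> u = t" using \<tau>f[of t] t(1) by (auto simp: S_def)
      then have "g u = c t $ 1" by (simp add: g_def)
      moreover have "c t $ 1 = g u + s" using arg_cong[OF t(2), of "\<lambda>z. z $ 1"] by simp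
      ultimately show False using False by simp
    qed
    ultimately have "?A \<subseteq> \<Omega>" using connected_Int_frontier[of ?A \<Omega>] by blast
    moreover have "y' \<in> {-\<rho><..<\<rho>}" using y(2) by auto
    ultimately show ?thesis by blast
  qed
  have "axis_chart \<Omega> (c t0) \<rho> (e / 3) g g'"
    unfolding axis_chart_def
  proof (intro conjI allI impI)
    show "0 < \<rho>" "0 < e / 3" using \<rho>(1) e(1) by auto
    show "g 0 = c t0 $ 1" by (simp add: g_def \<tau>0)
    show "(g has_real_derivative g' y) (at y)" if "\<bar>y\<bar> < \<rho>" for y
      by (rule dg[OF \<rho>U[OF that]])
    show "continuous_on {-\<rho><..<\<rho>} g'"
      by (rule continuous_on_subset[OF contg']) (use \<rho>U in \<open>auto simp: abs_less_iff\<close>)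
    have "bounded (g' ` cball 0 \<rho>1)"
      by (intro compact_imp_bounded compact_continuous_image continuous_on_subset[OF contg' \<rho>1(2)]) auto
    then show "bounded (g' ` {-\<rho><..<\<rho>})"
      by (rule bounded_subset) (use \<rho>(2) in \<open>auto intro!: imageI\<close>)
    show "pt (g y + s) y \<in> \<Omega> \<longleftrightarrow> pt (g 0 + s) 0 \<in> \<Omega>" if "\<bar>s\<bar> < e / 3" "\<bar>y\<bar> < \<rho>" for s y
      using side[OF that, of 0] side[OF that(1), of 0 y] that(2) \<rho>(1) by auto
  qed
  then show ?thesis by (rule that)
qed

lemma axis_chart_at_interior:
  assumes "open \<Omega>" "a \<in> \<Omega>" "a $ 2 = 0"
  obtains \<rho> r g g' where "axis_chart \<Omega> a \<rho> r g g'"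
proof -
  obtain e where e: "e > 0" "ball a e \<subseteq> \<Omega>" using assms(1,2) by (meson openE)
  have "a = pt (a $ 1) 0" using assms(3) by (simp add: vec2_eq_iff)
  then have "dist (pt (a $ 1 + s) y) a \<le> \<bar>s\<bar> + \<bar>y\<bar>" for s y
    using dist_pt_le[of "a $ 1 + s" y "a $ 1" 0] by simp
  then have "pt (a $ 1 + s) y \<in> \<Omega>" if "\<bar>s\<bar> < e / 2" "\<bar>y\<bar> < e / 2" for s y
  proof -
    have "dist (pt (a $ 1 + s) y) a < e"
      using \<open>dist (pt (a $ 1 + s) y) a \<le> \<bar>s\<bar> + \<bar>y\<bar>\<close> that by linarith
    then show ?thesis using e(2) by (auto simp: dist_commute)
  qed
  then have "axis_chart \<Omega> a (e / 2) (e / 2) (\<lambda>_. a $ 1) (\<lambda>_. 0)"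
    using e(1) unfolding axis_chart_def by (auto intro!: boundedI[of _ 0])
  then show ?thesis by (rule that)
qed

locale admissible_domain =
  fixes N :: nat and D :: "nat \<Rightarrow> (real^2) set" and \<Omega> :: "(real^2) set"
  assumes adm: "admissible N D" and \<Omega>_eq: "\<Omega> = perforated N D"
begin

lemma component_domain:
  assumes "j \<le> N"
  shows "D j \<noteq> {}" "open (D j)" "connected (D j)" "bounded (D j)" "smooth_closed_curve (frontier (D j))"
    "frontier (D j) \<inter> x1_axis \<noteq> {}"
  using adm assms unfolding admissible_def by blast+

lemma closure_D_subset: "j \<in> {1..N} \<Longrightarrow> closure (D j) \<subseteq> D 0"
  using adm unfolding admissible_def by blast

lemma closure_D_disjoint: "i \<in> {1..N} \<Longrightarrow> j \<in> {1..N} \<Longrightarrow> i \<noteq> j \<Longrightarrow> closure (D i) \<inter> closure (D j) = {}"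
  using adm unfolding admissible_def by blast

lemma reflect_mem_\<Omega>: "reflect x \<in> \<Omega> \<longleftrightarrow> x \<in> \<Omega>"
proof -
  have "reflect ` \<Omega> = \<Omega>" using adm unfolding admissible_def \<Omega>_eq by blast
  then show ?thesis by (metis imageI reflect_reflect)
qed

lemma mem_\<Omega>: "x \<in> \<Omega> \<longleftrightarrow> x \<in> D 0 \<and> (\<forall>j\<in>{1..N}. x \<notin> closure (D j))"
  by (auto simp: \<Omega>_eq perforated_def)

lemma open_\<Omega>: "open \<Omega>"
  unfolding \<Omega>_eq perforated_def using component_domain(2)[of 0] by (intro open_Diff closed_UN) auto

lemma bounded_\<Omega>: "bounded \<Omega>"
  using component_domain(4)[of 0] by (rule bounded_subset) (auto simp: mem_\<Omega>)

lemma frontier_D_disjoint: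
  assumes "i \<le> N" "j \<le> N" "i \<noteq> j"
  shows "frontier (D i) \<inter> frontier (D j) = {}"
proof -
  have 0: "frontier (D 0) \<inter> frontier (D k) = {}" if "k \<in> {1..N}" for k
    using closure_D_subset[OF that] component_domain(2)[of 0] by (auto simp: frontier_def interior_open)
  consider "i = 0" | "j = 0" | "i \<in> {1..N}" "j \<in> {1..N}" using assms by force
  then show ?thesis
  proof cases
    case 1
    then show ?thesis using 0[of j] assms by auto
  next
    case 2
    then show ?thesis using 0[of i] assms by (auto simp: Int_commute)
  next
    case 3
    then show ?thesis using closure_D_disjoint[OF 3 assms(3)] by (auto simp: frontier_def)
  qed
qed

text \<open>
  Every point of an inner curve is a limit of points of \<open>\<Omega>\<close> because the hole lies on only one
  side of its boundary curve.
\<close>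

lemma frontier_\<Omega>: "frontier \<Omega> = (\<Union>j\<le>N. frontier (D j))"
proof (intro equalityI subsetI)
  fix x assume "x \<in> frontier \<Omega>"
  then have x: "x \<in> closure \<Omega>" "x \<notin> \<Omega>" using open_\<Omega> by (auto simp: frontier_def interior_open)
  have "\<Omega> \<subseteq> D 0" by (auto simp: mem_\<Omega>)
  then have "x \<in> closure (D 0)" using x(1) closure_mono by blast
  show "x \<in> (\<Union>j\<le>N. frontier (D j))"
  proof (cases "x \<in> D 0")
    case False
    then have "x \<in> frontier (D 0)" using \<open>x \<in> closure (D 0)\<close> component_domain(2)[of 0] by (simp add: frontier_def interior_open)
    then show ?thesis by blast
  next
    case True
    then obtain j where j: "j \<in> {1..N}" "x \<in> closure (D j)" using x(2) mem_\<Omega> by blast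
    have "D j \<inter> \<Omega> = {}" using closure_subset[of "D j"] j(1) by (auto simp: mem_\<Omega>)
    then have "D j \<inter> closure \<Omega> = {}" using component_domain(2)[of j] j(1) open_Int_closure_eq_empty by auto
    then have "x \<notin> D j" using x(1) by blast
    then have "x \<in> frontier (D j)" using j component_domain(2)[of j] by (simp add: frontier_def interior_open)
    then show ?thesis using j(1) by auto
  qed
next
  fix x assume "x \<in> (\<Union>j\<le>N. frontier (D j))"
  then obtain j where j: "j \<le> N" "x \<in> frontier (D j)" by blast
  define W where "W = (\<Inter>i\<in>{1..N} - {j}. - closure (D i))"
  have "open W" unfolding W_def by (intro open_INT) auto
  have xW: "x \<in> W" if "j \<in> {1..N}"
    using closure_D_disjoint[OF that] j(2) by (fastforce simp: W_def frontier_def)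
  have "x \<in> closure \<Omega> \<and> x \<notin> \<Omega>"
  proof (cases "j = 0")
    case True
    have x0: "x \<in> closure (D 0)" "x \<notin> D 0"
      using j(2) True component_domain(2)[of 0] by (auto simp: frontier_def interior_open)
    then have "x \<in> W" using closure_D_subset by (fastforce simp: W_def)
    then have "x \<in> closure (W \<inter> D 0)"
      using open_Int_closure_subset[OF \<open>open W\<close>, of "D 0"] x0(1) by blast
    moreover have "W \<inter> D 0 \<subseteq> \<Omega>" using True by (auto simp: W_def mem_\<Omega>)
    ultimately show ?thesis using closure_mono x0(2) mem_\<Omega> by blast
  next
    case False
    then have j1: "j \<in> {1..N}" using j(1) by simp
    have "x \<in> closure (- closure (D j))"
      using smooth_closed_curve_exterior_side[of "D j"] component_domain[OF j(1)] j(2) by blast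
    moreover have "x \<in> W \<inter> D 0" using xW[OF j1] closure_D_subset[OF j1] j(2) by (auto simp: frontier_def)
    moreover have "open (W \<inter> D 0)" using \<open>open W\<close> component_domain(2)[of 0] by auto
    ultimately have "x \<in> closure ((W \<inter> D 0) \<inter> - closure (D j))"
      using open_Int_closure_subset by blast
    moreover have "(W \<inter> D 0) \<inter> - closure (D j) \<subseteq> \<Omega>" by (auto simp: W_def mem_\<Omega>)
    moreover have "x \<notin> \<Omega>" using j(2) j1 by (auto simp: mem_\<Omega> frontier_def)
    ultimately show ?thesis using closure_mono by blast
  qed
  then show "x \<in> frontier \<Omega>" using open_\<Omega> by (simp add: frontier_def interior_open)
qed

text \<open>
  The trace predicate speaks about the components of the frontier; this identifies them.
\<close>

lemma frontier_D_component:
  assumes "j \<le> N"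
  shows "frontier (D j) \<in> components (frontier \<Omega>)"
proof -
  obtain c where "smooth_loop c" and c: "range c = frontier (D j)"
    using component_domain(5)[OF assms] by (auto simp: smooth_closed_curve_def)
  then interpret smooth_loop_param c by unfold_locales
  let ?R = "\<Union>i\<in>{..N} - {j}. frontier (D i)"
  have split: "frontier \<Omega> = frontier (D j) \<union> ?R" using assms by (auto simp: frontier_\<Omega>)
  have disj: "frontier (D j) \<inter> ?R = {}" using frontier_D_disjoint[OF assms] by blast
  have "closed ?R" by (intro closed_UN) auto
  show ?thesis
    unfolding in_components_maximal
  proof (intro conjI allI impI)
    show "frontier (D j) \<noteq> {}" "connected (frontier (D j))" using c connected_range by auto
    show "frontier (D j) \<subseteq> frontier \<Omega>" using split by blast
    fix d assume d: "d \<noteq> {} \<and> frontier (D j) \<subseteq> d \<and> d \<subseteq> frontier \<Omega> \<and> connected d"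
    then have "d \<subseteq> frontier (D j) \<union> ?R" "frontier (D j) \<inter> d \<noteq> {}"
      using split \<open>frontier (D j) \<noteq> {}\<close> by auto
    moreover have "frontier (D j) \<inter> ?R \<inter> d = {}" using disj by blast
    ultimately have "?R \<inter> d = {}"
      using connected_closedD[of d "frontier (D j)" ?R] d \<open>closed ?R\<close> by auto
    with \<open>d \<subseteq> frontier (D j) \<union> ?R\<close> show "d = frontier (D j)" using d by blast
  qed
qed

lemma reflect_mem_frontier: "x \<in> frontier \<Omega> \<Longrightarrow> reflect x \<in> frontier \<Omega>"
proof -
  assume "x \<in> frontier \<Omega>"
  then have x: "x \<in> closure \<Omega>" "x \<notin> \<Omega>" using open_\<Omega> by (auto simp: frontier_def interior_open)
  have "reflect ` closure \<Omega> \<subseteq> closure \<Omega>"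
    by (rule image_closure_subset)
      (use closure_subset[of \<Omega>] reflect_mem_\<Omega> in \<open>auto intro!: continuous_intros\<close>)
  then show ?thesis using x reflect_mem_\<Omega> open_\<Omega> by (auto simp: frontier_def interior_open)
qed

lemma frontier_D_isolated:
  assumes "j \<le> N" "a \<in> frontier (D j)"
  obtains R where "R > 0" "frontier \<Omega> \<inter> ball a R \<subseteq> frontier (D j)"
proof -
  let ?R = "\<Union>i\<in>{..N} - {j}. frontier (D i)"
  have "closed ?R" by (intro closed_UN) auto
  moreover have "a \<notin> ?R" using frontier_D_disjoint[OF assms(1)] assms(2) by blast
  ultimately have "open (- ?R)" "a \<in> - ?R" by (blast intro: open_Compl)+
  then obtain R where R: "R > 0" "ball a R \<subseteq> - ?R" by (rule openE)
  have "frontier \<Omega> \<inter> ball a R \<subseteq> frontier (D j)" using R(2) by (auto simp: frontier_\<Omega>)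
  with R(1) show ?thesis by (rule that)
qed

lemma axis_chart_exists:
  assumes "a \<in> closure \<Omega>" "a $ 2 = 0"
  obtains \<rho> r g g' where "axis_chart \<Omega> a \<rho> r g g'"
proof (cases "a \<in> \<Omega>")
  case True
  then show ?thesis using axis_chart_at_interior[OF open_\<Omega> True assms(2)] that by metis
next
  case False
  then have "a \<in> frontier \<Omega>" using assms(1) open_\<Omega> by (simp add: frontier_def interior_open)
  then obtain j where j: "j \<le> N" "a \<in> frontier (D j)" by (auto simp: frontier_\<Omega>)
  obtain c where "smooth_loop c" and c: "range c = frontier (D j)"
    using component_domain(5)[OF j(1)] by (auto simp: smooth_closed_curve_def)
  then interpret smooth_loop_param c by unfold_locales
  have "a \<in> range c" using j(2) c by simp
  then obtain t0 where t0: "c t0 = a" by (metis rangeE)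
  have sub: "range c \<subseteq> frontier \<Omega>" using c j(1) by (auto simp: frontier_\<Omega>)
  have sym: "\<exists>r>0. \<forall>z\<in>range c. dist z b < r \<longrightarrow> reflect z \<in> range c" if b: "b \<in> range c" "b $ 2 = 0" for b
  proof -
    obtain R where R: "R > 0" "frontier \<Omega> \<inter> ball b R \<subseteq> frontier (D j)"
      using frontier_D_isolated[OF j(1)] b(1) c by metis
    have "reflect z \<in> range c" if "z \<in> range c" "dist z b < R" for z
    proof -
      have "reflect z \<in> frontier \<Omega>" using reflect_mem_frontier sub that(1) by blast
      moreover have "dist (reflect z) b < R" using that(2) by (simp add: dist_reflect_axis[OF b(2)])
      ultimately show ?thesis using R(2) c by (auto simp: dist_commute)
    qed
    then show ?thesis using R(1) by blast
  qed
  have "c' t0 $ 2 \<noteq> 0" by (rule axis_crossing_transversal[OF sym]) (use t0 assms(2) in auto)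
  moreover obtain R where R: "R > 0" "frontier \<Omega> \<inter> ball a R \<subseteq> frontier (D j)"
    using frontier_D_isolated[OF j] by metis
  ultimately show ?thesis
    using axis_chart_at_crossing[OF open_\<Omega> sub R(1), of t0] R(2) c t0 assms(2) that by metis
qed

end

section \<open>A Poincare inequality near the axis\<close>

lemma nn_integral_sheared_plane:
  fixes f :: "real^2 \<Rightarrow> ennreal"
  assumes [measurable]: "f \<in> borel_measurable borel" "G \<in> borel_measurable borel"
  shows "(\<integral>\<^sup>+z. f z \<partial>lborel) = (\<integral>\<^sup>+y. \<integral>\<^sup>+s. f (pt (G y + s) y) \<partial>lborel \<partial>lborel)"
proof -
  have "(\<integral>\<^sup>+x. f (pt x y) \<partial>lborel) = (\<integral>\<^sup>+s. f (pt (G y + s) y) \<partial>lborel)" for y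
    using nn_integral_real_affine[of "\<lambda>x. f (pt x y)" 1 "G y"] by simp
  then show ?thesis by (simp add: nn_integral_plane)
qed

abbreviation strip :: "real \<Rightarrow> (real^2) set" where "strip \<epsilon> \<equiv> {z. \<bar>z $ 2\<bar> < \<epsilon>}"

lemma open_strip: "open (strip \<epsilon>)"
  by (intro open_Collect_less continuous_intros)

lemma smooth_borel_measurable: "smooth (f :: 'a::euclidean_space \<Rightarrow> real) \<Longrightarrow> f \<in> borel_measurable borel"
  by (intro borel_measurable_continuous_onI smooth_continuous)

definition grad_sq :: "(real^2 \<Rightarrow> real) \<Rightarrow> real^2 \<Rightarrow> real" where
  "grad_sq W z = (partial_deriv 1 W z)\<^sup>2 + (partial_deriv 2 W z)\<^sup>2"

lemma grad_sq_measurable: "smooth W \<Longrightarrow> grad_sq W \<in> borel_measurable borel"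
  unfolding grad_sq_def[abs_def]
  by (intro borel_measurable_add borel_measurable_power smooth_borel_measurable smooth_partial_deriv)

text \<open>
  Integrate the derivative of \<open>W\<close> along a chart curve, starting from the axis, where \<open>W\<close> is 0.
  The factor \<open>1 + L\<^sup>2\<close> bounds the square of the length of the tangent vector \<open>(g', 1)\<close>.
\<close>

lemma square_along_chart_curve:
  assumes ch: "axis_chart \<Omega> a \<rho> r g g'"
    and W: "smooth W" "\<And>x. W (pt x 0) = 0"
    and L: "\<And>y. \<bar>y\<bar> < \<rho> \<Longrightarrow> \<bar>g' y\<bar> \<le> L"
    and \<epsilon>: "\<epsilon> \<le> \<rho>" and y: "\<bar>y\<bar> < \<epsilon>"
  shows "ennreal ((W (pt (g y + s) y))\<^sup>2)
    \<le> ennreal (\<epsilon> * (1 + L\<^sup>2)) * (\<integral>\<^sup>+\<tau>. ennreal (grad_sq W (pt (g \<tau> + s) \<tau>)) * indicator {-\<epsilon><..<\<epsilon>} \<tau> \<partial>lborel)"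
proof -
  define h where "h t = W (pt (g t + s) t)" for t
  define h' where "h' t = partial_deriv 1 W (pt (g t + s) t) * g' t + partial_deriv 2 W (pt (g t + s) t)" for t
  have dg: "(g has_real_derivative g' t) (at t)" if "\<bar>t\<bar> < \<rho>" for t
    using ch that by (simp add: axis_chart_def)
  have dh: "(h has_real_derivative h' t) (at t within S)" if "\<bar>t\<bar> < \<rho>" for t S
  proof -
    have "((\<lambda>t. g t + s) has_real_derivative g' t) (at t within S)"
      using DERIV_subset[OF dg[OF that], of S] by (auto intro!: derivative_eq_intros)
    from smooth_has_real_derivative_curve[OF W(1) this DERIV_ident] show ?thesis
      by (simp add: h_def[abs_def] h'_def)
  qed
  have contg: "continuous_on {-\<rho><..<\<rho>} g"
    by (intro continuous_at_imp_continuous_on ballI DERIV_isCont[OF dg]) auto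
  have conth': "continuous_on {-\<rho><..<\<rho>} h'"
    unfolding h'_def
    by (intro continuous_intros contg continuous_on_compose2[OF smooth_continuous[OF smooth_partial_deriv[OF W(1)], of UNIV]])
      (use ch in \<open>auto simp: axis_chart_def\<close>)
  have h0: "h 0 = 0" by (simp add: h_def W(2))
  define a b where "a = min 0 y" and "b = max 0 y"
  have ab: "a \<le> b" "b - a \<le> \<epsilon>" "{a..b} \<subseteq> {-\<epsilon><..<\<epsilon>}" "{a..b} \<subseteq> {-\<rho><..<\<rho>}"
    using y \<epsilon> by (auto simp: a_def b_def)
  have ab\<rho>: "\<bar>t\<bar> < \<rho>" if "t \<in> {a..b}" for t using subsetD[OF ab(4) that] by auto
  have "ennreal ((h b - h a)\<^sup>2) \<le> ennreal (b - a) * (\<integral>\<^sup>+t. ennreal ((h' t)\<^sup>2) * indicator {a..b} t \<partial>lborel)"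
    by (rule square_diff_le_nn_integral_deriv[OF ab(1) dh[OF ab\<rho>] continuous_on_subset[OF conth' ab(4)]])
  also have "(h b - h a)\<^sup>2 = (h y)\<^sup>2" by (auto simp: a_def b_def min_def max_def h0)
  also have "ennreal (b - a) * (\<integral>\<^sup>+t. ennreal ((h' t)\<^sup>2) * indicator {a..b} t \<partial>lborel)
    \<le> ennreal \<epsilon> * (\<integral>\<^sup>+t. ennreal (1 + L\<^sup>2) * (ennreal (grad_sq W (pt (g t + s) t)) * indicator {-\<epsilon><..<\<epsilon>} t) \<partial>lborel)"
  proof (rule mult_mono[OF ennreal_leI[OF ab(2)] nn_integral_mono])
    fix t
    show "ennreal ((h' t)\<^sup>2) * indicator {a..b} t
      \<le> ennreal (1 + L\<^sup>2) * (ennreal (grad_sq W (pt (g t + s) t)) * indicator {-\<epsilon><..<\<epsilon>} t)"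
    proof (cases "t \<in> {a..b}")
      case True
      define p q where "p = partial_deriv 1 W (pt (g t + s) t)" and "q = partial_deriv 2 W (pt (g t + s) t)"
      have "\<bar>g' t\<bar> \<le> L" by (rule L[OF ab\<rho>[OF True]])
      then have "(g' t)\<^sup>2 \<le> L\<^sup>2" using abs_le_square_iff[of "g' t" L] by auto
      have "(p * g' t + q)\<^sup>2 \<le> (1 + (g' t)\<^sup>2) * (p\<^sup>2 + q\<^sup>2)"
      proof -
        have "0 \<le> (p - q * g' t)\<^sup>2" by simp
        then show ?thesis by (simp add: power2_eq_square algebra_simps)
      qed
      also have "\<dots> \<le> (1 + L\<^sup>2) * (p\<^sup>2 + q\<^sup>2)"
        using \<open>(g' t)\<^sup>2 \<le> L\<^sup>2\<close> by (intro mult_right_mono) auto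
      finally have "(h' t)\<^sup>2 \<le> (1 + L\<^sup>2) * grad_sq W (pt (g t + s) t)"
        by (simp add: h'_def grad_sq_def p_def q_def)
      moreover have "ennreal ((1 + L\<^sup>2) * grad_sq W (pt (g t + s) t)) = ennreal (1 + L\<^sup>2) * ennreal (grad_sq W (pt (g t + s) t))"
        by (rule ennreal_mult') simp
      ultimately have "ennreal ((h' t)\<^sup>2) \<le> ennreal (1 + L\<^sup>2) * ennreal (grad_sq W (pt (g t + s) t))"
        by (metis ennreal_leI)
      then show ?thesis using True ab(3) by (auto simp: indicator_def)
    qed simp
  qed auto
  also have "\<dots> = ennreal \<epsilon> * (ennreal (1 + L\<^sup>2) *
      (\<integral>\<^sup>+t. ennreal (grad_sq W (pt (g t + s) t)) * indicator {-\<epsilon><..<\<epsilon>} t \<partial>lborel))"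
  proof -
    have "(\<lambda>t. indicator {-\<epsilon><..<\<epsilon>} t *\<^sub>R grad_sq W (pt (g t + s) t)) \<in> borel_measurable borel"
      unfolding grad_sq_def
      by (intro borel_measurable_continuous_on_indicator continuous_intros continuous_on_subset[OF contg]
          continuous_on_compose2[OF smooth_continuous[OF smooth_partial_deriv[OF W(1)], of UNIV]])
        (use \<epsilon> in auto)
    then have "(\<lambda>t. ennreal (indicator {-\<epsilon><..<\<epsilon>} t *\<^sub>R grad_sq W (pt (g t + s) t))) \<in> borel_measurable borel"
      by measurable
    also have "(\<lambda>t. ennreal (indicator {-\<epsilon><..<\<epsilon>} t *\<^sub>R grad_sq W (pt (g t + s) t)))
      = (\<lambda>t. ennreal (grad_sq W (pt (g t + s) t)) * indicator {-\<epsilon><..<\<epsilon>} t)"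
      by (auto simp: indicator_def)
    finally show ?thesis by (subst nn_integral_cmult) auto
  qed
  also have "\<dots> = ennreal (\<epsilon> * (1 + L\<^sup>2)) * (\<integral>\<^sup>+t. ennreal (grad_sq W (pt (g t + s) t)) * indicator {-\<epsilon><..<\<epsilon>} t \<partial>lborel)"
    using y by (simp add: ennreal_mult' mult.assoc del: ennreal_plus)
  finally show ?thesis by (simp add: h_def)
qed

lemma axis_chart_neighbourhood:
  assumes ch: "axis_chart \<Omega> a \<rho> r g g'" and a: "a $ 2 = 0"
  defines "Q \<equiv> {z. \<bar>z $ 2\<bar> < \<rho> \<and> \<bar>z $ 1 - g (z $ 2)\<bar> < r}"
  shows "open Q" "a \<in> Q"
proof -
  have dg: "(g has_real_derivative g' t) (at t)" if "\<bar>t\<bar> < \<rho>" for t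
    using ch that by (simp add: axis_chart_def)
  have contg: "continuous_on {-\<rho><..<\<rho>} g"
    by (intro continuous_at_imp_continuous_on ballI DERIV_isCont[OF dg]) auto
  have "open (strip \<rho> \<inter> (\<lambda>z. z $ 1 - g (z $ 2)) -` {-r<..<r})"
    by (rule continuous_open_preimage[OF _ open_strip])
      (auto intro!: continuous_intros continuous_on_compose2[OF contg])
  also have "strip \<rho> \<inter> (\<lambda>z. z $ 1 - g (z $ 2)) -` {-r<..<r} = Q"
    by (auto simp: Q_def)
  finally show "open Q" .
  show "a \<in> Q" using ch a by (auto simp: Q_def axis_chart_def)
qed

text \<open>
  A Poincare inequality with the constant \<open>K \<epsilon>\<^sup>2\<close>, where \<open>\<epsilon>\<close> is the half width of the strip, for
  the part of \<open>\<Omega>\<close> in \<open>Q\<close>.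
\<close>

definition axis_poincare :: "(real^2) set \<Rightarrow> (real^2) set \<Rightarrow> real \<Rightarrow> real \<Rightarrow> bool" where
  "axis_poincare \<Omega> Q K \<rho> \<longleftrightarrow> 0 \<le> K \<and> 0 < \<rho> \<and>
     (\<forall>\<epsilon> W. 0 < \<epsilon> \<longrightarrow> \<epsilon> \<le> \<rho> \<longrightarrow> smooth W \<longrightarrow> (\<forall>x. W (pt x 0) = 0) \<longrightarrow>
      (\<integral>\<^sup>+z. ennreal ((W z)\<^sup>2) * indicator (Q \<inter> \<Omega> \<inter> strip \<epsilon>) z \<partial>lborel)
      \<le> ennreal (K * \<epsilon>\<^sup>2) * (\<integral>\<^sup>+z. ennreal (grad_sq W z) * indicator \<Omega> z \<partial>lborel))"

text \<open>
  The shear \<open>(s, y) \<mapsto> (g y + s, y)\<close> preserves area, so the estimate along the chart curves may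
  be integrated over \<open>s\<close> and \<open>y\<close>. In these coordinates, the part of \<open>\<Omega>\<close> in the chart is a
  product set.
\<close>

lemma poincare_in_axis_chart:
  assumes ch: "axis_chart \<Omega> a \<rho> r g g'" and a: "a $ 2 = 0" and "open \<Omega>"
  obtains Q K where "open Q" "a \<in> Q" "axis_poincare \<Omega> Q K \<rho>"
proof -
  define Q where "Q = {z :: real^2. \<bar>z $ 2\<bar> < \<rho> \<and> \<bar>z $ 1 - g (z $ 2)\<bar> < r}"
  have Q: "open Q" "a \<in> Q" unfolding Q_def using axis_chart_neighbourhood[OF ch a] by auto
  obtain L where L: "\<And>y. \<bar>y\<bar> < \<rho> \<Longrightarrow> \<bar>g' y\<bar> \<le> L"
  proof -
    obtain L where "\<forall>x\<in>g' ` {-\<rho><..<\<rho>}. norm x \<le> L"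
      using ch unfolding axis_chart_def bounded_iff by blast
    then have "\<bar>g' y\<bar> \<le> L" if "\<bar>y\<bar> < \<rho>" for y
      using that by (auto simp: abs_less_iff)
    then show ?thesis by (rule that)
  qed
  have dg: "(g has_real_derivative g' t) (at t)" if "\<bar>t\<bar> < \<rho>" for t
    using ch that by (simp add: axis_chart_def)
  have contg: "continuous_on {-\<rho><..<\<rho>} g"
    by (intro continuous_at_imp_continuous_on ballI DERIV_isCont[OF dg]) auto
  \<comment> \<open>The chart function, made measurable on the whole line.\<close>
  define G where "G t = indicator {-\<rho><..<\<rho>} t *\<^sub>R g t" for t
  have Gm[measurable]: "G \<in> borel_measurable borel"
    unfolding G_def[abs_def] by (intro borel_measurable_continuous_on_indicator contg) simp
  have Gg: "G t = g t" if "\<bar>t\<bar> < \<rho>" for t using that by (auto simp: G_def indicator_def)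
  \<comment> \<open>the translates that run inside \<open>\<Omega>\<close>\<close>
  define X where "X = {s. \<bar>s\<bar> < r \<and> pt (g 0 + s) 0 \<in> \<Omega>}"
  have "open X"
  proof -
    have "open ({-r<..<r} \<inter> (\<lambda>s. pt (g 0 + s) 0) -` \<Omega>)"
      by (intro open_Int open_vimage \<open>open \<Omega>\<close> continuous_intros open_greaterThanLessThan)
    also have "{-r<..<r} \<inter> (\<lambda>s. pt (g 0 + s) 0) -` \<Omega> = X" by (auto simp: X_def)
    finally show ?thesis .
  qed
  then have Xm[measurable]: "X \<in> sets borel" by simp
  have X: "s \<in> X \<longleftrightarrow> \<bar>s\<bar> < r \<and> pt (g y + s) y \<in> \<Omega>" if "\<bar>y\<bar> < \<rho>" for s y
    using ch that by (auto simp: axis_chart_def X_def)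
  have Om[measurable]: "\<Omega> \<in> sets borel" using \<open>open \<Omega>\<close> by simp
  have Sm: "Q \<inter> \<Omega> \<inter> strip \<epsilon> \<in> sets borel" for \<epsilon>
    using Q(1) \<open>open \<Omega>\<close> open_strip by (intro borel_open) blast
  have main: "(\<integral>\<^sup>+z. ennreal ((W z)\<^sup>2) * indicator (Q \<inter> \<Omega> \<inter> strip \<epsilon>) z \<partial>lborel)
      \<le> ennreal (2 * (1 + L\<^sup>2) * \<epsilon>\<^sup>2) * (\<integral>\<^sup>+z. ennreal (grad_sq W z) * indicator \<Omega> z \<partial>lborel)"
    if \<epsilon>: "0 < \<epsilon>" "\<epsilon> \<le> \<rho>" and W: "smooth W" "\<And>x. W (pt x 0) = 0" for \<epsilon> W
  proof -
    have [measurable]: "W \<in> borel_measurable borel" "grad_sq W \<in> borel_measurable borel"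
      by (rule smooth_borel_measurable[OF W(1)], rule grad_sq_measurable[OF W(1)])
    define I where "I s = (\<integral>\<^sup>+\<tau>. ennreal (grad_sq W (pt (G \<tau> + s) \<tau>)) * indicator {-\<epsilon><..<\<epsilon>} \<tau> \<partial>lborel)" for s
    have Ig: "I s = (\<integral>\<^sup>+\<tau>. ennreal (grad_sq W (pt (g \<tau> + s) \<tau>)) * indicator {-\<epsilon><..<\<epsilon>} \<tau> \<partial>lborel)" for s
      unfolding I_def using Gg \<epsilon> by (intro nn_integral_cong) (auto simp: indicator_def)
    have Im[measurable]: "I \<in> borel_measurable borel"
      unfolding I_def[abs_def] by measurable
    have ind: "indicator (Q \<inter> \<Omega> \<inter> strip \<epsilon>) (pt (G y + s) y) = (indicator {-\<epsilon><..<\<epsilon>} y * indicator X s :: ennreal)" for y s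
      using X[of y s] Gg[of y] \<epsilon> by (auto simp: indicator_def Q_def)
    have "(\<integral>\<^sup>+z. ennreal ((W z)\<^sup>2) * indicator (Q \<inter> \<Omega> \<inter> strip \<epsilon>) z \<partial>lborel)
        = (\<integral>\<^sup>+y. \<integral>\<^sup>+s. ennreal ((W (pt (G y + s) y))\<^sup>2) * (indicator {-\<epsilon><..<\<epsilon>} y * indicator X s) \<partial>lborel \<partial>lborel)"
      using Sm by (subst nn_integral_sheared_plane[OF _ Gm]) (auto simp: ind intro!: borel_measurable_times_ennreal borel_measurable_indicator)
    also have "\<dots> \<le> (\<integral>\<^sup>+y. \<integral>\<^sup>+s. (ennreal (\<epsilon> * (1 + L\<^sup>2)) * indicator {-\<epsilon><..<\<epsilon>} y) * (I s * indicator X s) \<partial>lborel \<partial>lborel)"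
    proof (intro nn_integral_mono)
      fix y s :: real
      show "ennreal ((W (pt (G y + s) y))\<^sup>2) * (indicator {-\<epsilon><..<\<epsilon>} y * indicator X s)
        \<le> (ennreal (\<epsilon> * (1 + L\<^sup>2)) * indicator {-\<epsilon><..<\<epsilon>} y) * (I s * indicator X s)"
      proof (cases "y \<in> {-\<epsilon><..<\<epsilon>}")
        case True
        then have "\<bar>y\<bar> < \<epsilon>" by auto
        from square_along_chart_curve[OF ch W L \<epsilon>(2) this, of s] Gg[of y] \<epsilon> True
        show ?thesis by (auto simp: indicator_def Ig)
      qed simp
    qed
    also have "\<dots> = (\<integral>\<^sup>+y. ennreal (\<epsilon> * (1 + L\<^sup>2)) * indicator {-\<epsilon><..<\<epsilon>} y * (\<integral>\<^sup>+s. I s * indicator X s \<partial>lborel) \<partial>lborel)"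
      by (simp add: nn_integral_cmult)
    also have "\<dots> = (\<integral>\<^sup>+y. ennreal (\<epsilon> * (1 + L\<^sup>2)) * indicator {-\<epsilon><..<\<epsilon>} y \<partial>lborel) * (\<integral>\<^sup>+s. I s * indicator X s \<partial>lborel)"
      by (simp add: nn_integral_multc)
    also have "(\<integral>\<^sup>+y. ennreal (\<epsilon> * (1 + L\<^sup>2)) * indicator {-\<epsilon><..<\<epsilon>} y \<partial>lborel) = ennreal (2 * (1 + L\<^sup>2) * \<epsilon>\<^sup>2)"
    proof -
      have "(\<integral>\<^sup>+y. ennreal (\<epsilon> * (1 + L\<^sup>2)) * indicator {-\<epsilon><..<\<epsilon>} y \<partial>lborel)
          = ennreal (\<epsilon> * (1 + L\<^sup>2)) * ennreal (2 * \<epsilon>)"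
        using \<epsilon> by (subst nn_integral_cmult_indicator) auto
      also have "\<dots> = ennreal (\<epsilon> * (1 + L\<^sup>2) * (2 * \<epsilon>))"
        using \<epsilon> by (intro ennreal_mult'[symmetric]) simp
      also have "\<epsilon> * (1 + L\<^sup>2) * (2 * \<epsilon>) = 2 * (1 + L\<^sup>2) * \<epsilon>\<^sup>2"
        by (simp add: power2_eq_square algebra_simps)
      finally show ?thesis .
    qed
    also have "(\<integral>\<^sup>+s. I s * indicator X s \<partial>lborel)
      = (\<integral>\<^sup>+s. \<integral>\<^sup>+\<tau>. ennreal (grad_sq W (pt (G \<tau> + s) \<tau>)) * indicator {-\<epsilon><..<\<epsilon>} \<tau> * indicator X s \<partial>lborel \<partial>lborel)"
      unfolding I_def by (simp add: nn_integral_multc)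
    also have "\<dots> = (\<integral>\<^sup>+\<tau>. \<integral>\<^sup>+s. ennreal (grad_sq W (pt (G \<tau> + s) \<tau>)) * indicator {-\<epsilon><..<\<epsilon>} \<tau> * indicator X s \<partial>lborel \<partial>lborel)"
      by (rule lborel_pair.Fubini') measurable
    also have "\<dots> = (\<integral>\<^sup>+\<tau>. \<integral>\<^sup>+s. ennreal (grad_sq W (pt (G \<tau> + s) \<tau>)) * indicator (Q \<inter> \<Omega> \<inter> strip \<epsilon>) (pt (G \<tau> + s) \<tau>) \<partial>lborel \<partial>lborel)"
      by (simp add: ind mult.assoc)
    also have "\<dots> = (\<integral>\<^sup>+z. ennreal (grad_sq W z) * indicator (Q \<inter> \<Omega> \<inter> strip \<epsilon>) z \<partial>lborel)"
      using Sm by (subst nn_integral_sheared_plane[OF _ Gm]) (auto intro!: borel_measurable_times_ennreal borel_measurable_indicator)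
    also have "\<dots> \<le> (\<integral>\<^sup>+z. ennreal (grad_sq W z) * indicator \<Omega> z \<partial>lborel)"
      by (intro nn_integral_mono mult_left_mono) (auto simp: indicator_def)
    finally show ?thesis by (simp add: mult_left_mono)
  qed
  have "axis_poincare \<Omega> Q (2 * (1 + L\<^sup>2)) \<rho>"
    unfolding axis_poincare_def
    by (intro conjI allI impI main) (use ch in \<open>auto simp: axis_chart_def\<close>)
  then show ?thesis by (rule that[OF Q])
qed

text \<open>
  The axis meets the closure of \<open>\<Omega>\<close> in a compact set, which finitely many charts cover; these
  charts also cover the part of \<open>\<Omega>\<close> in every sufficiently thin strip.
\<close>

lemma (in admissible_domain) poincare_near_axis: "\<exists>C \<epsilon>0. axis_poincare \<Omega> UNIV C \<epsilon>0"
proof -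
  define A where "A = closure \<Omega> \<inter> {z. z $ 2 = 0}"
  have "compact A"
    unfolding A_def using bounded_\<Omega>
    by (intro compact_Int_closed closed_Collect_eq continuous_intros) (auto simp: compact_closure)
  have "\<exists>Q K \<rho>. open Q \<and> a \<in> Q \<and> axis_poincare \<Omega> Q K \<rho>" if "a \<in> A" for a
  proof -
    have a: "a \<in> closure \<Omega>" "a $ 2 = 0" using that by (auto simp: A_def)
    obtain \<rho> r g g' where ch: "axis_chart \<Omega> a \<rho> r g g'" using axis_chart_exists[OF a] by metis
    show ?thesis using poincare_in_axis_chart[OF ch a(2) open_\<Omega>] by metis
  qed
  then obtain Q K \<rho> where QK: "\<And>a. a \<in> A \<Longrightarrow> open (Q a) \<and> a \<in> Q a \<and> axis_poincare \<Omega> (Q a) (K a) (\<rho> a)"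
    by metis
  obtain F where F: "F \<subseteq> A" "finite F" "A \<subseteq> (\<Union>a\<in>F. Q a)"
    by (rule compactE_image[OF \<open>compact A\<close>, of A Q]) (use QK in auto)
  have oQ: "open (Q a)" and g: "axis_poincare \<Omega> (Q a) (K a) (\<rho> a)" if "a \<in> F" for a
    using QK F(1) that by blast+
  define V where "V = (\<Union>a\<in>F. Q a)"
  have "open V" using oQ by (auto simp: V_def)
  have "compact (closure \<Omega> - V)" using bounded_\<Omega> \<open>open V\<close> by (intro compact_diff) (auto simp: compact_closure)
  have "\<exists>e>0. \<forall>z\<in>closure \<Omega> - V. e \<le> \<bar>z $ 2\<bar>"
  proof (cases "closure \<Omega> - V = {}")
    case True
    then show ?thesis by (metis empty_iff zero_less_one)
  next
    case False
    obtain z where z: "z \<in> closure \<Omega> - V" "\<And>w. w \<in> closure \<Omega> - V \<Longrightarrow> \<bar>z $ 2\<bar> \<le> \<bar>w $ 2\<bar>"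
    proof -
      have "continuous_on (closure \<Omega> - V) (\<lambda>z. \<bar>z $ 2\<bar>)" by (intro continuous_intros)
      from continuous_attains_inf[OF \<open>compact (closure \<Omega> - V)\<close> False this] show ?thesis using that by blast
    qed
    then have "z $ 2 \<noteq> 0" using F(3) by (auto simp: A_def V_def)
    then show ?thesis using z(2) by (intro exI[of _ "\<bar>z $ 2\<bar>"]) auto
  qed
  then obtain e where e: "e > 0" "\<And>z. z \<in> closure \<Omega> \<Longrightarrow> z \<notin> V \<Longrightarrow> e \<le> \<bar>z $ 2\<bar>" by blast
  define \<epsilon>0 where "\<epsilon>0 = Min (insert e (\<rho> ` F))"
  have \<epsilon>0: "0 < \<epsilon>0" "\<epsilon>0 \<le> e" "\<And>a. a \<in> F \<Longrightarrow> \<epsilon>0 \<le> \<rho> a"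
    using F(2) e(1) g by (auto simp: \<epsilon>0_def axis_poincare_def)
  define C where "C = (\<Sum>a\<in>F. K a)"
  have C: "0 \<le> C" using g by (auto simp: C_def axis_poincare_def intro!: sum_nonneg)
  have main: "(\<integral>\<^sup>+z. ennreal ((W z)\<^sup>2) * indicator (UNIV \<inter> \<Omega> \<inter> strip \<epsilon>) z \<partial>lborel)
      \<le> ennreal (C * \<epsilon>\<^sup>2) * (\<integral>\<^sup>+z. ennreal (grad_sq W z) * indicator \<Omega> z \<partial>lborel)"
    if \<epsilon>: "0 < \<epsilon>" "\<epsilon> \<le> \<epsilon>0" and W: "smooth W" "\<And>x. W (pt x 0) = 0" for \<epsilon> W
  proof -
    have [measurable]: "W \<in> borel_measurable borel" by (rule smooth_borel_measurable[OF W(1)])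
    have Sm[measurable]: "Q a \<inter> \<Omega> \<inter> strip \<epsilon> \<in> sets borel" if "a \<in> F" for a
      using oQ[OF that] open_\<Omega> open_strip by (intro borel_open) blast
    have "(\<integral>\<^sup>+z. ennreal ((W z)\<^sup>2) * indicator (UNIV \<inter> \<Omega> \<inter> strip \<epsilon>) z \<partial>lborel)
        \<le> (\<integral>\<^sup>+z. (\<Sum>a\<in>F. ennreal ((W z)\<^sup>2) * indicator (Q a \<inter> \<Omega> \<inter> strip \<epsilon>) z) \<partial>lborel)"
    proof (intro nn_integral_mono)
      fix z
      show "ennreal ((W z)\<^sup>2) * indicator (UNIV \<inter> \<Omega> \<inter> strip \<epsilon>) z
        \<le> (\<Sum>a\<in>F. ennreal ((W z)\<^sup>2) * indicator (Q a \<inter> \<Omega> \<inter> strip \<epsilon>) z)"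
      proof (cases "z \<in> \<Omega> \<inter> strip \<epsilon>")
        case True
        then have "z \<in> closure \<Omega>" "\<bar>z $ 2\<bar> < e" using closure_subset[of \<Omega>] \<epsilon>(2) \<epsilon>0(2) by auto
        then have "z \<in> V" using e(2)[of z] by linarith
        then obtain b where b: "b \<in> F" "z \<in> Q b" by (auto simp: V_def)
        have "ennreal ((W z)\<^sup>2) * indicator (UNIV \<inter> \<Omega> \<inter> strip \<epsilon>) z = ennreal ((W z)\<^sup>2) * indicator (Q b \<inter> \<Omega> \<inter> strip \<epsilon>) z"
          using True b by (simp add: indicator_def)
        also have "\<dots> \<le> (\<Sum>a\<in>F. ennreal ((W z)\<^sup>2) * indicator (Q a \<inter> \<Omega> \<inter> strip \<epsilon>) z)"
          by (rule member_le_sum[OF b(1)]) (use F(2) in auto)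
        finally show ?thesis .
      qed simp
    qed
    also have "\<dots> = (\<Sum>a\<in>F. \<integral>\<^sup>+z. ennreal ((W z)\<^sup>2) * indicator (Q a \<inter> \<Omega> \<inter> strip \<epsilon>) z \<partial>lborel)"
      by (rule nn_integral_sum) (auto intro!: borel_measurable_times_ennreal borel_measurable_indicator Sm)
    also have "\<dots> \<le> (\<Sum>a\<in>F. ennreal (K a * \<epsilon>\<^sup>2) * (\<integral>\<^sup>+z. ennreal (grad_sq W z) * indicator \<Omega> z \<partial>lborel))"
    proof (rule sum_mono)
      fix a assume a: "a \<in> F"
      then have "\<epsilon> \<le> \<rho> a" using \<epsilon>0(3)[of a] \<epsilon>(2) by simp
      then show "(\<integral>\<^sup>+z. ennreal ((W z)\<^sup>2) * indicator (Q a \<inter> \<Omega> \<inter> strip \<epsilon>) z \<partial>lborel)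
          \<le> ennreal (K a * \<epsilon>\<^sup>2) * (\<integral>\<^sup>+z. ennreal (grad_sq W z) * indicator \<Omega> z \<partial>lborel)"
        using g[OF a] \<epsilon>(1) W unfolding axis_poincare_def by blast
    qed
    also have "\<dots> = ennreal (C * \<epsilon>\<^sup>2) * (\<integral>\<^sup>+z. ennreal (grad_sq W z) * indicator \<Omega> z \<partial>lborel)"
    proof -
      have "(\<Sum>a\<in>F. ennreal (K a * \<epsilon>\<^sup>2)) = ennreal (C * \<epsilon>\<^sup>2)"
        using g by (subst sum_ennreal) (auto simp: C_def axis_poincare_def sum_distrib_right)
      then show ?thesis by (simp add: sum_distrib_right[symmetric])
    qed
    finally show ?thesis .
  qed
  have "axis_poincare \<Omega> UNIV C \<epsilon>0"
    unfolding axis_poincare_def by (intro conjI allI impI C \<epsilon>0(1) main) auto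
  then show ?thesis by blast
qed

section \<open>Odd Sobolev functions near the axis\<close>

lemma nn_integral_lebesgue_on:
  "\<Omega> \<in> sets borel \<Longrightarrow> (\<integral>\<^sup>+x. f x \<partial>lebesgue_on \<Omega>) = (\<integral>\<^sup>+x. f x * indicator \<Omega> x \<partial>lborel)"
  by (subst nn_integral_restrict_space) (auto simp: nn_integral_completion)

lemma nn_integral_reflect_lebesgue:
  fixes f :: "real^2 \<Rightarrow> ennreal"
  assumes "f \<in> borel_measurable lebesgue"
  shows "(\<integral>\<^sup>+x. f (reflect x) \<partial>lborel) = (\<integral>\<^sup>+x. f x \<partial>lborel)"
proof -
  obtain h where h: "h \<in> borel_measurable lborel" and eq: "AE x in lborel. f x = h x"
    using completion_ex_borel_measurable[OF assms] by blast
  have h': "h \<in> borel_measurable borel" using h by simp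
  have "AE x in distr lborel borel reflect. f x = h x"
    using eq by (simp only: distr_lborel_reflect)
  then have "AE x in lborel. f (reflect x) = h (reflect x)"
    by (rule AE_distrD[rotated]) simp
  then have "(\<integral>\<^sup>+x. f (reflect x) \<partial>lborel) = (\<integral>\<^sup>+x. h (reflect x) \<partial>lborel)"
    by (rule nn_integral_cong_AE)
  also have "\<dots> = (\<integral>\<^sup>+x. h x \<partial>lborel)" by (rule nn_integral_reflect[OF h'])
  also have "\<dots> = (\<integral>\<^sup>+x. f x \<partial>lborel)" using eq by (intro nn_integral_cong_AE) auto
  finally show ?thesis .
qed

lemma linear_reflect: "bounded_linear reflect"
proof -
  have eq: "reflect = (\<lambda>x. (x $ 1) *\<^sub>R axis 1 1 + (- x $ 2) *\<^sub>R axis 2 1)"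
    by (auto simp: fun_eq_iff reflect_eq_pt pt_def)
  show ?thesis
    unfolding eq by (intro bounded_linear_add bounded_linear_scaleR_const bounded_linear_minus bounded_linear_vec_nth)
qed

lemma reflect_axis: "reflect (axis 1 1) = axis 1 1" "reflect (axis 2 1) = - axis 2 1"
  by (simp_all add: vec2_eq_iff axis_def)

definition odd_part :: "(real^2 \<Rightarrow> real) \<Rightarrow> real^2 \<Rightarrow> real" where
  "odd_part w x = (w x - w (reflect x)) / 2"

lemma combination_has_derivative:
  fixes f g :: "real^2 \<Rightarrow> real"
  assumes "smooth f" "smooth g"
  shows "((\<lambda>x. a * f x + b * g (reflect x)) has_derivative
    (\<lambda>h. a * frechet_derivative f (at x) h + b * frechet_derivative g (at (reflect x)) (reflect h))) (at x)"
  by (rule has_derivative_add[OF has_derivative_mult_right[OF smooth_has_derivative[OF assms(1)]]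
      has_derivative_mult_right[OF has_derivative_compose[OF bounded_linear_imp_has_derivative[OF linear_reflect]
          smooth_has_derivative[OF assms(2)]]]])

lemma smooth_reflect_combination:
  fixes f g :: "real^2 \<Rightarrow> real"
  assumes "smooth f" "smooth g"
  shows "smooth (\<lambda>x. a * f x + b * g (reflect x))"
proof (rule smooth_coinduct)
  show "(\<lambda>x. a * f x + b * g (reflect x)) \<in> {\<lambda>x. a * f x + b * g (reflect x) | f g. smooth f \<and> smooth g}"
    using assms by blast
next
  fix F h assume "F \<in> {\<lambda>x. a * f x + b * g (reflect x) | f g. smooth (f :: real^2 \<Rightarrow> real) \<and> smooth g}"
  then obtain f g where F: "F = (\<lambda>x. a * f x + b * g (reflect x))" and fg: "smooth f" "smooth g" by blast
  note d = combination_has_derivative[OF fg, of a b, folded F]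
  show "F differentiable_on UNIV"
    using d by (auto simp: differentiable_on_def differentiable_def)
  show "(\<lambda>x. frechet_derivative F (at x) h) \<in> {\<lambda>x. a * f x + b * g (reflect x) | f g. smooth f \<and> smooth g}"
    unfolding frechet_derivative_at[OF d, symmetric] mem_Collect_eq
    by (intro exI[of _ "\<lambda>x. frechet_derivative f (at x) h"] exI[of _ "\<lambda>x. frechet_derivative g (at x) (reflect h)"])
      (simp add: smooth_directional_derivative fg)
qed

lemma odd_part_eq: "odd_part w = (\<lambda>x. (1/2) * w x + (-1/2) * w (reflect x))"
  by (auto simp: odd_part_def fun_eq_iff)

lemma smooth_odd_part: "smooth w \<Longrightarrow> smooth (odd_part w)"
  unfolding odd_part_eq by (rule smooth_reflect_combination)

lemma partial_deriv_odd_part: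
  assumes "smooth w"
  shows "partial_deriv 1 (odd_part w) x = (partial_deriv 1 w x - partial_deriv 1 w (reflect x)) / 2"
    "partial_deriv 2 (odd_part w) x = (partial_deriv 2 w x + partial_deriv 2 w (reflect x)) / 2"
proof -
  note d = combination_has_derivative[OF assms assms, of "1/2" "-1/2" x, folded odd_part_eq]
  have "linear (frechet_derivative w (at (reflect x)))"
    using smooth_has_derivative[OF assms] has_derivative_linear by blast
  then have neg: "frechet_derivative w (at (reflect x)) (- h) = - frechet_derivative w (at (reflect x)) h" for h
    by (rule linear_neg)
  show "partial_deriv 1 (odd_part w) x = (partial_deriv 1 w x - partial_deriv 1 w (reflect x)) / 2"
    "partial_deriv 2 (odd_part w) x = (partial_deriv 2 w x + partial_deriv 2 w (reflect x)) / 2"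
    unfolding partial_deriv_def frechet_derivative_at[OF d, symmetric] reflect_axis neg by simp_all
qed

lemma odd_part_axis: "odd_part w (pt x 0) = 0"
proof -
  have "reflect (pt x 0) = pt x 0" by (simp add: vec2_eq_iff)
  then show ?thesis by (simp add: odd_part_def)
qed

lemma half_sum_square_le: "((a + b) / 2)\<^sup>2 \<le> (a\<^sup>2 + b\<^sup>2) / (2::real)" "((a - b) / 2)\<^sup>2 \<le> (a\<^sup>2 + b\<^sup>2) / (2::real)"
  using zero_le_power2[of "a - b"] zero_le_power2[of "a + b"]
  by (simp_all add: power_divide power2_eq_square algebra_simps)

lemma ennreal_le_two_sum:
  assumes "c \<le> 2 * a + 2 * b" "0 \<le> a" "0 \<le> b"
  shows "ennreal c \<le> 2 * ennreal a + 2 * ennreal b"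
proof -
  have m: "ennreal (2 * t) = 2 * ennreal t" for t
    using ennreal_mult'[of 2 t] by simp
  have "ennreal c \<le> ennreal (2 * a + 2 * b)" by (rule ennreal_leI[OF assms(1)])
  also have "\<dots> = ennreal (2 * a) + ennreal (2 * b)" by (rule ennreal_plus) (use assms in auto)
  finally show ?thesis by (simp only: m)
qed

context admissible_domain
begin

lemma borel_\<Omega>: "\<Omega> \<in> sets borel" using open_\<Omega> by simp

lemma nn_integral_reflect_\<Omega>:
  assumes "f \<in> borel_measurable (lebesgue_on \<Omega>)"
  shows "(\<integral>\<^sup>+x. ennreal (f (reflect x)) * indicator \<Omega> x \<partial>lborel) = (\<integral>\<^sup>+x. ennreal (f x) * indicator \<Omega> x \<partial>lborel)"
proof -
  have "(\<lambda>x. ennreal (f x)) \<in> borel_measurable (lebesgue_on \<Omega>)" using assms by measurable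
  then have "(\<lambda>x. ennreal (f x) * indicator \<Omega> x) \<in> borel_measurable lebesgue"
    using borel_\<Omega> by (subst (asm) borel_measurable_restrict_space_iff_ennreal) (auto intro: sets_completionI_sets)
  from nn_integral_reflect_lebesgue[OF this] show ?thesis
    by (simp add: indicator_def reflect_mem_\<Omega>)
qed

text \<open>
  Averaging over the reflection does not increase integrals over the symmetric set \<open>\<Omega>\<close>. This
  controls the odd part of an approximating function by the function itself.
\<close>

lemma nn_integral_half_reflect_sum:
  assumes f: "f \<in> borel_measurable (lebesgue_on \<Omega>)" "\<And>x. 0 \<le> f x"
    and le: "AE x in lebesgue_on \<Omega>. F x \<le> (f x + f (reflect x)) / 2"
  shows "(\<integral>\<^sup>+x. ennreal (F x) \<partial>lebesgue_on \<Omega>) \<le> (\<integral>\<^sup>+x. ennreal (f x) \<partial>lebesgue_on \<Omega>)"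
proof -
  let ?I = "\<integral>\<^sup>+x. ennreal (f x) \<partial>lebesgue_on \<Omega>"
  have m: "(\<lambda>x. f (reflect x)) \<in> borel_measurable (lebesgue_on \<Omega>)"
  proof (rule measurable_compose[OF _ f(1)])
    have "reflect \<in> lebesgue \<rightarrow>\<^sub>M lebesgue"
    proof -
      have "reflect = (\<lambda>x. 0 + (\<Sum>j\<in>Basis. ((if j = axis 2 1 then -1 else 1) * (x \<bullet> j)) *\<^sub>R j))"
        by (auto simp: fun_eq_iff Basis_plane axis_eq_axis reflect_eq_pt pt_def cart_eq_inner_axis)
      then show ?thesis
        using lebesgue_affine_measurable[of "\<lambda>j. if j = axis 2 1 then -1 else 1" "0 :: real^2"] by simp
    qed
    then show "reflect \<in> lebesgue_on \<Omega> \<rightarrow>\<^sub>M lebesgue_on \<Omega>"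
      by (intro measurable_restrict_space3) (auto simp: reflect_mem_\<Omega>)
  qed
  have "(\<integral>\<^sup>+x. ennreal (F x) \<partial>lebesgue_on \<Omega>)
      \<le> (\<integral>\<^sup>+x. ennreal (1/2) * ennreal (f x) + ennreal (1/2) * ennreal (f (reflect x)) \<partial>lebesgue_on \<Omega>)"
  proof (rule nn_integral_mono_AE)
    show "AE x in lebesgue_on \<Omega>. ennreal (F x) \<le> ennreal (1/2) * ennreal (f x) + ennreal (1/2) * ennreal (f (reflect x))"
      using le
    proof eventually_elim
      case (elim x)
      then have "ennreal (F x) \<le> ennreal (1/2 * f x + 1/2 * f (reflect x))"
        by (intro ennreal_leI) simp
      also have "\<dots> = ennreal (1/2) * ennreal (f x) + ennreal (1/2) * ennreal (f (reflect x))"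
      proof -
        have m: "ennreal (1/2 * t) = ennreal (1/2) * ennreal t" for t
          by (rule ennreal_mult') simp
        show ?thesis
          unfolding m[symmetric] by (rule ennreal_plus) (use f(2) in auto)
      qed
      finally show ?case .
    qed
  qed
  also have "\<dots> = ennreal (1/2) * ?I + ennreal (1/2) * (\<integral>\<^sup>+x. ennreal (f (reflect x)) \<partial>lebesgue_on \<Omega>)"
    using f(1) m by (simp add: nn_integral_add nn_integral_cmult)
  also have "(\<integral>\<^sup>+x. ennreal (f (reflect x)) \<partial>lebesgue_on \<Omega>) = ?I"
    using nn_integral_reflect_\<Omega>[OF f(1)] by (simp add: nn_integral_lebesgue_on[OF borel_\<Omega>])
  also have "ennreal (1/2) * ?I + ennreal (1/2) * ?I = ?I"
  proof -
    have "ennreal (1/2) * ?I + ennreal (1/2) * ?I = (ennreal (1/2) + ennreal (1/2)) * ?I"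
      by (simp only: distrib_right)
    also have "ennreal (1/2) + ennreal (1/2) = 1" by (subst ennreal_plus[symmetric]) auto
    finally show ?thesis by simp
  qed
  finally show ?thesis .
qed

text \<open>
  The odd parts of smooth approximations of \<open>u\<close> are again smooth approximations, they vanish on
  the axis, and their gradients stay bounded in \<open>L\<^sup>2\<close>; so the Poincare inequality passes to the
  limit \<open>u\<close>.
\<close>

lemma odd_W12_strip_estimate:
  assumes tr: "has_trace 2 \<Omega> u g"
    and odd: "AE x in lebesgue_on \<Omega>. u (reflect x) = - u x"
  shows "\<exists>C \<epsilon>0. 0 \<le> C \<and> 0 < \<epsilon>0 \<and> (\<forall>\<epsilon>. 0 < \<epsilon> \<longrightarrow> \<epsilon> < \<epsilon>0 \<longrightarrow>
      (\<integral>\<^sup>+x. ennreal ((u x)\<^sup>2) * indicator (strip \<epsilon>) x \<partial>lebesgue_on \<Omega>) \<le> ennreal (C * \<epsilon>\<^sup>2))"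
proof -
  let ?M = "lebesgue_on \<Omega>"
  define U where "U i = weak_partial \<Omega> i u" for i
  obtain w where u: "u \<in> W1 2 \<Omega>" and w: "\<And>k. smooth (w k)"
    and w0: "(\<lambda>k. \<integral>\<^sup>+x. ennreal ((w k x - u x)\<^sup>2) \<partial>?M) \<longlonglongrightarrow> 0"
    and w1: "\<And>i. (\<lambda>k. \<integral>\<^sup>+x. ennreal ((partial_deriv i (w k) x - U i x)\<^sup>2) \<partial>?M) \<longlonglongrightarrow> 0"
    using tr unfolding has_trace_def abs_powr_two U_def by blast
  note [measurable] = W1_measurable(1)[OF u] W1_measurable(2)[OF u, folded U_def]
    smooth_measurable_lebesgue_on[OF w] smooth_measurable_lebesgue_on[OF smooth_partial_deriv[OF w]]
    smooth_measurable_lebesgue_on[OF smooth_odd_part[OF w]]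
  have Ufin: "(\<integral>\<^sup>+x. ennreal ((U i x)\<^sup>2) \<partial>?M) < \<infinity>" for i
    unfolding U_def by (rule W1_two_finite(2)[OF u])
  obtain C \<epsilon>0 where poincare: "axis_poincare \<Omega> UNIV C \<epsilon>0" using poincare_near_axis by blast
  then have C: "0 \<le> C" "0 < \<epsilon>0" by (auto simp: axis_poincare_def)
  define B where "B = (\<Sum>i\<in>UNIV. 2 * (\<integral>\<^sup>+x. ennreal ((U i x)\<^sup>2) \<partial>?M) + 2)"
  have Bfin: "B < \<infinity>"
    using Ufin unfolding B_def by (simp add: sum_2 ennreal_mult_eq_top_iff less_top[symmetric])
  have w1bound: "eventually (\<lambda>k. (\<integral>\<^sup>+x. ennreal ((partial_deriv i (w k) x)\<^sup>2) \<partial>?M)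
      \<le> 2 * (\<integral>\<^sup>+x. ennreal ((U i x)\<^sup>2) \<partial>?M) + 2) sequentially" for i
  proof -
    have "eventually (\<lambda>k. (\<integral>\<^sup>+x. ennreal ((partial_deriv i (w k) x - U i x)\<^sup>2) \<partial>?M) < 1) sequentially"
      by (rule order_tendstoD[OF w1]) simp
    then show ?thesis
    proof eventually_elim
      case (elim k)
      have "(\<integral>\<^sup>+x. ennreal ((partial_deriv i (w k) x)\<^sup>2) \<partial>?M)
          \<le> (\<integral>\<^sup>+x. 2 * ennreal ((U i x)\<^sup>2) + 2 * ennreal ((partial_deriv i (w k) x - U i x)\<^sup>2) \<partial>?M)"
      proof (rule nn_integral_mono)
        fix x
        have "(partial_deriv i (w k) x)\<^sup>2 \<le> 2 * (U i x)\<^sup>2 + 2 * (partial_deriv i (w k) x - U i x)\<^sup>2"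
          using zero_le_power2[of "partial_deriv i (w k) x - 2 * U i x"] by (simp add: power2_eq_square algebra_simps)
        then show "ennreal ((partial_deriv i (w k) x)\<^sup>2)
            \<le> 2 * ennreal ((U i x)\<^sup>2) + 2 * ennreal ((partial_deriv i (w k) x - U i x)\<^sup>2)"
          by (intro ennreal_le_two_sum) auto
      qed
      also have "\<dots> = 2 * (\<integral>\<^sup>+x. ennreal ((U i x)\<^sup>2) \<partial>?M) + 2 * (\<integral>\<^sup>+x. ennreal ((partial_deriv i (w k) x - U i x)\<^sup>2) \<partial>?M)"
        by (simp add: nn_integral_add nn_integral_cmult)
      also have "\<dots> \<le> 2 * (\<integral>\<^sup>+x. ennreal ((U i x)\<^sup>2) \<partial>?M) + 2 * 1"
        using elim by (intro add_left_mono mult_left_mono) auto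
      finally show ?case by simp
    qed
  qed
  have grad: "eventually (\<lambda>k. (\<integral>\<^sup>+z. ennreal (grad_sq (odd_part (w k)) z) * indicator \<Omega> z \<partial>lborel) \<le> B) sequentially"
    using w1bound[of 1] w1bound[of 2]
  proof eventually_elim
    case (elim k)
    have le: "(\<integral>\<^sup>+x. ennreal ((partial_deriv i (odd_part (w k)) x)\<^sup>2) \<partial>?M)
        \<le> (\<integral>\<^sup>+x. ennreal ((partial_deriv i (w k) x)\<^sup>2) \<partial>?M)" for i
    proof (rule nn_integral_half_reflect_sum)
      show "AE x in ?M. (partial_deriv i (odd_part (w k)) x)\<^sup>2
          \<le> ((partial_deriv i (w k) x)\<^sup>2 + (partial_deriv i (w k) (reflect x))\<^sup>2) / 2"
        using exhaust_2[of i] half_sum_square_le by (auto simp: partial_deriv_odd_part[OF w])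
    qed auto
    have "(\<integral>\<^sup>+z. ennreal (grad_sq (odd_part (w k)) z) * indicator \<Omega> z \<partial>lborel)
        = (\<integral>\<^sup>+z. ennreal (grad_sq (odd_part (w k)) z) \<partial>?M)"
      by (simp add: nn_integral_lebesgue_on[OF borel_\<Omega>])
    also have "\<dots> = (\<integral>\<^sup>+x. ennreal ((partial_deriv 1 (odd_part (w k)) x)\<^sup>2) \<partial>?M)
        + (\<integral>\<^sup>+x. ennreal ((partial_deriv 2 (odd_part (w k)) x)\<^sup>2) \<partial>?M)"
      using smooth_measurable_lebesgue_on[OF smooth_partial_deriv[OF smooth_odd_part[OF w]], where S = \<Omega>]
      by (subst nn_integral_add[symmetric]) (auto simp: grad_sq_def)
    also have "\<dots> \<le> B"
      unfolding B_def sum_2 using elim le[of 1] le[of 2] by (intro add_mono) (auto intro: order_trans)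
    finally show ?case .
  qed
  have odd_close: "(\<integral>\<^sup>+x. ennreal ((odd_part (w k) x - u x)\<^sup>2) \<partial>?M) \<le> (\<integral>\<^sup>+x. ennreal ((w k x - u x)\<^sup>2) \<partial>?M)" for k
  proof (rule nn_integral_half_reflect_sum)
    show "AE x in ?M. (odd_part (w k) x - u x)\<^sup>2 \<le> ((w k x - u x)\<^sup>2 + (w k (reflect x) - u (reflect x))\<^sup>2) / 2"
      using odd
    proof eventually_elim
      case (elim x)
      then have "odd_part (w k) x - u x = ((w k x - u x) - (w k (reflect x) - u (reflect x))) / 2"
        by (simp add: odd_part_def field_simps)
      then show ?case by (simp only: half_sum_square_le(2))
    qed
  qed auto
  have "(\<integral>\<^sup>+x. ennreal ((u x)\<^sup>2) * indicator (strip \<epsilon>) x \<partial>?M) \<le> ennreal (2 * (C * enn2real B) * \<epsilon>\<^sup>2)"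
    if \<epsilon>: "0 < \<epsilon>" "\<epsilon> < \<epsilon>0" for \<epsilon>
  proof -
    let ?L = "\<integral>\<^sup>+x. ennreal ((u x)\<^sup>2) * indicator (strip \<epsilon>) x \<partial>?M"
    have Sm[measurable]: "strip \<epsilon> \<inter> \<Omega> \<in> sets ?M" "strip \<epsilon> \<in> sets lebesgue"
      using open_strip[of \<epsilon>] open_\<Omega> by (auto simp: sets_restrict_space intro!: image_eqI[of _ _ "strip \<epsilon>"])
    have im[measurable]: "indicator (strip \<epsilon>) \<in> borel_measurable ?M"
      by (intro measurable_restrict_space1 borel_measurable_indicator Sm)
    have "eventually (\<lambda>k. ?L \<le> 2 * (ennreal (C * \<epsilon>\<^sup>2) * B) + 2 * (\<integral>\<^sup>+x. ennreal ((w k x - u x)\<^sup>2) \<partial>?M)) sequentially"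
      using grad
    proof eventually_elim
      case (elim k)
      have "(\<integral>\<^sup>+x. ennreal ((odd_part (w k) x)\<^sup>2) * indicator (strip \<epsilon>) x \<partial>?M)
          = (\<integral>\<^sup>+x. ennreal ((odd_part (w k) x)\<^sup>2) * indicator (\<Omega> \<inter> strip \<epsilon>) x \<partial>lborel)"
        unfolding nn_integral_lebesgue_on[OF borel_\<Omega>] by (intro nn_integral_cong) (auto simp: indicator_def)
      also have "\<dots> \<le> ennreal (C * \<epsilon>\<^sup>2) * (\<integral>\<^sup>+z. ennreal (grad_sq (odd_part (w k)) z) * indicator \<Omega> z \<partial>lborel)"
        using poincare \<epsilon> smooth_odd_part[OF w[of k]] odd_part_axis[of "w k"] by (simp add: axis_poincare_def)
      also have "\<dots> \<le> ennreal (C * \<epsilon>\<^sup>2) * B"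
        using elim by (rule mult_left_mono) simp
      finally have near: "(\<integral>\<^sup>+x. ennreal ((odd_part (w k) x)\<^sup>2) * indicator (strip \<epsilon>) x \<partial>?M) \<le> ennreal (C * \<epsilon>\<^sup>2) * B" .
      have "?L \<le> (\<integral>\<^sup>+x. 2 * (ennreal ((odd_part (w k) x)\<^sup>2) * indicator (strip \<epsilon>) x)
          + 2 * ennreal ((odd_part (w k) x - u x)\<^sup>2) \<partial>?M)"
      proof (rule nn_integral_mono)
        fix x
        have "(u x)\<^sup>2 \<le> 2 * (odd_part (w k) x)\<^sup>2 + 2 * (odd_part (w k) x - u x)\<^sup>2"
          using zero_le_power2[of "u x - 2 * odd_part (w k) x"] by (simp add: power2_eq_square algebra_simps)
        then have "ennreal ((u x)\<^sup>2) \<le> 2 * ennreal ((odd_part (w k) x)\<^sup>2) + 2 * ennreal ((odd_part (w k) x - u x)\<^sup>2)"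
          by (intro ennreal_le_two_sum) auto
        then show "ennreal ((u x)\<^sup>2) * indicator (strip \<epsilon>) x \<le> 2 * (ennreal ((odd_part (w k) x)\<^sup>2) * indicator (strip \<epsilon>) x)
          + 2 * ennreal ((odd_part (w k) x - u x)\<^sup>2)"
          by (auto simp: indicator_def)
      qed
      also have "\<dots> = 2 * (\<integral>\<^sup>+x. ennreal ((odd_part (w k) x)\<^sup>2) * indicator (strip \<epsilon>) x \<partial>?M)
          + 2 * (\<integral>\<^sup>+x. ennreal ((odd_part (w k) x - u x)\<^sup>2) \<partial>?M)"
        by (simp add: nn_integral_add nn_integral_cmult)
      also have "\<dots> \<le> 2 * (ennreal (C * \<epsilon>\<^sup>2) * B) + 2 * (\<integral>\<^sup>+x. ennreal ((w k x - u x)\<^sup>2) \<partial>?M)"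
        by (intro add_mono mult_left_mono near odd_close) auto
      finally show ?case .
    qed
    moreover have "(\<lambda>k. 2 * (ennreal (C * \<epsilon>\<^sup>2) * B) + 2 * (\<integral>\<^sup>+x. ennreal ((w k x - u x)\<^sup>2) \<partial>?M))
        \<longlonglongrightarrow> 2 * (ennreal (C * \<epsilon>\<^sup>2) * B) + 2 * 0"
      by (intro tendsto_add tendsto_const ennreal_tendsto_cmult w0) simp
    ultimately have "?L \<le> 2 * (ennreal (C * \<epsilon>\<^sup>2) * B) + 2 * 0"
      by (intro tendsto_lowerbound[of _ _ sequentially]) auto
    also have "\<dots> = ennreal (2 * (C * enn2real B) * \<epsilon>\<^sup>2)"
    proof -
      have "B = ennreal (enn2real B)" using Bfin by simp
      moreover have "ennreal (C * \<epsilon>\<^sup>2) * ennreal (enn2real B) = ennreal (C * \<epsilon>\<^sup>2 * enn2real B)"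
        using C(1) by (intro ennreal_mult'[symmetric]) simp
      moreover have "2 * ennreal (C * \<epsilon>\<^sup>2 * enn2real B) = ennreal (2 * (C * \<epsilon>\<^sup>2 * enn2real B))"
        using ennreal_mult'[of 2 "C * \<epsilon>\<^sup>2 * enn2real B"] by simp
      ultimately have "2 * (ennreal (C * \<epsilon>\<^sup>2) * B) = ennreal (2 * (C * \<epsilon>\<^sup>2 * enn2real B))"
        by metis
      then show ?thesis by (simp add: mult_ac)
    qed
    finally show ?thesis .
  qed
  moreover have "0 \<le> 2 * (C * enn2real B)" using C(1) by simp
  ultimately show ?thesis using C(2) by blast
qed

end

section \<open>Horizontal lines and boundary values\<close>

lemma emeasure_image_interval_le:
  fixes f :: "real \<Rightarrow> real"
  assumes "a \<le> b" and der: "\<And>t. t \<in> {a..b} \<Longrightarrow> (f has_real_derivative f' t) (at t within {a..b})"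
    and cont: "continuous_on {a..b} f'"
  shows "f ` {a..b} \<in> sets borel"
    "emeasure lborel (f ` {a..b}) \<le> (\<integral>\<^sup>+t. ennreal \<bar>f' t\<bar> * indicator {a..b} t \<partial>lborel)"
proof -
  have cf: "continuous_on {a..b} f"
    using der by (intro DERIV_continuous_on) auto
  obtain c d where cd: "f ` {a..b} = {c..d}" "c \<le> d"
    using continuous_image_closed_interval[OF \<open>a \<le> b\<close> cf] by blast
  then show "f ` {a..b} \<in> sets borel" by simp
  have "c \<in> f ` {a..b}" "d \<in> f ` {a..b}" using cd by auto
  then obtain s t where st: "s \<in> {a..b}" "f s = c" "t \<in> {a..b}" "f t = d" by blast
  define l u where "l = min s t" and "u = max s t"
  have lu: "l \<le> u" "{l..u} \<subseteq> {a..b}" using st by (auto simp: l_def u_def)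
  have "ennreal (d - c) = ennreal \<bar>f u - f l\<bar>"
    using st cd(2) by (auto simp: l_def u_def min_def max_def)
  also have "\<dots> \<le> (\<integral>\<^sup>+t. ennreal \<bar>f' t\<bar> * indicator {l..u} t \<partial>lborel)"
    by (rule abs_diff_le_nn_integral_deriv[OF lu(1) DERIV_subset[OF der lu(2)] continuous_on_subset[OF cont lu(2)]])
      (use lu(2) in auto)
  also have "\<dots> \<le> (\<integral>\<^sup>+t. ennreal \<bar>f' t\<bar> * indicator {a..b} t \<partial>lborel)"
    using lu(2) by (intro nn_integral_mono mult_left_mono) (auto simp: indicator_def)
  finally show "emeasure lborel (f ` {a..b}) \<le> (\<integral>\<^sup>+t. ennreal \<bar>f' t\<bar> * indicator {a..b} t \<partial>lborel)"
    using cd by simp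
qed

lemma nn_integral_closed_halfopen:
  fixes F :: "real \<Rightarrow> ennreal"
  shows "(\<integral>\<^sup>+t. F t * indicator {a..b} t \<partial>lborel) = (\<integral>\<^sup>+t. F t * indicator {a..<b} t \<partial>lborel)"
    "(\<integral>\<^sup>+t. F t * indicator {a..b} t \<partial>lborel) = (\<integral>\<^sup>+t. F t * indicator {a<..<b} t \<partial>lborel)"
proof -
  show "(\<integral>\<^sup>+t. F t * indicator {a..b} t \<partial>lborel) = (\<integral>\<^sup>+t. F t * indicator {a..<b} t \<partial>lborel)"
    using AE_lborel_singleton[of b] by (intro nn_integral_cong_AE, eventually_elim) (auto simp: indicator_def)
  show "(\<integral>\<^sup>+t. F t * indicator {a..b} t \<partial>lborel) = (\<integral>\<^sup>+t. F t * indicator {a<..<b} t \<partial>lborel)"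
    using AE_lborel_singleton[of a] AE_lborel_singleton[of b]
    by (intro nn_integral_cong_AE, eventually_elim) (auto simp: indicator_def)
qed

text \<open>
  A weighted one-dimensional area inequality. The interval is cut into pieces so short that \<open>h\<close>
  varies by less than \<open>\<delta>\<close> on each. A piece that meets the superlevel set of \<open>2 \<delta>\<close> then has
  \<open>h \<ge> \<delta>\<close> throughout, and the length of its image is at most the integral of \<open>\<bar>f'\<bar>\<close> over it.
\<close>

lemma emeasure_image_superlevel_le:
  fixes f h :: "real \<Rightarrow> real"
  assumes der: "\<And>t. t \<in> {0..1} \<Longrightarrow> (f has_real_derivative f' t) (at t within {0..1})"
    and cf': "continuous_on {0..1} f'"
    and ch: "continuous_on {0..1} h" and "0 < \<delta>"
    and m: "f' \<in> borel_measurable borel" "h \<in> borel_measurable borel"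
  shows "ennreal \<delta> * emeasure lborel (f ` {t \<in> {0..1}. 2 * \<delta> \<le> h t})
    \<le> (\<integral>\<^sup>+t. ennreal (h t) * ennreal \<bar>f' t\<bar> * indicator {0..<1} t \<partial>lborel)"
proof -
  note [measurable] = m
  have "uniformly_continuous_on {0..1} h"
    by (rule compact_uniformly_continuous[OF ch]) simp
  then obtain d where d: "d > 0" "\<And>s t. s \<in> {0..1} \<Longrightarrow> t \<in> {0..1} \<Longrightarrow> dist s t < d \<Longrightarrow> dist (h s) (h t) < \<delta>"
    unfolding uniformly_continuous_on_def using \<open>0 < \<delta>\<close> by metis
  obtain n :: nat where n: "n > 0" "1 / real n < d"
    using reals_Archimedean[OF d(1)] by (metis inverse_eq_divide zero_less_Suc)
  define l u where "l m = real m / real n" and "u m = real (Suc m) / real n" for m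
  have lu: "l m \<le> u m" "u m - l m = 1 / real n" for m
    using n(1) by (auto simp: l_def u_def field_simps)
  have J01: "{l m..u m} \<subseteq> {0..1}" if "m < n" for m
  proof -
    have "u m \<le> 1" using that n(1) by (simp add: u_def field_simps)
    then show ?thesis by (auto simp: l_def intro: order_trans[of 0 "real m / real n"])
  qed
  define B where "B = {t \<in> {0..1}. 2 * \<delta> \<le> h t}"
  define S where "S = {m. m < n \<and> {l m..u m} \<inter> B \<noteq> {}}"
  have finS: "finite S" by (simp add: S_def)
  have hJ: "\<delta> \<le> h t" if "m \<in> S" "t \<in> {l m..u m}" for m t
  proof -
    have "\<exists>s. s \<in> {l m..u m} \<and> s \<in> B" using that(1) unfolding S_def by blast
    then obtain s where s: "s \<in> {l m..u m}" "s \<in> {0..1}" "2 * \<delta> \<le> h s" unfolding B_def by blast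
    have "\<bar>s - t\<bar> \<le> 1 / real n" using s(1) that(2) lu(2)[of m] by auto
    then have "dist s t < d" using n(2) by (simp add: dist_real_def)
    moreover have "t \<in> {0..1}" using J01[of m] that by (auto simp: S_def)
    ultimately have "dist (h s) (h t) < \<delta>" using d(2) s(2) by blast
    then show ?thesis using s(3) by (auto simp: dist_real_def)
  qed
  have cover: "f ` B \<subseteq> (\<Union>m\<in>S. f ` {l m..u m})"
  proof
    fix y assume "y \<in> f ` B"
    then obtain t where t: "t \<in> B" "y = f t" by blast
    have t01: "0 \<le> t" "t \<le> 1" using t(1) by (auto simp: B_def)
    \<comment> \<open>The floor of \<open>t n\<close>; the endpoint 1 belongs to the last piece.\<close>
    define m where "m = (if t = 1 then n - 1 else nat \<lfloor>t * real n\<rfloor>)"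
    have "m < n \<and> t \<in> {l m..u m}"
    proof (cases "t = 1")
      case True
      then show ?thesis using n(1) by (auto simp: m_def l_def u_def of_nat_diff field_simps)
    next
      case False
      have *: "real m = of_int \<lfloor>t * real n\<rfloor>" using False t01 n(1) by (simp add: m_def)
      have "real m \<le> t * real n" "t * real n < real m + 1" unfolding * by linarith+
      moreover have "t * real n < real n" using False t01 n(1) by simp
      ultimately have "m < n" "real m \<le> t * real n" "t * real n < real m + 1" by linarith+
      then show ?thesis using n(1) by (auto simp: l_def u_def field_simps)
    qed
    moreover from this have "m \<in> S" using t(1) unfolding S_def by blast
    ultimately show "y \<in> (\<Union>m\<in>S. f ` {l m..u m})" using t(2) by blast
  qed
  have dm: "emeasure lborel (f ` {l m..u m}) \<le> (\<integral>\<^sup>+t. ennreal \<bar>f' t\<bar> * indicator {l m..<u m} t \<partial>lborel)"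
    and ms: "f ` {l m..u m} \<in> sets borel" if "m \<in> S" for m
  proof -
    have sub: "{l m..u m} \<subseteq> {0..1}" using that J01 by (auto simp: S_def)
    have 1: "(f has_real_derivative f' t) (at t within {l m..u m})" if "t \<in> {l m..u m}" for t
      using DERIV_subset[OF der sub] that sub by blast
    note e = emeasure_image_interval_le[OF lu(1) 1 continuous_on_subset[OF cf' sub]]
    show "emeasure lborel (f ` {l m..u m}) \<le> (\<integral>\<^sup>+t. ennreal \<bar>f' t\<bar> * indicator {l m..<u m} t \<partial>lborel)"
      using e(2) by (simp add: nn_integral_closed_halfopen(1))
    show "f ` {l m..u m} \<in> sets borel" by (rule e(1))
  qed
  have "emeasure lborel (f ` B) \<le> emeasure lborel (\<Union>m\<in>S. f ` {l m..u m})"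
    using ms finS by (intro emeasure_mono cover) auto
  also have "\<dots> \<le> (\<Sum>m\<in>S. emeasure lborel (f ` {l m..u m}))"
    using ms finS by (intro emeasure_subadditive_finite) auto
  also have "\<dots> \<le> (\<Sum>m\<in>S. \<integral>\<^sup>+t. ennreal \<bar>f' t\<bar> * indicator {l m..<u m} t \<partial>lborel)"
    by (intro sum_mono dm)
  finally have "ennreal \<delta> * emeasure lborel (f ` B)
      \<le> ennreal \<delta> * (\<Sum>m\<in>S. \<integral>\<^sup>+t. ennreal \<bar>f' t\<bar> * indicator {l m..<u m} t \<partial>lborel)"
    by (rule mult_left_mono) simp
  also have "\<dots> = (\<integral>\<^sup>+t. (\<Sum>m\<in>S. ennreal \<delta> * (ennreal \<bar>f' t\<bar> * indicator {l m..<u m} t)) \<partial>lborel)"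
    by (subst nn_integral_sum) (auto simp: sum_distrib_left nn_integral_cmult)
  also have "\<dots> \<le> (\<integral>\<^sup>+t. ennreal (h t) * ennreal \<bar>f' t\<bar> * indicator {0..<1} t \<partial>lborel)"
  proof (rule nn_integral_mono)
    fix t
    show "(\<Sum>m\<in>S. ennreal \<delta> * (ennreal \<bar>f' t\<bar> * indicator {l m..<u m} t))
        \<le> ennreal (h t) * ennreal \<bar>f' t\<bar> * indicator {0..<1} t"
    proof (cases "\<exists>m\<in>S. t \<in> {l m..<u m}")
      case False
      then have "(\<Sum>m\<in>S. ennreal \<delta> * (ennreal \<bar>f' t\<bar> * indicator {l m..<u m} t)) = 0"
        by (intro sum.neutral) (auto simp: indicator_def)
      then show ?thesis by simp
    next
      case True
      then obtain m where m: "m \<in> S" "t \<in> {l m..<u m}" by blast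
      have uniq: "k = m" if "t \<in> {l k..<u k}" for k
      proof -
        have "real k \<le> t * real n" "t * real n < real k + 1" "real m \<le> t * real n" "t * real n < real m + 1"
          using that m(2) n(1) by (auto simp: l_def u_def field_simps)
        then show ?thesis by linarith
      qed
      have "(\<Sum>k\<in>S. ennreal \<delta> * (ennreal \<bar>f' t\<bar> * indicator {l k..<u k} t))
          = (\<Sum>k\<in>{m}. ennreal \<delta> * (ennreal \<bar>f' t\<bar> * indicator {l k..<u k} t))"
      proof (rule sum.mono_neutral_right[OF finS])
        show "\<forall>k\<in>S - {m}. ennreal \<delta> * (ennreal \<bar>f' t\<bar> * indicator {l k..<u k} t) = 0"
        proof
          fix k assume "k \<in> S - {m}"
          then have "t \<notin> {l k..<u k}" using uniq by blast
          then show "ennreal \<delta> * (ennreal \<bar>f' t\<bar> * indicator {l k..<u k} t) = 0" by simp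
        qed
      qed (use m(1) in simp)
      also have "\<dots> = ennreal \<delta> * ennreal \<bar>f' t\<bar>" using m(2) by simp
      also have "\<dots> \<le> ennreal (h t) * ennreal \<bar>f' t\<bar>"
      proof (rule mult_right_mono[OF ennreal_leI])
        show "\<delta> \<le> h t" by (rule hJ[OF m(1)]) (use m(2) in simp)
      qed simp
      also have "\<dots> = ennreal (h t) * ennreal \<bar>f' t\<bar> * indicator {0..<1} t"
      proof -
        have "m < n" using m(1) by (simp add: S_def)
        then have "u m \<in> {0..1}" "l m \<in> {0..1}" using J01[of m] lu(1)[of m] by (simp_all add: subset_iff)
        then have "t \<in> {0..<1}" using m(2) by simp
        then show ?thesis by simp
      qed
      finally show ?thesis .
    qed
  qed
  finally show ?thesis by (simp add: B_def)
qed

lemma arclength_as_curve_integral: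
  assumes "smooth_closed_curve \<Gamma>"
  obtains c where "smooth_loop c" "range c = \<Gamma>"
    "\<And>F. F \<in> borel_measurable borel \<Longrightarrow> (\<integral>\<^sup>+x. F x \<partial>arclength \<Gamma>)
      = (\<integral>\<^sup>+t. F (c t) * ennreal (norm (vector_derivative c (at t))) * indicator {0..<1} t \<partial>lborel)"
proof -
  define c where "c = (SOME c. smooth_loop c \<and> range c = \<Gamma>)"
  have c: "smooth_loop c \<and> range c = \<Gamma>"
    unfolding c_def using assms unfolding smooth_closed_curve_def by (rule someI_ex)
  then interpret smooth_loop_param c by unfold_locales blast
  have [measurable]: "c \<in> borel_measurable borel" "c' \<in> borel_measurable borel"
    by (rule borel_measurable_continuous_onI[OF continuous_c], rule borel_measurable_continuous_onI[OF continuous_c'])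
  have "(\<integral>\<^sup>+x. F x \<partial>arclength \<Gamma>)
      = (\<integral>\<^sup>+t. F (c t) * ennreal (norm (vector_derivative c (at t))) * indicator {0..<1} t \<partial>lborel)"
    if [measurable]: "F \<in> borel_measurable borel" for F
  proof -
    have cm: "c \<in> borel_measurable (density (restrict_space lborel {0..<1}) (\<lambda>t. ennreal (norm (c' t))))"
      by (simp add: measurable_restrict_space1)
    have "(\<integral>\<^sup>+x. F x \<partial>arclength \<Gamma>)
        = (\<integral>\<^sup>+t. F (c t) \<partial>density (restrict_space lborel {0..<1}) (\<lambda>t. ennreal (norm (c' t))))"
      unfolding arclength_def c_def[symmetric] Let_def c'_def[symmetric]
      by (rule nn_integral_distr[OF cm]) simp
    also have "\<dots> = (\<integral>\<^sup>+t. ennreal (norm (c' t)) * F (c t) \<partial>restrict_space lborel {0..<1})"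
      by (rule nn_integral_density) (auto intro!: measurable_restrict_space1)
    also have "\<dots> = (\<integral>\<^sup>+t. ennreal (norm (c' t)) * F (c t) * indicator {0..<1} t \<partial>lborel)"
      by (rule nn_integral_restrict_space) simp
    finally show ?thesis by (simp add: c'_def mult_ac)
  qed
  then show ?thesis using c that by blast
qed

definition bad_heights :: "(real^2) set \<Rightarrow> (real^2 \<Rightarrow> real) \<Rightarrow> real \<Rightarrow> real \<Rightarrow> real set" where
  "bad_heights \<Gamma> w m \<delta> = {y. \<exists>x\<in>\<Gamma>. x $ 2 = y \<and> \<delta> \<le> \<bar>w x - m\<bar>}"

text \<open>
  Chebyshev's inequality for the projection of the curve onto the vertical axis.
\<close>

lemma emeasure_bad_heights:
  assumes "smooth_closed_curve \<Gamma>" and w: "smooth w" and "0 < \<delta>"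
  shows "bad_heights \<Gamma> w m (2 * \<delta>) \<in> sets borel"
    "ennreal \<delta> * emeasure lborel (bad_heights \<Gamma> w m (2 * \<delta>)) \<le> (\<integral>\<^sup>+x. ennreal \<bar>w x - m\<bar> \<partial>arclength \<Gamma>)"
proof -
  obtain c where c: "smooth_loop c" "range c = \<Gamma>" and arc: "\<And>F. F \<in> borel_measurable borel \<Longrightarrow> (\<integral>\<^sup>+x. F x \<partial>arclength \<Gamma>)
      = (\<integral>\<^sup>+t. F (c t) * ennreal (norm (vector_derivative c (at t))) * indicator {0..<1} t \<partial>lborel)"
    using arclength_as_curve_integral[OF assms(1)] by blast
  interpret smooth_loop_param c using c(1) by unfold_locales
  have wm[measurable]: "w \<in> borel_measurable borel" by (rule smooth_borel_measurable[OF w])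
  have cwc: "continuous_on A (\<lambda>t. \<bar>w (c t) - m\<bar>)" for A
    by (intro continuous_intros continuous_on_compose2[OF smooth_continuous[OF w, of UNIV] continuous_c]) auto
  have eq: "bad_heights \<Gamma> w m (2 * \<delta>) = (\<lambda>t. c t $ 2) ` {t \<in> {0..1}. 2 * \<delta> \<le> \<bar>w (c t) - m\<bar>}"
    unfolding bad_heights_def c(2)[symmetric] range_eq_path_image path_image_def by (auto simp: image_iff)
  have "closed ({0..1} \<inter> (\<lambda>t. \<bar>w (c t) - m\<bar>) -` {2 * \<delta>..})"
    by (rule continuous_closed_preimage[OF cwc]) simp_all
  moreover have "{0..1} \<inter> (\<lambda>t. \<bar>w (c t) - m\<bar>) -` {2 * \<delta>..} = {t \<in> {0..1}. 2 * \<delta> \<le> \<bar>w (c t) - m\<bar>}"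
    by auto
  moreover have "bounded {t \<in> {0..1::real}. 2 * \<delta> \<le> \<bar>w (c t) - m\<bar>}"
    by (rule bounded_subset[of "{0..1}"]) auto
  ultimately have "compact {t \<in> {0..1}. 2 * \<delta> \<le> \<bar>w (c t) - m\<bar>}"
    by (simp add: compact_eq_bounded_closed)
  then have "compact (bad_heights \<Gamma> w m (2 * \<delta>))"
    unfolding eq by (intro compact_continuous_image continuous_intros continuous_c)
  then show "bad_heights \<Gamma> w m (2 * \<delta>) \<in> sets borel"
    by (intro borel_closed compact_imp_closed)
  have "ennreal \<delta> * emeasure lborel (bad_heights \<Gamma> w m (2 * \<delta>))
      \<le> (\<integral>\<^sup>+t. ennreal \<bar>w (c t) - m\<bar> * ennreal \<bar>c' t $ 2\<bar> * indicator {0..<1} t \<partial>lborel)"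
    unfolding eq
  proof (rule emeasure_image_superlevel_le[OF has_real_derivative_component _ cwc \<open>0 < \<delta>\<close>])
    show "continuous_on {0..1} (\<lambda>t. c' t $ 2)" by (intro continuous_intros continuous_c')
    show "(\<lambda>t. c' t $ 2) \<in> borel_measurable borel"
      by (intro borel_measurable_continuous_onI continuous_intros continuous_c')
    show "(\<lambda>t. \<bar>w (c t) - m\<bar>) \<in> borel_measurable borel"
      by (intro borel_measurable_continuous_onI cwc)
  qed
  also have "\<dots> \<le> (\<integral>\<^sup>+t. ennreal \<bar>w (c t) - m\<bar> * ennreal (norm (c' t)) * indicator {0..<1} t \<partial>lborel)"
    by (intro nn_integral_mono mult_right_mono mult_left_mono ennreal_leI component_le_norm_cart) auto
  also have "\<dots> = (\<integral>\<^sup>+x. ennreal \<bar>w x - m\<bar> \<partial>arclength \<Gamma>)"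
    unfolding c'_def by (rule arc[symmetric]) measurable
  finally show "ennreal \<delta> * emeasure lborel (bad_heights \<Gamma> w m (2 * \<delta>)) \<le> (\<integral>\<^sup>+x. ennreal \<bar>w x - m\<bar> \<partial>arclength \<Gamma>)" .
qed

context admissible_domain
begin

lemma closure_\<Omega>_disjoint: "j \<in> {1..N} \<Longrightarrow> D j \<inter> closure \<Omega> = {}"
proof -
  assume j: "j \<in> {1..N}"
  have "D j \<inter> \<Omega> = {}" using closure_subset[of "D j"] j by (auto simp: mem_\<Omega>)
  then show ?thesis using component_domain(2)[of j] j open_Int_closure_eq_empty by auto
qed

text \<open>
  Go to the right from a point of the hole \<open>D j\<close>. Take the last point \<open>t1\<close> of the line in the
  closure of a hole with a value other than \<open>M 0\<close>, and then the first point \<open>t2\<close> after it that is in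
  the closure of another hole or outside \<open>D 0\<close>. The line may cross the boundary infinitely often;
  only these two points matter.
\<close>

lemma horizontal_crossing:
  fixes M :: "nat \<Rightarrow> real"
  assumes j: "j \<le> N" "M j \<noteq> M 0" and y: "pt x y \<in> D j"
  obtains t1 t2 i i' where "t1 < t2" "i \<le> N" "i' \<le> N" "M i \<noteq> M 0" "M i' = M 0"
    "pt t1 y \<in> frontier (D i)" "pt t2 y \<in> frontier (D i')" "\<And>t. t1 < t \<Longrightarrow> t < t2 \<Longrightarrow> pt t y \<in> \<Omega>"
proof -
  have contp: "continuous_on S (\<lambda>t. pt t y)" for S by (intro continuous_intros)
  define A where "A = {i \<in> {1..N}. M i \<noteq> M 0}"
  define KA where "KA = (\<Union>i\<in>A. closure (D i))"
  define KB where "KB = - D 0 \<union> (\<Union>i\<in>{1..N} - A. closure (D i))"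
  have "closed KA" "closed KB"
    using component_domain(2)[of 0] by (auto simp: KA_def KB_def A_def intro!: closed_UN closed_Un closed_Compl)
  have "j \<in> A" using j by (cases "j = 0") (auto simp: A_def)
  define R where "R = (SOME R. \<forall>z\<in>D 0. norm z \<le> R)"
  have R: "norm z \<le> R" if "z \<in> D 0" for z
  proof -
    have "\<exists>R. \<forall>z\<in>D 0. norm z \<le> R" using component_domain(4)[of 0] by (auto simp: bounded_iff)
    then have "\<forall>z\<in>D 0. norm z \<le> R" unfolding R_def by (rule someI_ex)
    then show ?thesis using that by blast
  qed
  have Rt: "\<bar>t\<bar> \<le> R" if "pt t y \<in> D 0" for t
    using R[OF that] component_le_norm_cart[of "pt t y" 1] by simp
  have KA0: "KA \<subseteq> D 0" using closure_D_subset by (auto simp: KA_def A_def)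
  define LA where "LA = {t. pt t y \<in> KA}"
  have "closed LA"
    using continuous_closed_vimage[OF \<open>closed KA\<close>, of "\<lambda>t. pt t y"] contp[of UNIV]
    by (simp add: LA_def vimage_def continuous_on_eq_continuous_at)
  have "x \<in> LA" using y \<open>j \<in> A\<close> closure_subset[of "D j"] by (auto simp: LA_def KA_def)
  have bddA: "bdd_above LA" using KA0 Rt by (intro bdd_aboveI[of _ R]) (force simp: LA_def abs_le_iff)
  define t1 where "t1 = Sup LA"
  have t1: "t1 \<in> LA" unfolding t1_def
    by (rule closed_contains_Sup) (use \<open>x \<in> LA\<close> bddA \<open>closed LA\<close> in auto)
  have t1_max: "t \<le> t1" if "t \<in> LA" for t unfolding t1_def by (rule cSup_upper[OF that bddA])
  define LB where "LB = {t. t1 \<le> t \<and> pt t y \<in> KB}"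
  have "closed LB"
  proof -
    have "closed ({t1..} \<inter> (\<lambda>t. pt t y) -` KB)"
      by (rule continuous_closed_preimage[OF contp _ \<open>closed KB\<close>]) simp
    moreover have "{t1..} \<inter> (\<lambda>t. pt t y) -` KB = LB" by (auto simp: LB_def)
    ultimately show ?thesis by simp
  qed
  have "max t1 (R + 1) \<in> LB"
  proof -
    have "pt (max t1 (R + 1)) y \<notin> D 0" using Rt[of "max t1 (R + 1)"] by linarith
    then show ?thesis by (simp add: LB_def KB_def)
  qed
  have bddB: "bdd_below LB" by (rule bdd_belowI[of _ t1]) (simp add: LB_def)
  define t2 where "t2 = Inf LB"
  have t2: "t2 \<in> LB" unfolding t2_def
    by (rule closed_contains_Inf) (use \<open>max t1 (R + 1) \<in> LB\<close> bddB \<open>closed LB\<close> in auto)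
  have t2_min: "t2 \<le> t" if "t \<in> LB" for t unfolding t2_def by (rule cInf_lower[OF that bddB])
  have "KA \<inter> KB = {}"
  proof (rule ccontr)
    assume "KA \<inter> KB \<noteq> {}"
    then obtain z i where z: "z \<in> KB" "i \<in> A" "z \<in> closure (D i)" by (auto simp: KA_def)
    then have "z \<in> D 0" using KA0 by (auto simp: KA_def)
    then obtain k where "k \<in> {1..N} - A" "z \<in> closure (D k)" using z(1) by (auto simp: KB_def)
    then show False using closure_D_disjoint[of i k] z(2,3) by (auto simp: A_def)
  qed
  then have "t1 \<noteq> t2" using t1 t2 by (auto simp: LA_def LB_def)
  then have lt: "t1 < t2" using t2 by (simp add: LB_def)
  have in\<Omega>: "pt t y \<in> \<Omega>" if "t1 < t" "t < t2" for t
  proof -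
    have "t \<notin> LA" using t1_max that(1) by force
    moreover have "t \<notin> LB" using t2_min that(2) by force
    ultimately show ?thesis using that(1) by (auto simp: LA_def LB_def KA_def KB_def mem_\<Omega>)
  qed
  have "(\<lambda>t. pt t y) ` closure {t1<..<t2} \<subseteq> closure \<Omega>"
    by (rule image_closure_subset[OF contp]) (use in\<Omega> closure_subset[of \<Omega>] in auto)
  then have cl: "pt t1 y \<in> closure \<Omega>" "pt t2 y \<in> closure \<Omega>" using lt by auto
  obtain i where i: "i \<in> A" "pt t1 y \<in> closure (D i)" using t1 by (auto simp: LA_def KA_def)
  have 1: "pt t1 y \<in> frontier (D i)"
    using i closure_\<Omega>_disjoint[of i] cl(1) component_domain(2)[of i] by (auto simp: A_def frontier_def interior_open)
  have "\<exists>i'\<le>N. M i' = M 0 \<and> pt t2 y \<in> frontier (D i')"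
  proof (cases "pt t2 y \<in> D 0")
    case False
    have "closure \<Omega> \<subseteq> closure (D 0)" by (rule closure_mono) (auto simp: mem_\<Omega>)
    then have "pt t2 y \<in> frontier (D 0)" using False cl(2) component_domain(2)[of 0] by (auto simp: frontier_def interior_open)
    then show ?thesis by blast
  next
    case True
    then obtain i' where i': "i' \<in> {1..N} - A" "pt t2 y \<in> closure (D i')"
      using t2 by (auto simp: LB_def KB_def)
    then have "pt t2 y \<in> frontier (D i')"
      using closure_\<Omega>_disjoint[of i'] cl(2) component_domain(2)[of i'] by (auto simp: frontier_def interior_open)
    moreover have "i' \<le> N" "M i' = M 0" using i'(1) by (auto simp: A_def)
    ultimately show ?thesis by blast
  qed
  then obtain i' where "i' \<le> N" "M i' = M 0" "pt t2 y \<in> frontier (D i')" by blast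
  moreover have "i \<le> N" "M i \<noteq> M 0" using i(1) by (auto simp: A_def)
  ultimately show ?thesis using lt 1 in\<Omega> that by blast
qed

text \<open>
  Of the gap \<open>5 \<delta>\<close> between the two boundary values, the deviations of \<open>w\<close> from them use up less
  than \<open>2 \<delta>\<close> at each end of the segment.
\<close>

lemma line_integral_lower_bound:
  fixes M :: "nat \<Rightarrow> real"
  assumes w: "smooth w" and j: "j \<le> N" "M j \<noteq> M 0" and y: "pt x y \<in> D j"
    and gap: "\<And>i. i \<le> N \<Longrightarrow> M i \<noteq> M 0 \<Longrightarrow> 5 * \<delta> \<le> \<bar>M i - M 0\<bar>"
    and good: "\<And>i. i \<le> N \<Longrightarrow> y \<notin> bad_heights (frontier (D i)) w (M i) (2 * \<delta>)"
  shows "ennreal \<delta> \<le> (\<integral>\<^sup>+x. ennreal \<bar>partial_deriv 1 w (pt x y)\<bar> * indicator \<Omega> (pt x y) \<partial>lborel)"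
proof -
  obtain t1 t2 i i' where t: "t1 < t2" "i \<le> N" "i' \<le> N" "M i \<noteq> M 0" "M i' = M 0"
    "pt t1 y \<in> frontier (D i)" "pt t2 y \<in> frontier (D i')" and in\<Omega>: "\<And>t. t1 < t \<Longrightarrow> t < t2 \<Longrightarrow> pt t y \<in> \<Omega>"
    using horizontal_crossing[of j M, OF j y] by metis
  have close: "\<bar>w z - M k\<bar> < 2 * \<delta>" if "k \<le> N" "z \<in> frontier (D k)" "z $ 2 = y" for k z
    using good[OF that(1)] that(2,3) by (force simp: bad_heights_def)
  have "\<bar>w (pt t1 y) - M i\<bar> < 2 * \<delta>" "\<bar>w (pt t2 y) - M 0\<bar> < 2 * \<delta>"
    using close[OF t(2,6)] close[OF t(3,7)] t(5) by simp_all
  then have "\<delta> \<le> \<bar>w (pt t2 y) - w (pt t1 y)\<bar>" using gap[OF t(2,4)] by linarith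
  then have "ennreal \<delta> \<le> ennreal \<bar>w (pt t2 y) - w (pt t1 y)\<bar>" by (rule ennreal_leI)
  also have "\<dots> \<le> (\<integral>\<^sup>+x. ennreal \<bar>partial_deriv 1 w (pt x y)\<bar> * indicator {t1..t2} x \<partial>lborel)"
  proof (rule abs_diff_le_nn_integral_deriv)
    show "((\<lambda>x. w (pt x y)) has_real_derivative partial_deriv 1 w (pt x y)) (at x within {t1..t2})" for x
      using smooth_has_real_derivative_curve[OF w DERIV_ident DERIV_const, of y x "{t1..t2}"] by simp
    show "continuous_on {t1..t2} (\<lambda>x. partial_deriv 1 w (pt x y))"
      by (intro continuous_on_compose2[OF smooth_continuous[OF smooth_partial_deriv[OF w], of UNIV]]
          continuous_intros) auto
  qed (use t(1) in simp)
  also have "\<dots> = (\<integral>\<^sup>+x. ennreal \<bar>partial_deriv 1 w (pt x y)\<bar> * indicator {t1<..<t2} x \<partial>lborel)"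
    by (rule nn_integral_closed_halfopen(2))
  also have "\<dots> \<le> (\<integral>\<^sup>+x. ennreal \<bar>partial_deriv 1 w (pt x y)\<bar> * indicator \<Omega> (pt x y) \<partial>lborel)"
    using in\<Omega> by (intro nn_integral_mono mult_left_mono) (auto simp: indicator_def)
  finally show ?thesis .
qed

text \<open>
  The projection of \<open>D j\<close> onto the vertical axis is an interval with 0 in its closure, so it
  contains all small positive or all small negative heights.
\<close>

lemma heights_near_axis:
  assumes "j \<le> N"
  obtains e0 and Y :: "real \<Rightarrow> real set" where "0 < e0"
    "\<And>e. 0 < e \<Longrightarrow> e < e0 \<Longrightarrow> Y e \<in> sets borel \<and> emeasure lborel (Y e) = ennreal e \<and> Y e \<subseteq> {-e<..<e}"
    "\<And>e y. 0 < e \<Longrightarrow> e < e0 \<Longrightarrow> y \<in> Y e \<Longrightarrow> \<exists>x. pt x y \<in> D j"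
proof -
  define P where "P = (\<lambda>z. z $ 2) ` D j"
  have "connected P" unfolding P_def
    by (intro connected_continuous_image continuous_intros component_domain[OF assms])
  then have int: "y \<in> P" if "q \<in> P" "p \<in> P" "q \<le> y" "y \<le> p" for q p y
    using that by (meson connected_contains_Icc atLeastAtMost_iff subsetD)
  have line: "\<exists>x. pt x y \<in> D j" if "y \<in> P" for y
  proof -
    obtain z where "z \<in> D j" "y = z $ 2" using \<open>y \<in> P\<close> unfolding P_def by blast
    then have "pt (z $ 1) y \<in> D j" by simp
    then show ?thesis by blast
  qed
  obtain a where a: "a \<in> frontier (D j)" "a $ 2 = 0" using component_domain(6)[OF assms] by (auto simp: x1_axis_def)
  have near: "\<exists>q\<in>P. \<bar>q\<bar> < e" if "e > 0" for e
  proof -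
    have "a \<in> closure (D j)" using a(1) by (simp add: frontier_def)
    then obtain z where z: "z \<in> D j" "dist z a < e" using \<open>e > 0\<close> unfolding closure_approachable by blast
    have "\<bar>(z - a) $ 2\<bar> \<le> norm (z - a)" by (rule component_le_norm_cart)
    then have "\<bar>z $ 2\<bar> < e" using z(2) a(2) by (simp add: dist_norm)
    then show ?thesis using z(1) by (auto simp: P_def)
  qed
  have "\<exists>p\<in>P. p \<noteq> 0"
  proof (rule ccontr)
    assume "\<not> (\<exists>p\<in>P. p \<noteq> 0)"
    then have z: "z $ 2 = 0" if "z \<in> D j" for z using that by (auto simp: P_def)
    obtain z where zD: "z \<in> D j" using component_domain(1)[OF assms] by blast
    obtain r where r: "r > 0" "ball z r \<subseteq> D j" using component_domain(2)[OF assms] zD by (meson openE)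
    have "dist (pt (z $ 1) (z $ 2 + r / 2)) (pt (z $ 1) (z $ 2)) \<le> r / 2"
      using dist_pt_le[of "z $ 1" "z $ 2 + r / 2" "z $ 1" "z $ 2"] r(1) by simp
    then have "pt (z $ 1) (z $ 2 + r / 2) \<in> ball z r" using r(1) by (simp add: dist_commute)
    then have "pt (z $ 1) (z $ 2 + r / 2) $ 2 = 0" using r(2) z by blast
    then show False using z[OF zD] r(1) by simp
  qed
  then obtain p where p: "p \<in> P" "p \<noteq> 0" by blast
  show ?thesis
  proof (cases "p > 0")
    case True
    have "y \<in> P" if "0 < y" "y < p" for y
    proof -
      obtain q where "q \<in> P" "\<bar>q\<bar> < y" using near[OF \<open>0 < y\<close>] by blast
      then show ?thesis using int[of q p y] p(1) that by auto
    qed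
    note pos = this
    show ?thesis
    proof (rule that)
      show "0 < p" by (rule True)
      show "{0<..<e} \<in> sets borel \<and> emeasure lborel {0<..<e} = ennreal e \<and> {0<..<e} \<subseteq> {-e<..<e}"
        if "0 < e" for e :: real using that by auto
      show "\<exists>x. pt x y \<in> D j" if "e < p" "y \<in> {0<..<e}" for e y
        by (rule line, rule pos) (use that in auto)
    qed
  next
    case False
    then have "p < 0" using p(2) by simp
    have "y \<in> P" if "p < y" "y < 0" for y
    proof -
      have "0 < - y" using that by simp
      then obtain q where "q \<in> P" "\<bar>q\<bar> < - y" using near by blast
      then show ?thesis using int[of p q y] p(1) that by auto
    qed
    note neg = this
    show ?thesis
    proof (rule that)
      show "0 < - p" using \<open>p < 0\<close> by simp
      show "{-e<..<0} \<in> sets borel \<and> emeasure lborel {-e<..<0} = ennreal e \<and> {-e<..<0} \<subseteq> {-e<..<e}"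
        if "0 < e" for e :: real using that by auto
      show "\<exists>x. pt x y \<in> D j" if "e < - p" "y \<in> {-e<..<0}" for e y
        by (rule line, rule neg) (use that in auto)
    qed
  qed
qed

end

section \<open>Equality of the boundary values\<close>

lemma AE_off_axis: "AE x in lborel. (x :: real^2) $ 2 \<noteq> 0"
proof -
  have "negligible {x :: real^2. x \<bullet> axis 2 1 = 0}"
    by (rule negligible_standard_hyperplane) (simp add: Basis_plane)
  then have "{x :: real^2. x $ 2 = 0} \<in> null_sets lebesgue"
    by (simp add: negligible_iff_null_sets cart_eq_inner_axis)
  then have "AE x in lebesgue. x \<notin> {x :: real^2. x $ 2 = 0}"
    by (rule AE_not_in)
  then show ?thesis by (simp add: AE_completion_iff)
qed

context admissible_domain
begin

lemma strip_integral_tendsto_0: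
  assumes f: "f \<in> borel_measurable (lebesgue_on \<Omega>)" and fin: "(\<integral>\<^sup>+x. f x \<partial>lebesgue_on \<Omega>) < \<infinity>"
  shows "(\<lambda>n. \<integral>\<^sup>+x. f x * indicator (strip (1 / real (Suc n))) x \<partial>lebesgue_on \<Omega>) \<longlonglongrightarrow> 0"
proof -
  let ?M = "lebesgue_on \<Omega>"
  have off: "AE x in ?M. x $ 2 \<noteq> 0"
  proof -
    have "AE x in lebesgue. (x :: real^2) $ 2 \<noteq> 0" using AE_off_axis by (rule AE_completion)
    then show ?thesis using borel_\<Omega> by (subst AE_lebesgue_on_iff) (auto intro: sets_completionI_sets)
  qed
  have im: "indicator (strip e) \<in> borel_measurable ?M" for e
    using open_strip[of e] by (intro measurable_restrict_space1 borel_measurable_indicator) simp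
  have "(\<lambda>n. \<integral>\<^sup>+x. f x * indicator (strip (1 / real (Suc n))) x \<partial>?M) \<longlonglongrightarrow> (\<integral>\<^sup>+x. 0 \<partial>?M)"
  proof (rule nn_integral_dominated_convergence[where w = f])
    show "AE x in ?M. f x * indicator (strip (1 / real (Suc n))) x \<le> f x" for n
      by (auto simp: indicator_def)
    show "AE x in ?M. (\<lambda>n. f x * indicator (strip (1 / real (Suc n))) x) \<longlonglongrightarrow> 0"
      using off
    proof eventually_elim
      case (elim x)
      obtain n where n: "inverse (real (Suc n)) < \<bar>x $ 2\<bar>" using reals_Archimedean[of "\<bar>x $ 2\<bar>"] elim by auto
      have "x \<notin> strip (1 / real (Suc m))" if "m \<ge> n" for m
      proof -
        have "1 / real (Suc m) \<le> inverse (real (Suc n))" using that by (simp add: field_simps)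
        then show ?thesis using n by simp
      qed
      then have "\<forall>\<^sub>F m in sequentially. f x * indicator (strip (1 / real (Suc m))) x = 0"
        by (intro eventually_sequentiallyI[of n]) (auto simp: indicator_def)
      then show ?case by (rule tendsto_eventually)
    qed
  qed (use f fin im in \<open>auto intro!: borel_measurable_times_ennreal\<close>)
  then show ?thesis by simp
qed

text \<open>
  Integrate the bound on the single lines over the good heights, which make up a set of measure
  \<open>e\<close> up to a vanishing error, and let the smooth approximations converge.
\<close>

lemma head_jump_le_strip_integral:
  fixes M :: "nat \<Rightarrow> real"
  assumes tr: "has_trace 1 \<Omega> \<Phi> tr\<Phi>"
    and const: "\<And>i. i \<le> N \<Longrightarrow> AE x in arclength (frontier (D i)). tr\<Phi> x = M i"
    and j: "j \<le> N" "M j \<noteq> M 0"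
  shows "\<exists>\<delta>>0. \<exists>e0>0. \<forall>e. 0 < e \<longrightarrow> e < e0 \<longrightarrow>
      ennreal (\<delta> * e) \<le> (\<integral>\<^sup>+x. ennreal \<bar>weak_partial \<Omega> 1 \<Phi> x\<bar> * indicator (strip e) x \<partial>lebesgue_on \<Omega>)"
proof -
  let ?M = "lebesgue_on \<Omega>"
  define G where "G = weak_partial \<Omega> 1 \<Phi>"
  have powr1: "\<bar>t\<bar> powr 1 = \<bar>t\<bar>" for t :: real by simp
  obtain w where W1: "\<Phi> \<in> W1 1 \<Omega>" and w: "\<And>k. smooth (w k)"
    and w1: "(\<lambda>k. \<integral>\<^sup>+x. ennreal \<bar>partial_deriv 1 (w k) x - G x\<bar> \<partial>?M) \<longlonglongrightarrow> 0"
    and wt: "\<And>\<Gamma>. \<Gamma> \<in> components (frontier \<Omega>) \<Longrightarrow> (\<lambda>k. \<integral>\<^sup>+x. ennreal \<bar>w k x - tr\<Phi> x\<bar> \<partial>arclength \<Gamma>) \<longlonglongrightarrow> 0"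
    using tr unfolding has_trace_def powr1 G_def by blast
  have Gm[measurable]: "G \<in> borel_measurable ?M" unfolding G_def by (rule W1_measurable(2)[OF W1])
  note wm[measurable] = smooth_measurable_lebesgue_on[OF smooth_partial_deriv[OF w]]
  define I where "I = {i. i \<le> N \<and> M i \<noteq> M 0}"
  \<comment> \<open>A fifth of the smallest gap, as \<open>line_integral_lower_bound\<close> requires.\<close>
  define \<delta> where "\<delta> = Min ((\<lambda>i. \<bar>M i - M 0\<bar>) ` I) / 5"
  have finI: "finite I" "j \<in> I" using j by (auto simp: I_def)
  have "Min ((\<lambda>i. \<bar>M i - M 0\<bar>) ` I) > 0"
    using finI by (subst Min_gr_iff) (auto simp: I_def)
  then have \<delta>: "\<delta> > 0" by (simp add: \<delta>_def)
  have gap: "5 * \<delta> \<le> \<bar>M i - M 0\<bar>" if "i \<le> N" "M i \<noteq> M 0" for i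
    using finI(1) that by (auto simp: \<delta>_def I_def intro!: Min_le)
  define bad where "bad i k = bad_heights (frontier (D i)) (w k) (M i) (2 * \<delta>)" for i k
  have badm[measurable]: "bad i k \<in> sets borel" if "i \<le> N" for i k
    unfolding bad_def by (rule emeasure_bad_heights(1)[OF component_domain(5)[OF that] w \<delta>])
  have bad0: "(\<lambda>k. ennreal \<delta> * emeasure lborel (bad i k)) \<longlonglongrightarrow> 0" if i: "i \<le> N" for i
  proof (rule tendsto_0_le_ennreal)
    show "(\<lambda>k. \<integral>\<^sup>+x. ennreal \<bar>w k x - tr\<Phi> x\<bar> \<partial>arclength (frontier (D i))) \<longlonglongrightarrow> 0"
      by (rule wt[OF frontier_D_component[OF i]])
    show "ennreal \<delta> * emeasure lborel (bad i k) \<le> (\<integral>\<^sup>+x. ennreal \<bar>w k x - tr\<Phi> x\<bar> \<partial>arclength (frontier (D i)))" for k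
    proof -
      have "(\<integral>\<^sup>+x. ennreal \<bar>w k x - M i\<bar> \<partial>arclength (frontier (D i)))
          = (\<integral>\<^sup>+x. ennreal \<bar>w k x - tr\<Phi> x\<bar> \<partial>arclength (frontier (D i)))"
        using const[OF i] by (intro nn_integral_cong_AE, eventually_elim) simp
      then show ?thesis
        using emeasure_bad_heights(2)[OF component_domain(5)[OF i] w[of k] \<delta>, of "M i"] by (simp add: bad_def)
    qed
  qed
  obtain e0 and Y :: "real \<Rightarrow> real set" where e0: "0 < e0"
    and Y: "\<And>e. 0 < e \<Longrightarrow> e < e0 \<Longrightarrow> Y e \<in> sets borel \<and> emeasure lborel (Y e) = ennreal e \<and> Y e \<subseteq> {-e<..<e}"
    and Yline: "\<And>e y. 0 < e \<Longrightarrow> e < e0 \<Longrightarrow> y \<in> Y e \<Longrightarrow> \<exists>x. pt x y \<in> D j"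
    using heights_near_axis[OF j(1)] by metis
  have "ennreal (\<delta> * e) \<le> (\<integral>\<^sup>+x. ennreal \<bar>G x\<bar> * indicator (strip e) x \<partial>?M)" if e: "0 < e" "e < e0" for e
  proof -
    have [measurable]: "Y e \<in> sets borel" using Y[OF e] by blast
    have im[measurable]: "indicator (strip e) \<in> borel_measurable ?M"
      using open_strip[of e] by (intro measurable_restrict_space1 borel_measurable_indicator) simp
    have ob: "\<Omega> \<inter> strip e \<in> sets borel" using open_\<Omega> open_strip by auto
    have "ennreal (\<delta> * e) \<le> (\<integral>\<^sup>+x. ennreal \<bar>G x\<bar> * indicator (strip e) x \<partial>?M)
        + (\<integral>\<^sup>+x. ennreal \<bar>partial_deriv 1 (w k) x - G x\<bar> \<partial>?M) + (\<Sum>i\<le>N. ennreal \<delta> * emeasure lborel (bad i k))" for k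
    proof -
      have [measurable]: "partial_deriv 1 (w k) \<in> borel_measurable borel"
        by (rule smooth_borel_measurable[OF smooth_partial_deriv[OF w]])
      let ?f = "\<lambda>z. ennreal \<bar>partial_deriv 1 (w k) z\<bar> * indicator (\<Omega> \<inter> strip e) z"
      have fm[measurable]: "?f \<in> borel_measurable borel" using ob by measurable
      \<comment> \<open>At a bad height the second summand alone is at least \<open>\<delta>\<close>.\<close>
      have line: "ennreal \<delta> * indicator (Y e) y
          \<le> (\<integral>\<^sup>+x. ?f (pt x y) \<partial>lborel) + (\<Sum>i\<le>N. ennreal \<delta> * indicator (bad i k) y)" for y
      proof (cases "y \<in> Y e \<and> (\<forall>i\<le>N. y \<notin> bad i k)")
        case True
        then obtain x where x: "pt x y \<in> D j" using Yline[OF e] by blast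
        have "y \<in> {-e<..<e}" using Y[OF e] True by blast
        then have "\<bar>y\<bar> < e" by auto
        have "ennreal \<delta> * indicator (Y e) y \<le> ennreal \<delta>" by (simp add: indicator_def)
        also have "\<dots> \<le> (\<integral>\<^sup>+x. ennreal \<bar>partial_deriv 1 (w k) (pt x y)\<bar> * indicator \<Omega> (pt x y) \<partial>lborel)"
        proof (rule line_integral_lower_bound[OF w j x gap])
          show "y \<notin> bad_heights (frontier (D i)) (w k) (M i) (2 * \<delta>)" if "i \<le> N" for i
            using True that unfolding bad_def by blast
        qed
        also have "\<dots> = (\<integral>\<^sup>+x. ?f (pt x y) \<partial>lborel)"
          using \<open>\<bar>y\<bar> < e\<close> by (intro nn_integral_cong) (simp add: indicator_def)
        also have "\<dots> \<le> (\<integral>\<^sup>+x. ?f (pt x y) \<partial>lborel) + (\<Sum>i\<le>N. ennreal \<delta> * indicator (bad i k) y)"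
          by simp
        finally show ?thesis .
      next
        case False
        show ?thesis
        proof (cases "y \<in> Y e")
          case True
          then obtain i where i: "i \<le> N" "y \<in> bad i k" using False by blast
          have "ennreal \<delta> * indicator (Y e) y \<le> ennreal \<delta> * indicator (bad i k) y" using i by (simp add: indicator_def)
          also have "\<dots> \<le> (\<Sum>i\<le>N. ennreal \<delta> * indicator (bad i k) y)"
            by (rule member_le_sum) (use i in auto)
          finally show ?thesis by (simp add: add_increasing)
        qed simp
      qed
      have "ennreal (\<delta> * e) = (\<integral>\<^sup>+y. ennreal \<delta> * indicator (Y e) y \<partial>lborel)"
        using Y[OF e] \<delta> by (simp add: nn_integral_cmult_indicator ennreal_mult')
      also have "\<dots> \<le> (\<integral>\<^sup>+y. (\<integral>\<^sup>+x. ?f (pt x y) \<partial>lborel) + (\<Sum>i\<le>N. ennreal \<delta> * indicator (bad i k) y) \<partial>lborel)"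
        by (intro nn_integral_mono line)
      also have "\<dots> = (\<integral>\<^sup>+y. \<integral>\<^sup>+x. ?f (pt x y) \<partial>lborel \<partial>lborel) + (\<integral>\<^sup>+y. (\<Sum>i\<le>N. ennreal \<delta> * indicator (bad i k) y) \<partial>lborel)"
      proof (rule nn_integral_add)
        have "(\<lambda>(y, x). ?f (pt x y)) \<in> borel_measurable (lborel \<Otimes>\<^sub>M lborel)"
          using measurable_compose[OF _ fm, of "\<lambda>z. pt (snd z) (fst z)" "lborel \<Otimes>\<^sub>M lborel"]
          by (simp add: case_prod_beta')
        then show "(\<lambda>y. \<integral>\<^sup>+x. ?f (pt x y) \<partial>lborel) \<in> borel_measurable lborel"
          using lborel.borel_measurable_nn_integral[of "\<lambda>y x. ?f (pt x y)" lborel] by simp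
        show "(\<lambda>y. \<Sum>i\<le>N. ennreal \<delta> * indicator (bad i k) y) \<in> borel_measurable lborel"
          using badm by (intro borel_measurable_sum borel_measurable_times_ennreal borel_measurable_indicator) auto
      qed
      also have "(\<integral>\<^sup>+y. \<integral>\<^sup>+x. ?f (pt x y) \<partial>lborel \<partial>lborel) = (\<integral>\<^sup>+z. ?f z \<partial>lborel)"
        by (rule nn_integral_plane[symmetric]) (rule fm)
      also have "(\<integral>\<^sup>+z. ?f z \<partial>lborel) = (\<integral>\<^sup>+x. ennreal \<bar>partial_deriv 1 (w k) x\<bar> * indicator (strip e) x \<partial>?M)"
        unfolding nn_integral_lebesgue_on[OF borel_\<Omega>] by (intro nn_integral_cong) (auto simp: indicator_def)
      also have "(\<integral>\<^sup>+y. (\<Sum>i\<le>N. ennreal \<delta> * indicator (bad i k) y) \<partial>lborel) = (\<Sum>i\<le>N. ennreal \<delta> * emeasure lborel (bad i k))"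
        using badm by (subst nn_integral_sum) (auto simp: nn_integral_cmult_indicator intro!: borel_measurable_times_ennreal borel_measurable_indicator sum.cong)
      finally have 1: "ennreal (\<delta> * e) \<le> (\<integral>\<^sup>+x. ennreal \<bar>partial_deriv 1 (w k) x\<bar> * indicator (strip e) x \<partial>?M)
          + (\<Sum>i\<le>N. ennreal \<delta> * emeasure lborel (bad i k))" .
      have "(\<integral>\<^sup>+x. ennreal \<bar>partial_deriv 1 (w k) x\<bar> * indicator (strip e) x \<partial>?M)
          \<le> (\<integral>\<^sup>+x. ennreal \<bar>G x\<bar> * indicator (strip e) x + ennreal \<bar>partial_deriv 1 (w k) x - G x\<bar> \<partial>?M)"
      proof (rule nn_integral_mono)
        fix x
        have "ennreal \<bar>partial_deriv 1 (w k) x\<bar> \<le> ennreal (\<bar>G x\<bar> + \<bar>partial_deriv 1 (w k) x - G x\<bar>)"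
          by (rule ennreal_leI) linarith
        then have "ennreal \<bar>partial_deriv 1 (w k) x\<bar> \<le> ennreal \<bar>G x\<bar> + ennreal \<bar>partial_deriv 1 (w k) x - G x\<bar>"
          by (simp add: ennreal_plus)
        then show "ennreal \<bar>partial_deriv 1 (w k) x\<bar> * indicator (strip e) x
            \<le> ennreal \<bar>G x\<bar> * indicator (strip e) x + ennreal \<bar>partial_deriv 1 (w k) x - G x\<bar>"
          by (auto simp: indicator_def)
      qed
      also have "\<dots> = (\<integral>\<^sup>+x. ennreal \<bar>G x\<bar> * indicator (strip e) x \<partial>?M) + (\<integral>\<^sup>+x. ennreal \<bar>partial_deriv 1 (w k) x - G x\<bar> \<partial>?M)"
        by (rule nn_integral_add) measurable
      finally show ?thesis using 1 by (meson add_right_mono order_trans)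
    qed
    moreover have "(\<lambda>k. (\<integral>\<^sup>+x. ennreal \<bar>G x\<bar> * indicator (strip e) x \<partial>?M)
        + (\<integral>\<^sup>+x. ennreal \<bar>partial_deriv 1 (w k) x - G x\<bar> \<partial>?M) + (\<Sum>i\<le>N. ennreal \<delta> * emeasure lborel (bad i k)))
        \<longlonglongrightarrow> (\<integral>\<^sup>+x. ennreal \<bar>G x\<bar> * indicator (strip e) x \<partial>?M) + 0 + (\<Sum>i\<le>N. 0)"
      by (intro tendsto_add tendsto_const w1 tendsto_sum bad0) simp
    ultimately have "ennreal (\<delta> * e) \<le> (\<integral>\<^sup>+x. ennreal \<bar>G x\<bar> * indicator (strip e) x \<partial>?M) + 0 + (\<Sum>i\<le>N. 0)"
      by (intro tendsto_lowerbound[OF _ always_eventually trivial_limit_sequentially]) auto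
    then show ?thesis by simp
  qed
  then show ?thesis using \<delta> e0 unfolding G_def by blast
qed

end

lemma ennreal_square_le_product:
  assumes "ennreal (a * e) \<le> I" "I\<^sup>2 \<le> ennreal (C * e\<^sup>2) * J" "J < ennreal \<eta>"
    and "0 < a" "0 < e" "0 \<le> C" "0 < \<eta>"
  shows "a\<^sup>2 \<le> C * \<eta>"
proof -
  have "ennreal ((a * e)\<^sup>2) = (ennreal (a * e))\<^sup>2"
    using assms by (simp add: ennreal_power)
  also have "\<dots> \<le> I\<^sup>2" by (rule power_mono[OF assms(1)]) simp
  also have "\<dots> \<le> ennreal (C * e\<^sup>2) * J" by (rule assms(2))
  also have "\<dots> \<le> ennreal (C * e\<^sup>2) * ennreal \<eta>" by (rule mult_left_mono) (use assms(3) in auto)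
  also have "\<dots> = ennreal (C * e\<^sup>2 * \<eta>)" by (rule ennreal_mult'[symmetric]) (use assms in simp)
  finally have "(a * e)\<^sup>2 \<le> C * e\<^sup>2 * \<eta>" using assms by (subst (asm) ennreal_le_iff) auto
  then have "e\<^sup>2 * a\<^sup>2 \<le> e\<^sup>2 * (C * \<eta>)" by (simp add: power_mult_distrib mult_ac)
  then show ?thesis using assms(5) by simp
qed

theorem theorem7p1:
  fixes N :: nat
    and D :: "nat \<Rightarrow> (real^2) set"
    and \<Omega> :: "(real^2) set"
    and v :: "real^2 \<Rightarrow> real^2"
    and p :: "real^2 \<Rightarrow> real"
    and trace_\<Phi> :: "real^2 \<Rightarrow> real"
    and \<Phi>hat :: "nat \<Rightarrow> real"
  assumes "admissible N D"
    and "\<Omega> = perforated N D"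
    and "v \<in> JS \<Omega>"
    and "\<And>q. 1 \<le> q \<Longrightarrow> q < 2 \<Longrightarrow> p \<in> W1 q \<Omega>"
    and "steady_euler \<Omega> v p"
    and "has_trace 1 \<Omega> (total_head v p) trace_\<Phi>"
    and "\<And>j. j \<le> N \<Longrightarrow> AE x in arclength (frontier (D j)). trace_\<Phi> x = \<Phi>hat j"
  shows "\<forall>j\<le>N. \<Phi>hat j = \<Phi>hat 0"
proof (rule ccontr)
  assume "\<not> (\<forall>j\<le>N. \<Phi>hat j = \<Phi>hat 0)"
  then obtain j where j: "j \<le> N" "\<Phi>hat j \<noteq> \<Phi>hat 0" by blast
  interpret admissible_domain N D \<Omega>
    by (rule admissible_domain.intro[OF assms(1,2)])
  let ?M = "lebesgue_on \<Omega>"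
  define a b where "a = weak_partial \<Omega> 1 (\<lambda>y. v y $ 2)" and "b = weak_partial \<Omega> 2 (\<lambda>y. v y $ 1)"
  obtain \<delta> e0 where \<delta>: "0 < \<delta>" "0 < e0" and jump: "\<And>e. 0 < e \<Longrightarrow> e < e0 \<Longrightarrow>
      ennreal (\<delta> * e) \<le> (\<integral>\<^sup>+x. ennreal \<bar>weak_partial \<Omega> 1 (total_head v p) x\<bar> * indicator (strip e) x \<partial>?M)"
    using head_jump_le_strip_integral[OF assms(6,7) j] by blast
  have v: "(\<lambda>x. v x $ i) \<in> W1 2 \<Omega>" for i using assms(3) by (simp add: JS_def)
  obtain g :: "real^2 \<Rightarrow> real^2" where "\<And>i. has_trace 2 \<Omega> (\<lambda>x. v x $ i) (\<lambda>x. g x $ i)"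
    using assms(3) unfolding JS_def zero_normal_trace_def by blast
  then have tr2: "has_trace 2 \<Omega> (\<lambda>x. v x $ 2) (\<lambda>x. g x $ 2)" by blast
  have odd: "AE x in ?M. v (reflect x) $ 2 = - (v x $ 2)"
  proof -
    have "AE x in ?M. v (reflect x) $ 1 = v x $ 1 \<and> v (reflect x) $ 2 = - (v x $ 2)"
      using assms(3) by (simp add: JS_def symmetric_field_def)
    then show ?thesis by eventually_elim simp
  qed
  obtain C e1 where C: "0 \<le> C" "0 < e1" and strip2: "\<And>e. 0 < e \<Longrightarrow> e < e1 \<Longrightarrow>
      (\<integral>\<^sup>+x. ennreal ((v x $ 2)\<^sup>2) * indicator (strip e) x \<partial>?M) \<le> ennreal (C * e\<^sup>2)"
    using odd_W12_strip_estimate[OF tr2 odd] by blast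
  have [measurable]: "(\<lambda>x. v x $ i) \<in> borel_measurable ?M" "a \<in> borel_measurable ?M" "b \<in> borel_measurable ?M" for i
    unfolding a_def b_def by (rule W1_measurable[OF v])+
  have head: "total_head v p \<in> W1 1 \<Omega>" using assms(6) by (simp add: has_trace_def)
  have "p \<in> W1 1 \<Omega>" by (rule assms(4)) simp_all
  from head_derivative_eq_vorticity_times_velocity[OF open_\<Omega> assms(5) this head]
  have G: "AE x in ?M. weak_partial \<Omega> 1 (total_head v p) x = v x $ 2 * (a x - b x)"
    unfolding a_def b_def .
  have afin: "(\<integral>\<^sup>+x. ennreal ((a x)\<^sup>2) \<partial>?M) < \<infinity>" "(\<integral>\<^sup>+x. ennreal ((b x)\<^sup>2) \<partial>?M) < \<infinity>"
    unfolding a_def b_def by (rule W1_two_finite(2)[OF v])+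
  have "(\<integral>\<^sup>+x. ennreal ((a x - b x)\<^sup>2) \<partial>?M) \<le> (\<integral>\<^sup>+x. 2 * ennreal ((a x)\<^sup>2) + 2 * ennreal ((b x)\<^sup>2) \<partial>?M)"
  proof (intro nn_integral_mono ennreal_le_two_sum)
    show "(a x - b x)\<^sup>2 \<le> 2 * (a x)\<^sup>2 + 2 * (b x)\<^sup>2" for x
      using zero_le_power2[of "a x + b x"] by (simp add: power2_eq_square algebra_simps)
  qed auto
  also have "\<dots> < \<infinity>"
    using afin by (simp add: nn_integral_add nn_integral_cmult ennreal_mult_eq_top_iff less_top[symmetric])
  finally have \<omega>fin: "(\<integral>\<^sup>+x. ennreal ((a x - b x)\<^sup>2) \<partial>?M) < \<infinity>" .
  \<comment> \<open>A bound on the vorticity so small that \<open>C \<eta> < \<delta>\<^sup>2\<close>.\<close>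
  define \<eta> where "\<eta> = \<delta>\<^sup>2 / (2 * (C + 1))"
  have \<eta>: "0 < \<eta>" using \<delta> C by (simp add: \<eta>_def)
  have "(\<lambda>n. \<integral>\<^sup>+x. ennreal ((a x - b x)\<^sup>2) * indicator (strip (1 / real (Suc n))) x \<partial>?M) \<longlonglongrightarrow> 0"
    by (rule strip_integral_tendsto_0) (use \<omega>fin in auto)
  then have "eventually (\<lambda>n. (\<integral>\<^sup>+x. ennreal ((a x - b x)\<^sup>2) * indicator (strip (1 / real (Suc n))) x \<partial>?M) < ennreal \<eta>) sequentially"
    by (rule order_tendstoD) (use \<eta> in simp)
  moreover have "eventually (\<lambda>n. 1 / real (Suc n) < min e0 e1) sequentially"
    using order_tendstoD(2)[OF LIMSEQ_inverse_real_of_nat, of "min e0 e1"] \<delta>(2) C(2) by (simp add: inverse_eq_divide)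
  ultimately have "eventually (\<lambda>n. (\<integral>\<^sup>+x. ennreal ((a x - b x)\<^sup>2) * indicator (strip (1 / real (Suc n))) x \<partial>?M) < ennreal \<eta>
      \<and> 1 / real (Suc n) < min e0 e1) sequentially"
    by (rule eventually_conj)
  then obtain n where n: "(\<integral>\<^sup>+x. ennreal ((a x - b x)\<^sup>2) * indicator (strip (1 / real (Suc n))) x \<partial>?M) < ennreal \<eta>"
    "1 / real (Suc n) < min e0 e1"
    by (auto simp: eventually_sequentially)
  define e where "e = 1 / real (Suc n)"
  have e: "0 < e" "e < e0" "e < e1" using n(2) by (auto simp: e_def)
  have im[measurable]: "indicator (strip e) \<in> borel_measurable ?M"
    using open_strip[of e] by (intro measurable_restrict_space1 borel_measurable_indicator) simp
  define J where "J = (\<integral>\<^sup>+x. ennreal \<bar>v x $ 2\<bar> * indicator (strip e) x * (ennreal \<bar>a x - b x\<bar> * indicator (strip e) x) \<partial>?M)"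
  have "(\<integral>\<^sup>+x. ennreal \<bar>weak_partial \<Omega> 1 (total_head v p) x\<bar> * indicator (strip e) x \<partial>?M) = J"
    unfolding J_def using G
    by (intro nn_integral_cong_AE, eventually_elim) (simp add: abs_mult ennreal_mult' indicator_def)
  then have 1: "ennreal (\<delta> * e) \<le> J" using jump[OF e(1,2)] by simp
  have "J\<^sup>2 \<le> (\<integral>\<^sup>+x. (ennreal \<bar>v x $ 2\<bar> * indicator (strip e) x)\<^sup>2 \<partial>?M)
      * (\<integral>\<^sup>+x. (ennreal \<bar>a x - b x\<bar> * indicator (strip e) x)\<^sup>2 \<partial>?M)"
    unfolding J_def by (rule Cauchy_Schwarz_nn_integral) measurable
  also have "(\<integral>\<^sup>+x. (ennreal \<bar>v x $ 2\<bar> * indicator (strip e) x)\<^sup>2 \<partial>?M)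
      = (\<integral>\<^sup>+x. ennreal ((v x $ 2)\<^sup>2) * indicator (strip e) x \<partial>?M)"
    by (intro nn_integral_cong) (simp add: indicator_def ennreal_power)
  also have "(\<integral>\<^sup>+x. (ennreal \<bar>a x - b x\<bar> * indicator (strip e) x)\<^sup>2 \<partial>?M)
      = (\<integral>\<^sup>+x. ennreal ((a x - b x)\<^sup>2) * indicator (strip e) x \<partial>?M)"
    by (intro nn_integral_cong) (simp add: indicator_def ennreal_power)
  finally have "J\<^sup>2 \<le> (\<integral>\<^sup>+x. ennreal ((v x $ 2)\<^sup>2) * indicator (strip e) x \<partial>?M)
      * (\<integral>\<^sup>+x. ennreal ((a x - b x)\<^sup>2) * indicator (strip e) x \<partial>?M)" .
  also have "\<dots> \<le> ennreal (C * e\<^sup>2) * (\<integral>\<^sup>+x. ennreal ((a x - b x)\<^sup>2) * indicator (strip e) x \<partial>?M)"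
    by (rule mult_right_mono[OF strip2[OF e(1,3)]]) simp
  finally have "\<delta>\<^sup>2 \<le> C * \<eta>"
    by (rule ennreal_square_le_product[OF 1 _ n(1)[folded e_def] \<delta>(1) e(1) C(1) \<eta>])
  also have "\<dots> \<le> \<delta>\<^sup>2 / 2"
    using C(1) by (simp add: \<eta>_def field_simps)
  finally show False using \<delta>(1) by simp
qed

end
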